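(* Let $X\in\{F,T,V,\mathcal O\}$. If $\sigma_1,\sigma_2$ are two diffuse Pythagorean representations of $X$, then $$\dim_P(\sigma_1\oplus\sigma_2)=\dim_P(\sigma_1)+\dim_P(\sigma_2),$$ with the convention that any addition involving $\infty$ is equal to $\infty$.
   Context: All Hilbert spaces are complex, group representations are unitary, and representations of C*-algebras are unital and $*$-preserving. $F\subset T\subset V$ are Richard Thompson's groups: $V$ is the group of homeomorphisms of the Cantor space $\{0,1\}^{\mathbf N^*}$ of the form $\mu_j\cdot w\mapsto\nu_j\cdot w$ ($1\le j\le n$, $w$ infinite word), where $(\mu_j)$, $(\nu_j)$ are lists of finite binary words each defining a standard partition of the Cantor space; $T$, resp. $F$, is the subgroup of elements preserving the cyclic, resp. linear, (lexicographic) order of the pieces. The Cuntz algebra $\mathcal O$ is the universal C*-algebra generated by $s_0,s_1$ with $s_0s_0^*+s_1s_1^*=s_0^*s_0=s_1^*s_1=1$; $V$ is identified with a group of unitaries of $\mathcal O$ by sending the homeomorphism $\mu_j\cdot w\mapsto\nu_j\cdot w$ ($1\le j\le n$, $w$ infinite word) to $\sum_j s_{\nu_j}s_{\mu_j}^*$. A P-module is a triple $(A,B,\mathfrak H)$ where $\mathfrak H$ is a Hilbert space and $A,B\in B(\mathfrak H)$ satisfy $A^*A+B^*B=\mathrm{id}_{\mathfrak H}$. It is diffuse if $\lim_{n\to\infty}x_n\cdots x_1\xi=0$ for every $\xi\in\mathfrak H$ and every infinite sequence $(x_n)$ in $\{A,B\}$. Given a P-module $(A,B,\mathfrak H)$,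 for each finite rooted binary tree $t$ (each vertex has $0$ or $2$ children) let $\mathfrak H_t:=\bigoplus_{\ell\in \mathrm{Leaf}(t)}\mathfrak H$. If $s$ is obtained from $t$ by attaching one caret at the leaf $\ell$, the isometry $\mathfrak H_t\to\mathfrak H_s$ replaces $\xi_\ell$ by $A\xi_\ell$ at the new left leaf and $B\xi_\ell$ at the new right leaf, leaving other components unchanged; compositions give a directed system, and $\mathscr H$ is the Hilbert space completion of the direct limit. The class of $\xi\in\mathfrak H_t$ is written $[t,\xi]$. For $t$ nontrivial with left and right subtrees $t_0,t_1$ at the children of the root, set $\tau_i([t,\xi]):=[t_i,\xi|_{\mathrm{Leaf}(t_i)}]$, $i=0,1$, extended to $\mathscr H$. Then $\Pi^{\mathcal O}(A,B,\mathfrak H)$ is the representation $s_i\mapsto\tau_i^*$ of $\mathcal O$ on $\mathscr H$, and $\Pi^V,\Pi^T,\Pi^F$ are its restrictions to $V,T,F$. A representation of $X$ is Pythagorean if it is unitarily equivalent to $\Pi^X(m)$ for some P-module $m$, and diffuse if $m$ can be taken diffuse. The P-dimension $\dim_P(\sigma)$ of a Pythagorean representation $\sigma$ of $X$ is the minimal $\dim(\mathfrak H)$ over all finite dimensional P-modules $m=(A,B,\mathfrak H)$ with $\Pi^X(m)\simeq\sigma$, and $\infty$ if none exists. *)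

theory Defs
  imports Complex_Main "HOL-Algebra.Module" "HOL-Library.Stream" "HOL-Library.Extended_Nat"
begin

section \<open>Complex Hilbert spaces\<close>

text \<open>
  Hilbert spaces are structures with an explicit carrier, since the space of a Pythagorean
  representation is built from a P-module (as a completed direct limit) and hence is not a type.
  The linear structure is that of a module in the sense of HOL-Algebra; the \<open>mult\<close> and \<open>one\<close> fields
  which such a record inherits are irrelevant. Operators are functions of which only the
  restriction to the carrier matters.
\<close>

definition complex_field :: "complex ring" where
  "complex_field = \<lparr>carrier = UNIV, mult = (*), one = 1, zero = 0, add = (+)\<rparr>"

record 'a hspace = "(complex, 'a) module" +
  hinner :: "'a \<Rightarrow> 'a \<Rightarrow> complex"

locale inner_product_space = Module.module complex_field H for H :: "'a hspace" (structure) +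
  assumes hinner_add_left:
    "\<lbrakk>x \<in> carrier H; y \<in> carrier H; z \<in> carrier H\<rbrakk> \<Longrightarrow> hinner H (x \<oplus> y) z = hinner H x z + hinner H y z"
  and hinner_smult_left:
    "\<lbrakk>x \<in> carrier H; y \<in> carrier H\<rbrakk> \<Longrightarrow> hinner H (c \<odot> x) y = c * hinner H x y"
  and hinner_commute:
    "\<lbrakk>x \<in> carrier H; y \<in> carrier H\<rbrakk> \<Longrightarrow> hinner H y x = cnj (hinner H x y)"
  and hinner_nonneg:
    "x \<in> carrier H \<Longrightarrow> 0 \<le> Re (hinner H x x)"
  and hinner_definite:
    "\<lbrakk>x \<in> carrier H; hinner H x x = 0\<rbrakk> \<Longrightarrow> x = \<zero>"

definition hnorm :: "'a hspace \<Rightarrow> 'a \<Rightarrow> real" where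
  "hnorm H x = sqrt (Re (hinner H x x))"

definition hCauchy :: "'a hspace \<Rightarrow> (nat \<Rightarrow> 'a) \<Rightarrow> bool" where
  "hCauchy H f \<longleftrightarrow> (\<forall>n. f n \<in> carrier H) \<and>
     (\<forall>e>0. \<exists>N. \<forall>m\<ge>N. \<forall>n\<ge>N. hnorm H (f m \<ominus>\<^bsub>H\<^esub> f n) < e)"

definition hlim :: "'a hspace \<Rightarrow> (nat \<Rightarrow> 'a) \<Rightarrow> 'a \<Rightarrow> bool" where
  "hlim H f x \<longleftrightarrow> (\<lambda>n. hnorm H (f n \<ominus>\<^bsub>H\<^esub> x)) \<longlonglongrightarrow> 0"

locale hilbert_space = inner_product_space +
  assumes complete: "hCauchy H f \<Longrightarrow> \<exists>x\<in>carrier H. hlim H f x"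

text \<open>\<open>has_dim H n\<close>: the Hilbert space \<open>H\<close> has an orthonormal basis with \<open>n\<close> elements.\<close>

definition has_dim :: "'a hspace \<Rightarrow> nat \<Rightarrow> bool" where
  "has_dim H n \<longleftrightarrow> (\<exists>e :: nat \<Rightarrow> 'a.
     (\<forall>i<n. e i \<in> carrier H) \<and>
     (\<forall>i<n. \<forall>j<n. hinner H (e i) (e j) = (if i = j then 1 else 0)) \<and>
     (\<forall>x\<in>carrier H. x = (\<Oplus>\<^bsub>H\<^esub>i\<in>{..<n}. hinner H x (e i) \<odot>\<^bsub>H\<^esub> e i)))"

definition linear_op :: "'a hspace \<Rightarrow> 'b hspace \<Rightarrow> ('a \<Rightarrow> 'b) \<Rightarrow> bool" where
  "linear_op H K T \<longleftrightarrow>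
     (\<forall>x\<in>carrier H. T x \<in> carrier K) \<and>
     (\<forall>x\<in>carrier H. \<forall>y\<in>carrier H. T (x \<oplus>\<^bsub>H\<^esub> y) = T x \<oplus>\<^bsub>K\<^esub> T y) \<and>
     (\<forall>c. \<forall>x\<in>carrier H. T (c \<odot>\<^bsub>H\<^esub> x) = c \<odot>\<^bsub>K\<^esub> T x)"

definition bounded_op :: "'a hspace \<Rightarrow> 'b hspace \<Rightarrow> ('a \<Rightarrow> 'b) \<Rightarrow> bool" where
  "bounded_op H K T \<longleftrightarrow> linear_op H K T \<and> (\<exists>c. \<forall>x\<in>carrier H. hnorm K (T x) \<le> c * hnorm H x)"

definition unitary_op :: "'a hspace \<Rightarrow> 'b hspace \<Rightarrow> ('a \<Rightarrow> 'b) \<Rightarrow> bool" where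
  "unitary_op H K U \<longleftrightarrow> linear_op H K U \<and> bij_betw U (carrier H) (carrier K) \<and>
     (\<forall>x\<in>carrier H. \<forall>y\<in>carrier H. hinner K (U x) (U y) = hinner H x y)"

definition adjoint :: "'a hspace \<Rightarrow> ('a \<Rightarrow> 'a) \<Rightarrow> 'a \<Rightarrow> 'a" where
  "adjoint H T y = (THE x. x \<in> carrier H \<and> (\<forall>z\<in>carrier H. hinner H (T z) y = hinner H z x))"

definition hsum :: "'a hspace \<Rightarrow> 'b hspace \<Rightarrow> ('a \<times> 'b) hspace" where
  "hsum H K = \<lparr>carrier = carrier H \<times> carrier K, mult = undefined, one = undefined,
     zero = (\<zero>\<^bsub>H\<^esub>, \<zero>\<^bsub>K\<^esub>),
     add = (\<lambda>(x, y) (x', y'). (x \<oplus>\<^bsub>H\<^esub> x', y \<oplus>\<^bsub>K\<^esub> y')),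
     smult = (\<lambda>c (x, y). (c \<odot>\<^bsub>H\<^esub> x, c \<odot>\<^bsub>K\<^esub> y)),
     hinner = (\<lambda>(x, y) (x', y'). hinner H x x' + hinner K y y')\<rparr>"

subsection \<open>Completion of an inner product space\<close>

text \<open>Cauchy sequences modulo null sequences, with the operations acting on representatives.\<close>

definition null_rel :: "'a hspace \<Rightarrow> ((nat \<Rightarrow> 'a) \<times> (nat \<Rightarrow> 'a)) set" where
  "null_rel S = {(f, g). hCauchy S f \<and> hCauchy S g \<and> (\<lambda>n. hnorm S (f n \<ominus>\<^bsub>S\<^esub> g n)) \<longlonglongrightarrow> 0}"

definition cclass :: "'a hspace \<Rightarrow> (nat \<Rightarrow> 'a) \<Rightarrow> (nat \<Rightarrow> 'a) set" where
  "cclass S f = null_rel S `` {f}"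

definition completion :: "'a hspace \<Rightarrow> (nat \<Rightarrow> 'a) set hspace" where
  "completion S = \<lparr>carrier = {f. hCauchy S f} // null_rel S, mult = undefined, one = undefined,
     zero = cclass S (\<lambda>n. \<zero>\<^bsub>S\<^esub>),
     add = (\<lambda>X Y. THE Z. \<exists>f\<in>X. \<exists>g\<in>Y. Z = cclass S (\<lambda>n. f n \<oplus>\<^bsub>S\<^esub> g n)),
     smult = (\<lambda>c X. THE Z. \<exists>f\<in>X. Z = cclass S (\<lambda>n. c \<odot>\<^bsub>S\<^esub> f n)),
     hinner = (\<lambda>X Y. THE z. \<exists>f\<in>X. \<exists>g\<in>Y. (\<lambda>n. hinner S (f n) (g n)) \<longlonglongrightarrow> z)\<rparr>"

definition extend_op :: "'a hspace \<Rightarrow> ('a \<Rightarrow> 'a) \<Rightarrow> (nat \<Rightarrow> 'a) set \<Rightarrow> (nat \<Rightarrow> 'a) set" where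
  "extend_op S T X = (THE Z. \<exists>f\<in>X. Z = cclass S (\<lambda>n. T (f n)))"

section \<open>P-modules\<close>

definition P_module :: "'a hspace \<Rightarrow> ('a \<Rightarrow> 'a) \<Rightarrow> ('a \<Rightarrow> 'a) \<Rightarrow> bool" where
  "P_module H A B \<longleftrightarrow> hilbert_space H \<and> bounded_op H H A \<and> bounded_op H H B \<and>
     (\<forall>\<xi>\<in>carrier H. adjoint H A (A \<xi>) \<oplus>\<^bsub>H\<^esub> adjoint H B (B \<xi>) = \<xi>)"

primrec iter_op :: "('a \<Rightarrow> 'a) \<Rightarrow> ('a \<Rightarrow> 'a) \<Rightarrow> (nat \<Rightarrow> bool) \<Rightarrow> nat \<Rightarrow> 'a \<Rightarrow> 'a" where
  "iter_op A B x 0 \<xi> = \<xi>"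
| "iter_op A B x (Suc n) \<xi> = (if x n then B else A) (iter_op A B x n \<xi>)"

definition diffuse :: "'a hspace \<Rightarrow> ('a \<Rightarrow> 'a) \<Rightarrow> ('a \<Rightarrow> 'a) \<Rightarrow> bool" where
  "diffuse H A B \<longleftrightarrow> (\<forall>x. \<forall>\<xi>\<in>carrier H. hlim H (\<lambda>n. iter_op A B x n \<xi>) \<zero>\<^bsub>H\<^esub>)"

subsection \<open>The direct limit over rooted binary trees\<close>

text \<open>
  A pair \<open>(t, \<xi>)\<close> of a finite rooted binary tree \<open>t\<close> and a vector \<open>\<xi>\<close> of the direct sum of copies of
  \<open>H\<close> over the leaves of \<open>t\<close> is the same thing as a binary tree whose leaves are labelled by
  vectors of \<open>H\<close>, the component of \<open>\<xi>\<close> at a leaf being the label; \<open>t\<close> is recovered by forgetting the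
  labels.
\<close>

datatype (labels: 'a) dtree = Leaf 'a | Node "'a dtree" "'a dtree"

definition shape :: "'a dtree \<Rightarrow> unit dtree" where
  "shape t = map_dtree (\<lambda>_. ()) t"

text \<open>Attaching one caret at one leaf.\<close>

inductive caret :: "('a \<Rightarrow> 'a) \<Rightarrow> ('a \<Rightarrow> 'a) \<Rightarrow> 'a dtree \<Rightarrow> 'a dtree \<Rightarrow> bool"
  for A B where
  caret_leaf: "caret A B (Leaf \<xi>) (Node (Leaf (A \<xi>)) (Leaf (B \<xi>)))"
| caret_left: "caret A B l l' \<Longrightarrow> caret A B (Node l r) (Node l' r)"
| caret_right: "caret A B r r' \<Longrightarrow> caret A B (Node l r) (Node l r')"

abbreviation grows :: "('a \<Rightarrow> 'a) \<Rightarrow> ('a \<Rightarrow> 'a) \<Rightarrow> 'a dtree \<Rightarrow> 'a dtree \<Rightarrow> bool" where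
  "grows A B \<equiv> (caret A B)\<^sup>*\<^sup>*"

definition dl_rel :: "'a hspace \<Rightarrow> ('a \<Rightarrow> 'a) \<Rightarrow> ('a \<Rightarrow> 'a) \<Rightarrow> ('a dtree \<times> 'a dtree) set" where
  "dl_rel H A B = {(s, t). labels s \<subseteq> carrier H \<and> labels t \<subseteq> carrier H \<and>
     (\<exists>u. grows A B s u \<and> grows A B t u)}"

definition dl_class :: "'a hspace \<Rightarrow> ('a \<Rightarrow> 'a) \<Rightarrow> ('a \<Rightarrow> 'a) \<Rightarrow> 'a dtree \<Rightarrow> 'a dtree set" where
  "dl_class H A B t = dl_rel H A B `` {t}"

text \<open>The two functions below are only used on trees of the same shape.\<close>

fun dtree_add :: "'a hspace \<Rightarrow> 'a dtree \<Rightarrow> 'a dtree \<Rightarrow> 'a dtree" where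
  "dtree_add H (Leaf x) (Leaf y) = Leaf (x \<oplus>\<^bsub>H\<^esub> y)"
| "dtree_add H (Node l r) (Node l' r') = Node (dtree_add H l l') (dtree_add H r r')"
| "dtree_add H _ _ = undefined"

fun dtree_inner :: "'a hspace \<Rightarrow> 'a dtree \<Rightarrow> 'a dtree \<Rightarrow> complex" where
  "dtree_inner H (Leaf x) (Leaf y) = hinner H x y"
| "dtree_inner H (Node l r) (Node l' r') = dtree_inner H l l' + dtree_inner H r r'"
| "dtree_inner H _ _ = undefined"

definition dlimit :: "'a hspace \<Rightarrow> ('a \<Rightarrow> 'a) \<Rightarrow> ('a \<Rightarrow> 'a) \<Rightarrow> 'a dtree set hspace" where
  "dlimit H A B = \<lparr>carrier = {t. labels t \<subseteq> carrier H} // dl_rel H A B,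
     mult = undefined, one = undefined,
     zero = dl_class H A B (Leaf \<zero>\<^bsub>H\<^esub>),
     add = (\<lambda>X Y. THE Z. \<exists>s\<in>X. \<exists>t\<in>Y. shape s = shape t \<and> Z = dl_class H A B (dtree_add H s t)),
     smult = (\<lambda>c X. THE Z. \<exists>t\<in>X. Z = dl_class H A B (map_dtree (\<lambda>x. c \<odot>\<^bsub>H\<^esub> x) t)),
     hinner = (\<lambda>X Y. THE z. \<exists>s\<in>X. \<exists>t\<in>Y. shape s = shape t \<and> z = dtree_inner H s t)\<rparr>"

definition subtree_op ::
  "'a hspace \<Rightarrow> ('a \<Rightarrow> 'a) \<Rightarrow> ('a \<Rightarrow> 'a) \<Rightarrow> bool \<Rightarrow> 'a dtree set \<Rightarrow> 'a dtree set" where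
  "subtree_op H A B i X =
     (THE Z. \<exists>l r. Node l r \<in> X \<and> Z = dl_class H A B (if i then r else l))"

definition Pi_space :: "'a hspace \<Rightarrow> ('a \<Rightarrow> 'a) \<Rightarrow> ('a \<Rightarrow> 'a) \<Rightarrow> (nat \<Rightarrow> 'a dtree set) set hspace" where
  "Pi_space H A B = completion (dlimit H A B)"

definition tau :: "'a hspace \<Rightarrow> ('a \<Rightarrow> 'a) \<Rightarrow> ('a \<Rightarrow> 'a) \<Rightarrow> bool \<Rightarrow>
    (nat \<Rightarrow> 'a dtree set) set \<Rightarrow> (nat \<Rightarrow> 'a dtree set) set" where
  "tau H A B i = extend_op (dlimit H A B) (subtree_op H A B i)"

section \<open>Thompson's groups and the Cuntz algebra\<close>

text \<open>
  The digits 0 and 1 are \<open>False\<close> and \<open>True\<close>; the Cantor space is the type \<open>bool stream\<close>, and \<open>u @- w\<close>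
  is the concatenation of the finite word \<open>u\<close> with the infinite word \<open>w\<close>.
\<close>

definition standard_partition :: "bool list list \<Rightarrow> bool" where
  "standard_partition \<mu> \<longleftrightarrow> (\<forall>x :: bool stream. \<exists>!j. j < length \<mu> \<and> (\<exists>w. x = \<mu> ! j @- w))"

definition is_table :: "(bool stream \<Rightarrow> bool stream) \<Rightarrow> bool list list \<Rightarrow> bool list list \<Rightarrow> bool" where
  "is_table v \<mu> \<nu> \<longleftrightarrow> standard_partition \<mu> \<and> standard_partition \<nu> \<and> length \<mu> = length \<nu> \<and>
     (\<forall>j<length \<mu>. \<forall>w. v (\<mu> ! j @- w) = \<nu> ! j @- w)"

definition lex_sorted :: "bool list list \<Rightarrow> bool" where
  "lex_sorted \<mu> \<longleftrightarrow> sorted_wrt (\<lambda>u u'. (u, u') \<in> lexord {(False, True)}) \<mu>"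

definition thompson_V :: "(bool stream \<Rightarrow> bool stream) set" where
  "thompson_V = {v. \<exists>\<mu> \<nu>. is_table v \<mu> \<nu>}"

definition thompson_T :: "(bool stream \<Rightarrow> bool stream) set" where
  "thompson_T = {v. \<exists>\<mu> \<nu> k. is_table v \<mu> \<nu> \<and> lex_sorted \<mu> \<and> lex_sorted (rotate k \<nu>)}"

definition thompson_F :: "(bool stream \<Rightarrow> bool stream) set" where
  "thompson_F = {v. \<exists>\<mu> \<nu>. is_table v \<mu> \<nu> \<and> lex_sorted \<mu> \<and> lex_sorted \<nu>}"

text \<open>
  Representations of the three groups and of the Cuntz algebra are treated uniformly as families of
  operators. For a group, the family is indexed by the group. For the Cuntz algebra it is indexed by
  the two generators: by the universal property which defines this algebra, a unital
  \<open>*\<close>-representation of it is the same as a pair of operators satisfying the defining relations, and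
  direct sums and unitary equivalences of representations can be read off from these pairs.
\<close>

datatype group_or_algebra = Thompson_F | Thompson_T | Thompson_V | Cuntz

datatype elem = Homeo "bool stream \<Rightarrow> bool stream" | Gen bool

fun elems :: "group_or_algebra \<Rightarrow> elem set" where
  "elems Thompson_F = Homeo ` thompson_F"
| "elems Thompson_T = Homeo ` thompson_T"
| "elems Thompson_V = Homeo ` thompson_V"
| "elems Cuntz = range Gen"

definition group_rep ::
  "(bool stream \<Rightarrow> bool stream) set \<Rightarrow> 'a hspace \<Rightarrow> ((bool stream \<Rightarrow> bool stream) \<Rightarrow> 'a \<Rightarrow> 'a) \<Rightarrow> bool" where
  "group_rep G H \<pi> \<longleftrightarrow> hilbert_space H \<and>
     (\<forall>g\<in>G. unitary_op H H (\<pi> g)) \<and>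
     (\<forall>x\<in>carrier H. \<pi> id x = x) \<and>
     (\<forall>g\<in>G. \<forall>h\<in>G. \<forall>x\<in>carrier H. \<pi> (g \<circ> h) x = \<pi> g (\<pi> h x))"

definition cuntz_rep :: "'a hspace \<Rightarrow> (bool \<Rightarrow> 'a \<Rightarrow> 'a) \<Rightarrow> bool" where
  "cuntz_rep H S \<longleftrightarrow> hilbert_space H \<and>
     (\<forall>i. bounded_op H H (S i)) \<and>
     (\<forall>x\<in>carrier H. S False (adjoint H (S False) x) \<oplus>\<^bsub>H\<^esub> S True (adjoint H (S True) x) = x) \<and>
     (\<forall>i. \<forall>x\<in>carrier H. adjoint H (S i) (S i x) = x)"

fun is_rep :: "group_or_algebra \<Rightarrow> 'a hspace \<Rightarrow> (elem \<Rightarrow> 'a \<Rightarrow> 'a) \<Rightarrow> bool" where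
  "is_rep Thompson_F H \<sigma> = group_rep thompson_F H (\<lambda>g. \<sigma> (Homeo g))"
| "is_rep Thompson_T H \<sigma> = group_rep thompson_T H (\<lambda>g. \<sigma> (Homeo g))"
| "is_rep Thompson_V H \<sigma> = group_rep thompson_V H (\<lambda>g. \<sigma> (Homeo g))"
| "is_rep Cuntz H \<sigma> = cuntz_rep H (\<lambda>i. \<sigma> (Gen i))"

definition rep_equiv :: "group_or_algebra \<Rightarrow> 'a hspace \<Rightarrow> (elem \<Rightarrow> 'a \<Rightarrow> 'a) \<Rightarrow>
    'b hspace \<Rightarrow> (elem \<Rightarrow> 'b \<Rightarrow> 'b) \<Rightarrow> bool" where
  "rep_equiv X H \<sigma> K \<rho> \<longleftrightarrow> (\<exists>U. unitary_op H K U \<and>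
     (\<forall>g\<in>elems X. \<forall>x\<in>carrier H. U (\<sigma> g x) = \<rho> g (U x)))"

definition rep_sum :: "(elem \<Rightarrow> 'a \<Rightarrow> 'a) \<Rightarrow> (elem \<Rightarrow> 'b \<Rightarrow> 'b) \<Rightarrow> elem \<Rightarrow> 'a \<times> 'b \<Rightarrow> 'a \<times> 'b" where
  "rep_sum \<sigma> \<rho> g = (\<lambda>(x, y). (\<sigma> g x, \<rho> g y))"

definition word_op :: "(bool \<Rightarrow> 'a \<Rightarrow> 'a) \<Rightarrow> bool list \<Rightarrow> 'a \<Rightarrow> 'a" where
  "word_op S u = foldr (\<lambda>i T. S i \<circ> T) u id"

text \<open>
  The operator \<open>\<Sum>\<^sub>j s\<^bsub>\<nu>\<^sub>j\<^esub> s\<^bsub>\<mu>\<^sub>j\<^esub>\<^sup>*\<close> attached to an element of \<open>V\<close>, in the representation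
  of the Cuntz algebra given by \<open>S\<close>. It does not depend on the chosen table \<open>(\<mu>, \<nu>)\<close>.
\<close>

definition V_op :: "'a hspace \<Rightarrow> (bool \<Rightarrow> 'a \<Rightarrow> 'a) \<Rightarrow> (bool stream \<Rightarrow> bool stream) \<Rightarrow> 'a \<Rightarrow> 'a" where
  "V_op H S v x = (case SOME (\<mu>, \<nu>). is_table v \<mu> \<nu> of (\<mu>, \<nu>) \<Rightarrow>
     (\<Oplus>\<^bsub>H\<^esub>j\<in>{..<length \<mu>}. word_op S (\<nu> ! j) (adjoint H (word_op S (\<mu> ! j)) x)))"

section \<open>Pythagorean representations and P-dimension\<close>

definition Pi_gen :: "'a hspace \<Rightarrow> ('a \<Rightarrow> 'a) \<Rightarrow> ('a \<Rightarrow> 'a) \<Rightarrow> bool \<Rightarrow>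
    (nat \<Rightarrow> 'a dtree set) set \<Rightarrow> (nat \<Rightarrow> 'a dtree set) set" where
  "Pi_gen H A B i = adjoint (Pi_space H A B) (tau H A B i)"

fun Pi_rep :: "'a hspace \<Rightarrow> ('a \<Rightarrow> 'a) \<Rightarrow> ('a \<Rightarrow> 'a) \<Rightarrow> elem \<Rightarrow>
    (nat \<Rightarrow> 'a dtree set) set \<Rightarrow> (nat \<Rightarrow> 'a dtree set) set" where
  "Pi_rep H A B (Gen i) = Pi_gen H A B i"
| "Pi_rep H A B (Homeo v) = V_op (Pi_space H A B) (Pi_gen H A B) v"

text \<open>
  The type argument is the type of the vectors of the diffuse P-module; it is there because one
  cannot quantify existentially over types.
\<close>

definition diffuse_pythagorean ::
  "'m itself \<Rightarrow> group_or_algebra \<Rightarrow> 'a hspace \<Rightarrow> (elem \<Rightarrow> 'a \<Rightarrow> 'a) \<Rightarrow> bool" where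
  "diffuse_pythagorean M X H \<sigma> \<longleftrightarrow> is_rep X H \<sigma> \<and>
     (\<exists>(K :: 'm hspace) A B. P_module K A B \<and> diffuse K A B \<and>
        rep_equiv X (Pi_space K A B) (Pi_rep K A B) H \<sigma>)"

text \<open>
  Every finite dimensional Hilbert space is isomorphic to one whose vectors are of type
  \<open>nat \<Rightarrow> complex\<close>. The infimum of a set of \<open>enat\<close>s is its minimum, and \<open>\<infinity>\<close> for the empty set.
\<close>

definition dim_P :: "group_or_algebra \<Rightarrow> 'a hspace \<Rightarrow> (elem \<Rightarrow> 'a \<Rightarrow> 'a) \<Rightarrow> enat" where
  "dim_P X H \<sigma> = Inf {enat n | n. \<exists>(K :: (nat \<Rightarrow> complex) hspace) A B.
     P_module K A B \<and> has_dim K n \<and> rep_equiv X (Pi_space K A B) (Pi_rep K A B) H \<sigma>}"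

end

theory Submission
  imports Defs
begin

text \<open>
  A Pythagorean representation carries isometries \<open>S\<^sub>0, S\<^sub>1\<close> with adjoints \<open>T\<^sub>0, T\<^sub>1\<close> satisfying the
  Cuntz relations, and the space of the P-module sits in it as a \<open>T\<close>-invariant subspace \<open>W\<close> which is
  generating: the finite sums of vectors \<open>S\<^sub>u w\<close>, with \<open>u\<close> a word and \<open>w \<in> W\<close>, are dense. Conversely a
  \<open>T\<close>-invariant generating subspace is a P-module whose representation is the given one (\<open>universal\<close>,
  \<open>realization\<close>). Hence, for the Cuntz algebra, the P-dimension is the least dimension of a
  \<open>T\<close>-invariant generating subspace. If \<open>V\<close> and \<open>V'\<close> are such subspaces of two representations, then
  \<open>V \<times> V'\<close> is one of the direct sum (\<open>P_dims_add\<close>), which gives one inequality.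

  For the other one, let \<open>W\<close> be such a subspace of \<open>H \<oplus> K\<close>, of finite dimension \<open>n\<close>, and let \<open>p\<close> be the
  projection onto \<open>H\<close>. The sections \<open>V = W \<inter> H\<close> and \<open>V' = W \<inter> K\<close> have dimensions which add up to at
  most \<open>n\<close>, so it suffices that they generate, that is, that \<open>L = V \<oplus> V' = {h \<in> W. p h \<in> W}\<close>
  generates (\<open>generating_restrict\<close>). On \<open>W\<close> the distance of \<open>p h\<close> to \<open>W\<close> vanishes exactly for
  \<open>h \<in> L\<close>, so by finite dimension the distance of \<open>h\<close> to \<open>L\<close> is at most \<open>C\<close> times the distance of
  \<open>p h\<close> to \<open>W\<close> (\<open>kernel_distance_bound\<close>). Approximate \<open>p h\<close> by \<open>\<Sum>\<^sub>u S\<^sub>u w\<^sub>u\<close>, the sum running over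
  the leaves \<open>u\<close> of a tree. As \<open>p\<close> commutes with \<open>T\<^sub>0, T\<^sub>1\<close>, the bound applies to each component \<open>T\<^sub>u h\<close>,
  and it replaces every \<open>w\<^sub>u\<close> by some \<open>l\<^sub>u \<in> L\<close> such that \<open>\<Sum>\<^sub>u S\<^sub>u l\<^sub>u\<close> approximates \<open>h\<close>, with an error
  which has only been multiplied by \<open>C\<close>.

  For the groups one has to know in addition that a unitary \<open>U\<close> which intertwines the actions of \<open>F\<close>
  also intertwines the Cuntz relations (\<open>F_intertwiner_intertwines_T\<close>). This is where diffuseness
  enters, in the form that the powers of \<open>T\<^sub>0\<close> and of \<open>T\<^sub>1\<close> tend strongly to \<open>0\<close>. Then the elements of \<open>F\<close>
  which act inside the cone of a word \<open>w\<close> as the powers of the usual generator \<open>x\<^sub>0\<close>, and trivially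
  outside, tend weakly to \<open>1 - S\<^sub>w T\<^sub>w\<close>, so \<open>U\<close> intertwines the projections \<open>S\<^sub>w T\<^sub>w\<close>. Composing with
  elements of \<open>F\<close> which move one cone onto another one, \<open>U\<close> intertwines \<open>S\<^sub>v T\<^sub>u\<close> for many pairs \<open>u, v\<close>,
  and \<open>T\<^sub>b\<close> is a limit of sums of such operators.

  The finite dimensional P-module which realizes the direct sum is not known to be diffuse in advance.
  But the powers of \<open>x\<^sub>0\<close> tend weakly to \<open>0\<close> in its representation too, because they do so in the
  equivalent one. If the powers of \<open>T\<^sub>b\<close> did not tend to \<open>0\<close> on \<open>W\<close>, compactness would yield \<open>u \<in> W\<close> on
  which they preserve the norm. The elements of \<open>F\<close> in question then act on \<open>u\<close> as powers of \<open>T\<^sub>b\<close>, and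
  vectors of constant norm in a finite dimensional space cannot tend weakly to \<open>0\<close>
  (\<open>vanishing_if_weakly_null\<close>).
\<close>

section \<open>Inner product spaces\<close>

lemma complex_field_simps [simp]:
  "carrier complex_field = UNIV" "mult complex_field = (*)" "one complex_field = 1"
  "zero complex_field = 0" "add complex_field = (+)"
  by (simp_all add: complex_field_def)

lemma cring_complex_field: "cring complex_field"
  by (rule cringI, rule abelian_groupI)
     (auto intro!: comm_monoidI simp: algebra_simps intro: exI[of _ "- x" for x] right_minus)

text \<open>
  In an inner product space an equation between vectors holds once both sides have the same inner
  product with every vector. Taken as an axiom, this separation property implies all module axioms,
  because each of them becomes an identity between complex numbers. This is the way in which the
  direct limit, the completion, direct sums and coordinate spaces are shown to be inner product spaces.
\<close>

lemma inner_product_spaceI: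
  fixes H :: "'a hspace" (structure)
  assumes zero: "\<zero> \<in> carrier H"
    and add: "\<And>x y. \<lbrakk>x \<in> carrier H; y \<in> carrier H\<rbrakk> \<Longrightarrow> x \<oplus> y \<in> carrier H"
    and smult: "\<And>c x. x \<in> carrier H \<Longrightarrow> c \<odot> x \<in> carrier H"
    and inner_add: "\<And>x y z. \<lbrakk>x \<in> carrier H; y \<in> carrier H; z \<in> carrier H\<rbrakk>
      \<Longrightarrow> hinner H (x \<oplus> y) z = hinner H x z + hinner H y z"
    and inner_smult: "\<And>c x z. \<lbrakk>x \<in> carrier H; z \<in> carrier H\<rbrakk> \<Longrightarrow> hinner H (c \<odot> x) z = c * hinner H x z"
    and inner_zero: "\<And>z. z \<in> carrier H \<Longrightarrow> hinner H \<zero> z = 0"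
    and commute: "\<And>x y. \<lbrakk>x \<in> carrier H; y \<in> carrier H\<rbrakk> \<Longrightarrow> hinner H y x = cnj (hinner H x y)"
    and nonneg: "\<And>x. x \<in> carrier H \<Longrightarrow> 0 \<le> Re (hinner H x x)"
    and separating: "\<And>x y. \<lbrakk>x \<in> carrier H; y \<in> carrier H; \<And>z. z \<in> carrier H \<Longrightarrow> hinner H x z = hinner H y z\<rbrakk>
      \<Longrightarrow> x = y"
  shows "inner_product_space H"
proof -
  note facts = zero add smult inner_add inner_smult inner_zero
  have "abelian_group H"
  proof (rule abelian_groupI)
    fix x assume x: "x \<in> carrier H"
    show "\<exists>y\<in>carrier H. y \<oplus> x = \<zero>"
      by (rule bexI[of _ "(-1) \<odot> x"]; (rule separating)?) (use x in \<open>simp_all add: facts\<close>)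
  qed (rule separating | simp add: facts)+
  then have "Module.module complex_field H"
    by (intro moduleI cring_complex_field) ((rule separating)?; simp add: facts algebra_simps)+
  moreover have "inner_product_space_axioms H"
  proof
    fix x assume x: "x \<in> carrier H" and xx: "hinner H x x = 0"
    show "x = \<zero>"
    proof (rule separating[OF x zero])
      fix z assume z: "z \<in> carrier H"
      define a where "a = hinner H x z"
      \<comment> \<open>positivity of the form at \<open>z - t \<cdot> cnj a \<cdot> x\<close>, whose quadratic term in \<open>t\<close> vanishes\<close>
      have bound: "0 \<le> Re (hinner H z z) - 2 * t * (cmod a)\<^sup>2" for t :: real
      proof -
        let ?c = "- (of_real t * cnj a)"
        have 1: "hinner H z (?c \<odot> x) = cnj (?c * a)"
          using commute[of "?c \<odot> x" z] x z by (simp add: inner_smult smult a_def)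
        have 2: "hinner H x (z \<oplus> ?c \<odot> x) = a"
          using commute[of "z \<oplus> ?c \<odot> x" x] commute[of x z] x z
          by (simp add: facts xx a_def)
        have 3: "hinner H z (z \<oplus> ?c \<odot> x) = hinner H z z + cnj (?c * a)"
          using commute[of "z \<oplus> ?c \<odot> x" z] commute[of x z] commute[of z z] x z
          by (simp add: facts a_def)
        have "hinner H (z \<oplus> ?c \<odot> x) (z \<oplus> ?c \<odot> x) = hinner H z z + cnj (?c * a) + ?c * a"
          using x z 2 3 by (simp add: facts)
        moreover have "Re (cnj (?c * a) + ?c * a) = - 2 * t * (cmod a)\<^sup>2"
          unfolding cmod_power2 by (simp add: power2_eq_square algebra_simps)
        moreover have "0 \<le> Re (hinner H (z \<oplus> ?c \<odot> x) (z \<oplus> ?c \<odot> x))"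
          using x z by (intro nonneg) (simp add: facts)
        ultimately show ?thesis by simp
      qed
      have "a = 0"
      proof (rule ccontr)
        assume "a \<noteq> 0"
        then have "(cmod a)\<^sup>2 > 0" by simp
        then show False
          using bound[of "(Re (hinner H z z) + 1) / (2 * (cmod a)\<^sup>2)"] by (simp add: field_simps)
      qed
      then show "hinner H x z = hinner H \<zero> z"
        using z by (simp add: a_def inner_zero)
    qed
  qed (fact inner_add inner_smult commute nonneg)+
  ultimately show ?thesis by (simp add: inner_product_space_def)
qed

context inner_product_space
begin

lemma smult_closed' [simp, intro]: "x \<in> carrier H \<Longrightarrow> c \<odot> x \<in> carrier H"
  using smult_closed by simp

lemma hinner_add_right:
  "\<lbrakk>x \<in> carrier H; y \<in> carrier H; z \<in> carrier H\<rbrakk> \<Longrightarrow> hinner H z (x \<oplus> y) = hinner H z x + hinner H z y"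
  by (subst (1 2 3) hinner_commute) (simp_all add: hinner_add_left)

lemma hinner_smult_right:
  "\<lbrakk>x \<in> carrier H; y \<in> carrier H\<rbrakk> \<Longrightarrow> hinner H y (c \<odot> x) = cnj c * hinner H y x"
  by (subst (1 2) hinner_commute) (simp_all add: hinner_smult_left)

lemma hinner_zero_left: "z \<in> carrier H \<Longrightarrow> hinner H \<zero> z = 0"
  using hinner_add_left[of \<zero> \<zero> z] by simp

lemma hinner_zero_right: "z \<in> carrier H \<Longrightarrow> hinner H z \<zero> = 0"
  using hinner_add_right[of \<zero> \<zero> z] by simp

lemma hinner_uminus_left:
  "\<lbrakk>x \<in> carrier H; z \<in> carrier H\<rbrakk> \<Longrightarrow> hinner H (\<ominus> x) z = - hinner H x z"
  using hinner_add_left[of x "\<ominus> x" z] by (simp add: M.r_neg hinner_zero_left eq_neg_iff_add_eq_0 add.commute)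

lemma hinner_minus_left:
  "\<lbrakk>x \<in> carrier H; y \<in> carrier H; z \<in> carrier H\<rbrakk> \<Longrightarrow> hinner H (x \<ominus> y) z = hinner H x z - hinner H y z"
  by (simp add: M.minus_eq hinner_add_left hinner_uminus_left)

lemma hinner_minus_right:
  "\<lbrakk>x \<in> carrier H; y \<in> carrier H; z \<in> carrier H\<rbrakk> \<Longrightarrow> hinner H z (x \<ominus> y) = hinner H z x - hinner H z y"
  by (subst (1 2 3) hinner_commute) (simp_all add: hinner_minus_left)

lemmas hinner_left = hinner_add_left hinner_smult_left hinner_zero_left hinner_minus_left
lemmas hinner_right = hinner_add_right hinner_smult_right hinner_zero_right hinner_minus_right

lemma minus_eq_zeroD:
  assumes "x \<ominus> y = \<zero>" "x \<in> carrier H" "y \<in> carrier H"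
  shows "x = y"
proof -
  have "x = (x \<ominus> y) \<oplus> y"
    using assms(2,3) by (simp add: M.minus_eq M.a_assoc M.l_neg)
  then show ?thesis using assms by simp
qed

text \<open>
  The separation property. Together with \<open>hinner_left\<close> it reduces vector identities to computations
  with complex numbers.
\<close>

lemma hinner_eqI:
  assumes "x \<in> carrier H" "y \<in> carrier H" "\<And>z. z \<in> carrier H \<Longrightarrow> hinner H x z = hinner H y z"
  shows "x = y"
proof -
  have "hinner H (x \<ominus> y) (x \<ominus> y) = 0"
    using assms by (simp add: hinner_minus_left)
  then have "x \<ominus> y = \<zero>" using assms by (simp add: hinner_definite)
  then show ?thesis using assms(1,2) by (rule minus_eq_zeroD)
qed

lemma hinner_finsum_left:
  assumes "finite I" "f \<in> I \<rightarrow> carrier H" "z \<in> carrier H"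
  shows "hinner H (\<Oplus>i\<in>I. f i) z = (\<Sum>i\<in>I. hinner H (f i) z)"
  using assms
  by (induction I) (simp_all add: hinner_zero_left hinner_add_left M.finsum_closed Pi_def)

section \<open>The norm\<close>

lemma hnorm_nonneg [simp]: "x \<in> carrier H \<Longrightarrow> 0 \<le> hnorm H x"
  by (simp add: hnorm_def hinner_nonneg)

lemma hnorm_power2: "x \<in> carrier H \<Longrightarrow> (hnorm H x)\<^sup>2 = Re (hinner H x x)"
  by (simp add: hnorm_def hinner_nonneg)

lemma hinner_self: "x \<in> carrier H \<Longrightarrow> hinner H x x = of_real ((hnorm H x)\<^sup>2)"
  using hinner_commute[of x x] by (simp add: hnorm_power2 complex_eq_iff)

lemma hnorm_zero [simp]: "hnorm H \<zero> = 0"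
  by (simp add: hnorm_def hinner_zero_left)

lemma hnorm_eq_zero: "\<lbrakk>x \<in> carrier H; hnorm H x = 0\<rbrakk> \<Longrightarrow> x = \<zero>"
  by (rule hinner_definite) (simp_all add: hinner_self)

lemma hnorm_smult: "x \<in> carrier H \<Longrightarrow> hnorm H (c \<odot> x) = cmod c * hnorm H x"
proof -
  assume x: "x \<in> carrier H"
  have "(hnorm H (c \<odot> x))\<^sup>2 = Re (c * cnj c * hinner H x x)"
    using x by (simp add: hnorm_power2 hinner_left hinner_right algebra_simps)
  also have "\<dots> = (cmod c * hnorm H x)\<^sup>2"
    using x by (simp add: hinner_self complex_norm_square[symmetric] power_mult_distrib)
  finally show ?thesis using x by (simp add: power2_eq_iff_nonneg)
qed

lemma hnorm_add_power2:
  "\<lbrakk>x \<in> carrier H; y \<in> carrier H\<rbrakk> \<Longrightarrow>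
    (hnorm H (x \<oplus> y))\<^sup>2 = (hnorm H x)\<^sup>2 + (hnorm H y)\<^sup>2 + 2 * Re (hinner H x y)"
  using hinner_commute[of x y] by (simp add: hnorm_power2 hinner_left hinner_right)

lemma hnorm_minus_power2:
  "\<lbrakk>x \<in> carrier H; y \<in> carrier H\<rbrakk> \<Longrightarrow>
    (hnorm H (x \<ominus> y))\<^sup>2 = (hnorm H x)\<^sup>2 + (hnorm H y)\<^sup>2 - 2 * Re (hinner H x y)"
  using hinner_commute[of x y] by (simp add: hnorm_power2 hinner_left hinner_right)

lemma Cauchy_Schwarz:
  assumes x: "x \<in> carrier H" and y: "y \<in> carrier H"
  shows "cmod (hinner H x y) \<le> hnorm H x * hnorm H y"
proof (cases "y = \<zero>")
  case True
  then show ?thesis using x by (simp add: hinner_zero_right)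
next
  case False
  then have pos: "(hnorm H y)\<^sup>2 > 0" using hnorm_eq_zero[OF y] by auto
  define a where "a = hinner H x y"
  \<comment> \<open>\<open>c \<odot> y\<close> is the projection of \<open>x\<close> onto the line of \<open>y\<close>\<close>
  define c where "c = a / of_real ((hnorm H y)\<^sup>2)"
  have c: "cmod c = cmod a / (hnorm H y)\<^sup>2"
    by (simp add: c_def norm_divide flip: of_real_power)
  have "0 \<le> (hnorm H (x \<ominus> c \<odot> y))\<^sup>2" by simp
  also have "\<dots> = (hnorm H x)\<^sup>2 + (cmod c * hnorm H y)\<^sup>2 - 2 * Re (cnj c * a)"
    using x y by (simp add: hnorm_minus_power2 hnorm_smult hinner_smult_right a_def)
  also have "cnj c * a = of_real ((cmod a)\<^sup>2 / (hnorm H y)\<^sup>2)"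
    using complex_norm_square[of a] by (simp add: c_def mult.commute)
  also have "(cmod c * hnorm H y)\<^sup>2 = (cmod a)\<^sup>2 / (hnorm H y)\<^sup>2"
    using pos y by (simp add: c power2_eq_square field_simps)
  finally have "(cmod a)\<^sup>2 / (hnorm H y)\<^sup>2 \<le> (hnorm H x)\<^sup>2"
    by simp
  then have "(cmod a)\<^sup>2 \<le> (hnorm H x * hnorm H y)\<^sup>2"
    using pos by (simp add: power_mult_distrib field_simps)
  then show ?thesis using x y by (simp add: a_def abs_le_square_iff[symmetric])
qed

lemma hnorm_triangle:
  assumes x: "x \<in> carrier H" and y: "y \<in> carrier H"
  shows "hnorm H (x \<oplus> y) \<le> hnorm H x + hnorm H y"
proof -
  have "Re (hinner H x y) \<le> hnorm H x * hnorm H y"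
    using Cauchy_Schwarz[OF x y] complex_Re_le_cmod order_trans by blast
  then have "(hnorm H (x \<oplus> y))\<^sup>2 \<le> (hnorm H x + hnorm H y)\<^sup>2"
    using x y by (simp add: hnorm_add_power2 power2_sum)
  then show ?thesis using x y by (simp add: abs_le_square_iff[symmetric])
qed

lemma hnorm_minus_commute:
  "\<lbrakk>x \<in> carrier H; y \<in> carrier H\<rbrakk> \<Longrightarrow> hnorm H (x \<ominus> y) = hnorm H (y \<ominus> x)"
  by (simp add: hnorm_def hinner_left hinner_right algebra_simps)

lemma hnorm_minus_triangle:
  assumes "x \<in> carrier H" "y \<in> carrier H" "z \<in> carrier H"
  shows "hnorm H (x \<ominus> z) \<le> hnorm H (x \<ominus> y) + hnorm H (y \<ominus> z)"
proof -
  have "x \<ominus> z = (x \<ominus> y) \<oplus> (y \<ominus> z)"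
    using assms by (intro hinner_eqI) (simp_all add: hinner_left)
  then show ?thesis using assms hnorm_triangle by simp
qed

lemma hnorm_triangle_minus:
  assumes "x \<in> carrier H" "y \<in> carrier H"
  shows "hnorm H x \<le> hnorm H y + hnorm H (x \<ominus> y)"
proof -
  have "x = y \<oplus> (x \<ominus> y)"
    using assms by (intro hinner_eqI) (simp_all add: hinner_left)
  then show ?thesis using assms hnorm_triangle[of y "x \<ominus> y"] by simp
qed

lemma minus_self [simp]: "x \<in> carrier H \<Longrightarrow> x \<ominus> x = \<zero>"
  by (simp add: M.minus_eq M.r_neg)

lemma minus_zero_right [simp]: "x \<in> carrier H \<Longrightarrow> x \<ominus> \<zero> = x"
  by (rule hinner_eqI) (simp_all add: hinner_left)

lemma tendsto_hinner:
  assumes f: "\<And>n. f n \<in> carrier H" "x \<in> carrier H" "hlim H f x"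
    and g: "\<And>n. g n \<in> carrier H" "y \<in> carrier H" "hlim H g y"
  shows "(\<lambda>n. hinner H (f n) (g n)) \<longlonglongrightarrow> hinner H x y"
proof -
  have eq: "hinner H (f n) (g n) - hinner H x y
      = hinner H (f n \<ominus> x) (g n \<ominus> y) + hinner H (f n \<ominus> x) y + hinner H x (g n \<ominus> y)" for n
    using f g by (simp add: hinner_left hinner_right)
  have "(\<lambda>n. hnorm H (f n \<ominus> x) * hnorm H (g n \<ominus> y) + hnorm H (f n \<ominus> x) * hnorm H y
      + hnorm H x * hnorm H (g n \<ominus> y)) \<longlonglongrightarrow> 0 * 0 + 0 * hnorm H y + hnorm H x * 0"
    using f g unfolding hlim_def by (intro tendsto_intros)
  then have lim: "(\<lambda>n. hnorm H (f n \<ominus> x) * hnorm H (g n \<ominus> y) + hnorm H (f n \<ominus> x) * hnorm H y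
      + hnorm H x * hnorm H (g n \<ominus> y)) \<longlonglongrightarrow> 0"
    by simp
  have bound: "norm (hinner H (f n) (g n) - hinner H x y) \<le> hnorm H (f n \<ominus> x) * hnorm H (g n \<ominus> y)
      + hnorm H (f n \<ominus> x) * hnorm H y + hnorm H x * hnorm H (g n \<ominus> y)" for n
    unfolding eq using f g by (intro norm_triangle_mono Cauchy_Schwarz) simp_all
  have "(\<lambda>n. hinner H (f n) (g n) - hinner H x y) \<longlonglongrightarrow> 0"
    by (rule tendsto_0_le[where K = 1, OF lim], intro always_eventually allI)
       (use bound in \<open>simp add: order_trans[OF bound abs_ge_self]\<close>)
  then show ?thesis by (simp add: LIM_zero_iff)
qed

lemma hlim_const: "x \<in> carrier H \<Longrightarrow> hlim H (\<lambda>_. x) x"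
  by (simp add: hlim_def)

lemma tendsto_hnorm:
  assumes "\<And>n. f n \<in> carrier H" "x \<in> carrier H" "hlim H f x"
  shows "(\<lambda>n. hnorm H (f n)) \<longlonglongrightarrow> hnorm H x"
  unfolding hnorm_def using tendsto_hinner[OF assms assms] by (intro tendsto_intros)

lemma hlim_unique:
  assumes "\<And>n. f n \<in> carrier H" "x \<in> carrier H" "hlim H f x" "y \<in> carrier H" "hlim H f y"
  shows "x = y"
proof (rule hinner_eqI)
  fix z assume z: "z \<in> carrier H"
  show "hinner H x z = hinner H y z"
    using tendsto_hinner[OF assms(1-3) z z hlim_const[OF z]]
      tendsto_hinner[OF assms(1,4,5) z z hlim_const[OF z]] LIMSEQ_unique by blast
qed (use assms in simp_all)

lemma hlim_hCauchy:
  assumes f: "\<And>n. f n \<in> carrier H" "x \<in> carrier H" "hlim H f x"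
  shows "hCauchy H f"
  unfolding hCauchy_def
proof (intro conjI allI impI)
  fix e :: real assume "e > 0"
  then have "\<exists>N. \<forall>n\<ge>N. norm (hnorm H (f n \<ominus> x) - 0) < e / 2"
    using f(3) unfolding hlim_def by (intro LIMSEQ_D) simp_all
  then obtain N where N: "hnorm H (f n \<ominus> x) < e / 2" if "n \<ge> N" for n
    using f by auto
  show "\<exists>N. \<forall>m\<ge>N. \<forall>n\<ge>N. hnorm H (f m \<ominus> f n) < e"
  proof (intro exI[of _ N] allI impI)
    fix m n assume "m \<ge> N" "n \<ge> N"
    then show "hnorm H (f m \<ominus> f n) < e"
      using hnorm_minus_triangle[of "f m" x "f n"] hnorm_minus_commute[of x "f n"] N[of m] N[of n] f by simp
  qed
qed (fact f)

end

section \<open>Linear operators\<close>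

lemma linear_opD:
  assumes "linear_op H K T" "x \<in> carrier H"
  shows "T x \<in> carrier K"
    and "y \<in> carrier H \<Longrightarrow> T (x \<oplus>\<^bsub>H\<^esub> y) = T x \<oplus>\<^bsub>K\<^esub> T y"
    and "T (c \<odot>\<^bsub>H\<^esub> x) = c \<odot>\<^bsub>K\<^esub> T x"
  using assms unfolding linear_op_def by auto

lemma linear_op_zero:
  assumes "inner_product_space H" "inner_product_space K" "linear_op H K T"
  shows "T \<zero>\<^bsub>H\<^esub> = \<zero>\<^bsub>K\<^esub>"
proof -
  interpret H: inner_product_space H by fact
  interpret K: inner_product_space K by fact
  have "T (0 \<odot>\<^bsub>H\<^esub> \<zero>\<^bsub>H\<^esub>) = 0 \<odot>\<^bsub>K\<^esub> T \<zero>\<^bsub>H\<^esub>"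
    by (rule linear_opD(3)[OF assms(3)]) simp
  moreover have "0 \<odot>\<^bsub>K\<^esub> T \<zero>\<^bsub>H\<^esub> = \<zero>\<^bsub>K\<^esub>"
    using assms(3) linear_opD(1)[OF assms(3)] by (intro K.hinner_eqI) (simp_all add: K.hinner_left)
  moreover have "0 \<odot>\<^bsub>H\<^esub> \<zero>\<^bsub>H\<^esub> = \<zero>\<^bsub>H\<^esub>"
    by (intro H.hinner_eqI) (simp_all add: H.hinner_left)
  ultimately show ?thesis by simp
qed

lemma linear_op_minus:
  assumes "inner_product_space H" "inner_product_space K" "linear_op H K T"
    "x \<in> carrier H" "y \<in> carrier H"
  shows "T (x \<ominus>\<^bsub>H\<^esub> y) = T x \<ominus>\<^bsub>K\<^esub> T y"
proof -
  interpret H: inner_product_space H by fact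
  interpret K: inner_product_space K by fact
  have "x \<ominus>\<^bsub>H\<^esub> y = x \<oplus>\<^bsub>H\<^esub> (-1) \<odot>\<^bsub>H\<^esub> y"
    using assms by (intro H.hinner_eqI) (simp_all add: H.hinner_left)
  moreover have "T x \<ominus>\<^bsub>K\<^esub> T y = T x \<oplus>\<^bsub>K\<^esub> (-1) \<odot>\<^bsub>K\<^esub> T y"
    using assms linear_opD(1)[OF assms(3)] by (intro K.hinner_eqI) (simp_all add: K.hinner_left)
  ultimately show ?thesis
    using assms by (simp add: linear_opD H.smult_closed')
qed

section \<open>Unitary operators\<close>

lemma squeeze_zero:
  fixes f u :: "nat \<Rightarrow> real"
  assumes "u \<longlonglongrightarrow> 0" "\<And>n. 0 \<le> f n" "\<And>n. f n \<le> u n"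
  shows "f \<longlonglongrightarrow> 0"
  using assms by (intro tendsto_sandwich[of "\<lambda>_. 0" f sequentially u 0]) simp_all

lemma unitary_opD:
  assumes "unitary_op H K U"
  shows "linear_op H K U" and "bij_betw U (carrier H) (carrier K)"
    and "x \<in> carrier H \<Longrightarrow> U x \<in> carrier K"
    and "\<lbrakk>x \<in> carrier H; y \<in> carrier H\<rbrakk> \<Longrightarrow> hinner K (U x) (U y) = hinner H x y"
  using assms unfolding unitary_op_def linear_op_def by auto

lemma unitary_op_surj:
  assumes "unitary_op H K U" "y \<in> carrier K"
  obtains x where "x \<in> carrier H" "y = U x"
  using assms unfolding unitary_op_def bij_betw_def by blast

text \<open>
  Linearity and injectivity are consequences: \<open>U (x + y)\<close> and \<open>U x + U y\<close> have the same inner product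
  with every \<open>U z\<close>, and these vectors exhaust the target.
\<close>

lemma unitary_opI:
  assumes H: "inner_product_space H" and K: "inner_product_space K"
    and maps: "\<And>x. x \<in> carrier H \<Longrightarrow> U x \<in> carrier K"
    and surj: "\<And>y. y \<in> carrier K \<Longrightarrow> \<exists>x\<in>carrier H. U x = y"
    and inner: "\<And>x y. \<lbrakk>x \<in> carrier H; y \<in> carrier H\<rbrakk> \<Longrightarrow> hinner K (U x) (U y) = hinner H x y"
  shows "unitary_op H K U"
proof -
  interpret H: inner_product_space H by fact
  interpret K: inner_product_space K by fact
  have eqI: "U x = y" if "x \<in> carrier H" "y \<in> carrier K"
    "\<And>z. z \<in> carrier H \<Longrightarrow> hinner H x z = hinner K y (U z)" for x y
  proof (rule K.hinner_eqI)
    fix z assume "z \<in> carrier K"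
    then obtain z' where "z' \<in> carrier H" "U z' = z" using surj by blast
    then show "hinner K (U x) z = hinner K y z" using that inner by force
  qed (use that maps in auto)
  have "inj_on U (carrier H)"
  proof (rule inj_onI)
    fix x y assume *: "x \<in> carrier H" "y \<in> carrier H" "U x = U y"
    show "x = y"
    proof (rule H.hinner_eqI)
      fix z assume z: "z \<in> carrier H"
      show "hinner H x z = hinner H y z" using inner[OF *(1) z] inner[OF *(2) z] *(3) by simp
    qed (use * in auto)
  qed
  moreover have "U ` carrier H = carrier K" using maps surj by blast
  moreover have "linear_op H K U"
    unfolding linear_op_def
    by (auto intro!: eqI maps simp: inner maps H.hinner_left K.hinner_left)
  ultimately show ?thesis by (simp add: unitary_op_def bij_betw_def inner)
qed

lemma unitary_op_hnorm: "\<lbrakk>unitary_op H K U; x \<in> carrier H\<rbrakk> \<Longrightarrow> hnorm K (U x) = hnorm H x"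
  by (simp add: hnorm_def unitary_opD)

lemma unitary_op_compose:
  assumes "unitary_op H K U" "unitary_op K L W"
  shows "unitary_op H L (W \<circ> U)"
  using assms unfolding unitary_op_def linear_op_def
  by (auto intro: bij_betw_trans)

lemma unitary_op_inverse:
  assumes H: "inner_product_space H" and K: "inner_product_space K" and U: "unitary_op H K U"
  shows "unitary_op K H (the_inv_into (carrier H) U)"
    and "\<And>x. x \<in> carrier H \<Longrightarrow> the_inv_into (carrier H) U (U x) = x"
    and "\<And>y. y \<in> carrier K \<Longrightarrow> U (the_inv_into (carrier H) U y) = y"
proof -
  let ?V = "the_inv_into (carrier H) U"
  have bij: "bij_betw U (carrier H) (carrier K)" using U by (rule unitary_opD)
  show 1: "?V (U x) = x" if "x \<in> carrier H" for x
    using bij that by (simp add: bij_betw_def the_inv_into_f_f)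
  show 2: "U (?V y) = y" if "y \<in> carrier K" for y
    using bij that f_the_inv_into_f_bij_betw by metis
  have 3: "?V y \<in> carrier H" if "y \<in> carrier K" for y
    using bij_betw_the_inv_into[OF bij] that by (rule bij_betw_apply)
  show "unitary_op K H ?V"
  proof (rule unitary_opI[OF K H])
    fix x assume "x \<in> carrier H"
    then show "\<exists>y\<in>carrier K. ?V y = x"
      using 1 unitary_opD(3)[OF U] by blast
  next
    fix x y assume "x \<in> carrier K" "y \<in> carrier K"
    then show "hinner H (?V x) (?V y) = hinner K x y"
      using unitary_opD(4)[OF U, of "?V x" "?V y"] 2 3 by simp
  qed (fact 3)
qed

section \<open>Dense subsets\<close>

definition dense_in :: "'a hspace \<Rightarrow> 'a set \<Rightarrow> bool" where
  "dense_in H D \<longleftrightarrow> D \<subseteq> carrier H \<and>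
     (\<forall>x\<in>carrier H. \<forall>e>0. \<exists>d\<in>D. hnorm H (x \<ominus>\<^bsub>H\<^esub> d) < e)"

context inner_product_space
begin

lemma dense_inD:
  assumes "dense_in H D" "x \<in> carrier H" "e > 0"
  obtains d where "d \<in> D" "d \<in> carrier H" "hnorm H (x \<ominus> d) < e"
  using assms unfolding dense_in_def by blast

lemma dense_in_sequence:
  assumes D: "dense_in H D" and x: "x \<in> carrier H"
  obtains f where "\<And>n. f n \<in> D" "hlim H f x"
proof -
  have "\<exists>d. d \<in> D \<and> hnorm H (d \<ominus> x) < 1 / real (Suc n)" for n
  proof -
    obtain d where "d \<in> D" "d \<in> carrier H" "hnorm H (x \<ominus> d) < 1 / real (Suc n)"
      by (rule dense_inD[OF D x, of "1 / real (Suc n)"]) simp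
    then show ?thesis using hnorm_minus_commute x by auto
  qed
  then obtain f where f: "\<And>n. f n \<in> D" "\<And>n. hnorm H (f n \<ominus> x) < 1 / real (Suc n)"
    by metis
  have fH: "f n \<in> carrier H" for n using f(1) D by (auto simp: dense_in_def)
  have "hlim H f x" unfolding hlim_def
    using f(2) fH x by (intro squeeze_zero[OF lim_1_over_n[THEN LIMSEQ_Suc]]) (simp_all add: less_imp_le)
  with f(1) show ?thesis using that by blast
qed

lemma dense_in_eqI:
  assumes D: "dense_in H D" and xy: "x \<in> carrier H" "y \<in> carrier H"
    and eq: "\<And>d. d \<in> D \<Longrightarrow> hinner H x d = hinner H y d"
  shows "x = y"
proof (rule hinner_eqI[OF xy])
  fix z assume z: "z \<in> carrier H"
  obtain f where f: "\<And>n. f n \<in> D" "hlim H f z" using dense_in_sequence[OF D z] by blast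
  have fH: "f n \<in> carrier H" for n using f(1) D by (auto simp: dense_in_def)
  have "(\<lambda>n. hinner H x (f n)) \<longlonglongrightarrow> hinner H x z" "(\<lambda>n. hinner H y (f n)) \<longlonglongrightarrow> hinner H y z"
    using tendsto_hinner[OF _ _ hlim_const fH z f(2)] xy by blast+
  then show "hinner H x z = hinner H y z"
    using eq[OF f(1)] LIMSEQ_unique by auto
qed

end

text \<open>
  Two families with the same Gram matrix and dense ranges are exchanged by a unitary. Mutual distances
  in a family are determined by the Gram matrix, so a sequence from the first family is Cauchy exactly
  if the corresponding sequence of the second one is, and \<open>U\<close> sends limits to limits. It preserves inner
  products, hence it is linear by \<open>unitary_opI\<close>.
\<close>

lemma gram_unitary:
  fixes f :: "'i \<Rightarrow> 'a" and g :: "'i \<Rightarrow> 'b"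
  assumes H: "hilbert_space H" and K: "hilbert_space K"
    and gram: "\<And>s t. \<lbrakk>s \<in> I; t \<in> I\<rbrakk> \<Longrightarrow> hinner H (f s) (f t) = hinner K (g s) (g t)"
    and f: "dense_in H (f ` I)" and g: "dense_in K (g ` I)"
  obtains U where "unitary_op H K U" "\<And>s. s \<in> I \<Longrightarrow> U (f s) = g s"
proof -
  interpret H: hilbert_space H by fact
  interpret K: hilbert_space K by fact
  have fI [simp]: "f s \<in> carrier H" and gI [simp]: "g s \<in> carrier K" if "s \<in> I" for s
    using that f g by (auto simp: dense_in_def)
  have dist: "hnorm H (f s \<ominus>\<^bsub>H\<^esub> f t) = hnorm K (g s \<ominus>\<^bsub>K\<^esub> g t)" if "s \<in> I" "t \<in> I" for s t
    using that by (simp add: hnorm_def H.hinner_left H.hinner_right K.hinner_left K.hinner_right gram)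
  have Cauchy_iff: "hCauchy H (\<lambda>n. f (s n)) \<longleftrightarrow> hCauchy K (\<lambda>n. g (s n))" if "\<And>n. s n \<in> I" for s
    using that by (simp add: hCauchy_def dist)
  have seq: "\<exists>s. (\<forall>n. s n \<in> I) \<and> hlim H (\<lambda>n. f (s n)) x" if x: "x \<in> carrier H" for x
  proof -
    obtain h where h: "\<And>n. h n \<in> f ` I" "hlim H h x" using H.dense_in_sequence[OF f x] by blast
    then obtain s where "\<And>n. s n \<in> I" "\<And>n. h n = f (s n)" unfolding image_iff Bex_def by metis
    moreover from this have "h = (\<lambda>n. f (s n))" by auto
    ultimately show ?thesis using h by auto
  qed
  have "\<exists>y\<in>carrier K. \<forall>s. (\<forall>n. s n \<in> I) \<longrightarrow> hlim H (\<lambda>n. f (s n)) x \<longrightarrow> hlim K (\<lambda>n. g (s n)) y"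
    if x: "x \<in> carrier H" for x
  proof -
    obtain r where r: "\<And>n. r n \<in> I" "hlim H (\<lambda>n. f (r n)) x" using seq[OF x] by blast
    have "hCauchy H (\<lambda>n. f (r n))" using r x by (intro H.hlim_hCauchy) auto
    then obtain y where y: "y \<in> carrier K" "hlim K (\<lambda>n. g (r n)) y"
      using K.complete Cauchy_iff r(1) by blast
    have "hlim K (\<lambda>n. g (s n)) y" if s: "\<And>n. s n \<in> I" "hlim H (\<lambda>n. f (s n)) x" for s
    proof -
      let ?u = "\<lambda>n. hnorm H (f (s n) \<ominus>\<^bsub>H\<^esub> x) + hnorm H (f (r n) \<ominus>\<^bsub>H\<^esub> x) + hnorm K (g (r n) \<ominus>\<^bsub>K\<^esub> y)"
      have "?u \<longlonglongrightarrow> 0 + 0 + 0"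
        using r(2) s(2) y(2) unfolding hlim_def by (intro tendsto_intros)
      moreover have "hnorm K (g (s n) \<ominus>\<^bsub>K\<^esub> y) \<le> ?u n" for n
        using K.hnorm_minus_triangle[of "g (s n)" "g (r n)" y] dist[of "s n" "r n"]
          H.hnorm_minus_triangle[of "f (s n)" x "f (r n)"] H.hnorm_minus_commute[of x "f (r n)"]
          r(1)[of n] s(1)[of n] x y(1) by simp
      ultimately show ?thesis unfolding hlim_def
        using s(1) y(1) by (rule_tac squeeze_zero[of ?u]) simp_all
    qed
    with y(1) show ?thesis by blast
  qed
  then obtain U where U: "\<And>x. x \<in> carrier H \<Longrightarrow> U x \<in> carrier K"
    "\<And>x s. \<lbrakk>x \<in> carrier H; \<And>n. s n \<in> I; hlim H (\<lambda>n. f (s n)) x\<rbrakk> \<Longrightarrow> hlim K (\<lambda>n. g (s n)) (U x)"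
    by metis
  have "unitary_op H K U"
  proof (rule unitary_opI)
    fix y assume y: "y \<in> carrier K"
    obtain h where h: "\<And>n. h n \<in> g ` I" "hlim K h y" using K.dense_in_sequence[OF g y] by blast
    then obtain s where s: "\<And>n. s n \<in> I" and hs: "\<And>n. h n = g (s n)" unfolding image_iff Bex_def by metis
    from hs have "h = (\<lambda>n. g (s n))" by auto
    with h(2) have sy: "hlim K (\<lambda>n. g (s n)) y" by simp
    then have "hCauchy H (\<lambda>n. f (s n))"
      using Cauchy_iff s K.hlim_hCauchy y by simp
    then obtain x where x: "x \<in> carrier H" "hlim H (\<lambda>n. f (s n)) x" using H.complete by blast
    then have "U x = y"
      using K.hlim_unique[OF _ _ _ y sy] U s by simp
    with x show "\<exists>x\<in>carrier H. U x = y" by blast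
  next
    fix x y assume xy: "x \<in> carrier H" "y \<in> carrier H"
    obtain r where r: "\<And>n. r n \<in> I" "hlim H (\<lambda>n. f (r n)) x" using seq xy by blast
    obtain s where s: "\<And>n. s n \<in> I" "hlim H (\<lambda>n. f (s n)) y" using seq xy by blast
    have "(\<lambda>n. hinner K (g (r n)) (g (s n))) \<longlonglongrightarrow> hinner K (U x) (U y)"
      using U r s xy by (intro K.tendsto_hinner) auto
    moreover have "(\<lambda>n. hinner H (f (r n)) (f (s n))) \<longlonglongrightarrow> hinner H x y"
      using r s xy by (intro H.tendsto_hinner) auto
    ultimately show "hinner K (U x) (U y) = hinner H x y"
      using gram r(1) s(1) LIMSEQ_unique by auto
  qed (use U in \<open>auto intro: H.inner_product_space_axioms K.inner_product_space_axioms\<close>)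
  moreover have "U (f s) = g s" if "s \<in> I" for s
    using U(2)[of "f s" "\<lambda>_. s"] that K.hlim_unique[of "\<lambda>_. g s" "U (f s)" "g s"]
      H.hlim_const K.hlim_const U(1) by simp
  ultimately show ?thesis using that by blast
qed

section \<open>Adjoints and P-modules\<close>

lemma (in inner_product_space) nonneg_quadratic_imp_zero:
  fixes a :: complex and b :: real
  assumes "\<And>t. 0 \<le> (cmod t)\<^sup>2 * b + 2 * Re (t * a)"
  shows "a = 0"
proof (rule ccontr)
  assume a: "a \<noteq> 0"
  \<comment> \<open>small enough for the linear term to win at \<open>t = - s \<cdot> cnj a\<close>\<close>
  define s where "s = 1 / (\<bar>b\<bar> + 1)"
  have s: "s > 0" "s * b < 2"
    by (auto simp: s_def field_simps)
  have "Re (cnj a * a) = (cmod a)\<^sup>2" unfolding cmod_power2 by (simp add: power2_eq_square)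
  then have "0 \<le> (s * cmod a)\<^sup>2 * b - 2 * s * (cmod a)\<^sup>2"
    using assms[of "- (of_real s * cnj a)"] s by (simp add: norm_mult mult.assoc)
  also have "\<dots> = s * (cmod a)\<^sup>2 * (s * b - 2)"
    by (simp add: power2_eq_square algebra_simps)
  also have "\<dots> < 0"
    using a s by (intro mult_pos_neg) auto
  finally show False by simp
qed

text \<open>
  The representing vector is the minimizer of \<open>J x = \<parallel>x\<parallel>\<^sup>2 - 2 Re (\<phi> x)\<close>, which is bounded below because
  \<open>\<phi>\<close> is bounded. By the parallelogram identity minimizing sequences are Cauchy, and \<open>\<phi> x = \<langle>x, y\<rangle>\<close> is
  the vanishing of the derivative of \<open>J\<close> at the minimizer \<open>y\<close>.
\<close>

theorem (in hilbert_space) Riesz_representation: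
  assumes add: "\<And>x y. \<lbrakk>x \<in> carrier H; y \<in> carrier H\<rbrakk> \<Longrightarrow> \<phi> (x \<oplus> y) = \<phi> x + \<phi> y"
    and smult: "\<And>c x. x \<in> carrier H \<Longrightarrow> \<phi> (c \<odot> x) = c * \<phi> x"
    and bound: "\<And>x. x \<in> carrier H \<Longrightarrow> cmod (\<phi> x) \<le> c * hnorm H x"
  obtains y where "y \<in> carrier H" "\<And>x. x \<in> carrier H \<Longrightarrow> \<phi> x = hinner H x y"
proof -
  define J where "J x = (hnorm H x)\<^sup>2 - 2 * Re (\<phi> x)" for x
  have diff: "\<phi> (x \<ominus> y) = \<phi> x - \<phi> y" if "x \<in> carrier H" "y \<in> carrier H" for x y
  proof -
    have "x \<ominus> y = x \<oplus> (-1) \<odot> y" using that by (intro hinner_eqI) (simp_all add: hinner_left)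
    then show ?thesis using that by (simp add: add smult)
  qed
  have below: "- c\<^sup>2 \<le> J x" if x: "x \<in> carrier H" for x
  proof -
    have "Re (\<phi> x) \<le> c * hnorm H x"
      using bound[OF x] complex_Re_le_cmod[of "\<phi> x"] by simp
    moreover have "0 \<le> (hnorm H x - c)\<^sup>2" by simp
    ultimately show ?thesis by (simp add: J_def power2_diff algebra_simps)
  qed
  define m where "m = Inf (J ` carrier H)"
  have bdd: "bdd_below (J ` carrier H)" using below by (intro bdd_belowI2)
  have m_le: "m \<le> J x" if "x \<in> carrier H" for x
    unfolding m_def using bdd that by (intro cInf_lower) auto
  have "\<exists>x\<in>carrier H. J x < m + 1 / real (Suc n)" for n
  proof -
    have 1: "Inf (J ` carrier H) < m + 1 / real (Suc n)" by (simp add: m_def)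
    have 2: "J ` carrier H \<noteq> {}" using M.zero_closed by blast
    from cInf_lessD[OF 2 1] show ?thesis by auto
  qed
  then obtain f where f: "\<And>n. f n \<in> carrier H" "\<And>n. J (f n) < m + 1 / real (Suc n)" by metis
  have parallelogram: "(hnorm H (x \<ominus> y))\<^sup>2 \<le> 2 * (J x - m) + 2 * (J y - m)"
    if "x \<in> carrier H" "y \<in> carrier H" for x y
  proof -
    have "(hnorm H (x \<ominus> y))\<^sup>2 = 2 * J x + 2 * J y - 4 * J ((1/2) \<odot> (x \<oplus> y))"
      using that by (simp add: J_def hnorm_minus_power2 hnorm_smult smult add power_mult_distrib
          hnorm_add_power2 power_divide add_divide_distrib algebra_simps)
    moreover have "m \<le> J ((1/2) \<odot> (x \<oplus> y))" using that by (intro m_le) simp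
    ultimately show ?thesis by simp
  qed
  have "hCauchy H f"
    unfolding hCauchy_def
  proof (intro conjI allI impI)
    fix e :: real assume e: "e > 0"
    then obtain N where N: "1 / real (Suc N) < e\<^sup>2 / 4"
      using nat_approx_posE[of "e\<^sup>2 / 4"] by (metis zero_less_power zero_less_divide_iff zero_less_numeral)
    have J: "J (f n) - m < e\<^sup>2 / 4" if "n \<ge> N" for n
    proof -
      have "1 / real (Suc n) \<le> 1 / real (Suc N)" using that by (simp add: frac_le)
      then show ?thesis using f(2)[of n] N by linarith
    qed
    show "\<exists>N. \<forall>m\<ge>N. \<forall>n\<ge>N. hnorm H (f m \<ominus> f n) < e"
    proof (intro exI[of _ N] allI impI)
      fix k n assume "k \<ge> N" "n \<ge> N"
      then have "(hnorm H (f k \<ominus> f n))\<^sup>2 < e\<^sup>2"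
        using parallelogram[of "f k" "f n"] J[of k] J[of n] f(1) by (auto simp: field_simps)
      then show "hnorm H (f k \<ominus> f n) < e" using e by (simp add: power_less_imp_less_base)
    qed
  qed (fact f)
  then obtain y where y: "y \<in> carrier H" "hlim H f y" using complete by blast
  have "(\<lambda>n. \<phi> (f n) - \<phi> y) \<longlonglongrightarrow> 0"
    using y(2) unfolding hlim_def
    by (rule tendsto_0_le[where K = c])
       (use bound f(1) y(1) in \<open>auto intro!: always_eventually simp: diff[symmetric] mult.commute\<close>)
  then have "(\<lambda>n. J (f n)) \<longlonglongrightarrow> J y"
    unfolding J_def using y f(1)
    by (intro tendsto_intros tendsto_hnorm) (simp_all add: LIM_zero_iff)
  moreover have "(\<lambda>n. m + 1 / real (Suc n)) \<longlonglongrightarrow> m + 0"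
    using lim_1_over_n[THEN LIMSEQ_Suc] by (intro tendsto_intros) simp
  ultimately have Jy: "J y \<le> m"
    using LIMSEQ_le[of "\<lambda>n. J (f n)" "J y" "\<lambda>n. m + 1 / real (Suc n)" m] f(2)
    by (auto intro: less_imp_le)
  have "\<phi> x = hinner H x y" if x: "x \<in> carrier H" for x
  proof -
    have "hinner H x y - \<phi> x = 0"
    proof (rule nonneg_quadratic_imp_zero)
      fix t
      have "J y \<le> J (y \<oplus> t \<odot> x)" using Jy m_le[of "y \<oplus> t \<odot> x"] x y by simp
      moreover have "Re (cnj t * hinner H y x) = Re (t * hinner H x y)"
        using hinner_commute[of x y] x y by simp
      ultimately show "0 \<le> (cmod t)\<^sup>2 * (hnorm H x)\<^sup>2 + 2 * Re (t * (hinner H x y - \<phi> x))"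
        using x y(1) by (simp add: J_def hnorm_add_power2 hnorm_smult add smult hinner_smult_right
            power_mult_distrib right_diff_distrib)
    qed
    then show ?thesis by simp
  qed
  with y(1) show ?thesis using that by blast
qed

lemma (in inner_product_space) adjoint_eqI:
  assumes "x \<in> carrier H" "\<And>z. z \<in> carrier H \<Longrightarrow> hinner H (T z) y = hinner H z x"
  shows "adjoint H T y = x"
  unfolding adjoint_def
proof (rule the_equality)
  fix x' assume x': "x' \<in> carrier H \<and> (\<forall>z\<in>carrier H. hinner H (T z) y = hinner H z x')"
  show "x' = x"
  proof (rule hinner_eqI)
    fix z assume z: "z \<in> carrier H"
    then have "hinner H z x' = hinner H z x" using assms x' by simp
    then show "hinner H x' z = hinner H x z"
      using hinner_commute[of z x'] hinner_commute[of z x] x' assms(1) z by simp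
  qed (use x' assms in simp_all)
qed (use assms in simp)

lemma (in hilbert_space) adjoint:
  assumes T: "bounded_op H H T" and y: "y \<in> carrier H"
  shows adjoint_closed: "adjoint H T y \<in> carrier H"
    and hinner_adjoint: "z \<in> carrier H \<Longrightarrow> hinner H z (adjoint H T y) = hinner H (T z) y"
proof -
  have lin: "linear_op H H T" using T by (simp add: bounded_op_def)
  obtain c where c: "\<And>x. x \<in> carrier H \<Longrightarrow> hnorm H (T x) \<le> c * hnorm H x"
    using T by (auto simp: bounded_op_def)
  have "cmod (hinner H (T x) y) \<le> (c * hnorm H y) * hnorm H x" if x: "x \<in> carrier H" for x
  proof -
    have "cmod (hinner H (T x) y) \<le> hnorm H (T x) * hnorm H y"
      using x y linear_opD(1)[OF lin] by (intro Cauchy_Schwarz) auto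
    also have "\<dots> \<le> (c * hnorm H x) * hnorm H y"
      using c[OF x] y by (intro mult_right_mono) auto
    finally show ?thesis by (simp add: mult_ac)
  qed
  then obtain x where x: "x \<in> carrier H" "\<And>z. z \<in> carrier H \<Longrightarrow> hinner H (T z) y = hinner H z x"
    using y by (rule_tac Riesz_representation[of "\<lambda>z. hinner H (T z) y" "c * hnorm H y"])
      (auto simp: linear_opD[OF lin] hinner_left)
  then have "adjoint H T y = x" by (rule adjoint_eqI)
  then show "adjoint H T y \<in> carrier H"
    and "z \<in> carrier H \<Longrightarrow> hinner H z (adjoint H T y) = hinner H (T z) y"
    using x by simp_all
qed

text \<open>
  The defining equation of a P-module, freed from adjoints: it says that \<open>\<xi> \<mapsto> (A \<xi>, B \<xi>)\<close> is an isometry.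
  This form needs the existence of adjoints, hence the representation theorem of Riesz, since
  \<^const>\<open>adjoint\<close> is a definite description.
\<close>

lemma P_module_iff:
  "P_module H A B \<longleftrightarrow> hilbert_space H \<and> linear_op H H A \<and> linear_op H H B \<and>
     (\<forall>x\<in>carrier H. \<forall>y\<in>carrier H. hinner H (A x) (A y) + hinner H (B x) (B y) = hinner H x y)"
    (is "?L \<longleftrightarrow> ?R")
proof
  assume L: ?L
  then interpret hilbert_space H by (simp add: P_module_def)
  have AB: "bounded_op H H A" "bounded_op H H B"
    and eq: "adjoint H A (A y) \<oplus>\<^bsub>H\<^esub> adjoint H B (B y) = y" if "y \<in> carrier H" for y
    using L that by (auto simp: P_module_def)
  have lin: "linear_op H H A" "linear_op H H B"
    using L by (auto simp: P_module_def bounded_op_def)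
  have "hinner H (A x) (A y) + hinner H (B x) (B y) = hinner H x y"
    if xy: "x \<in> carrier H" "y \<in> carrier H" for x y
  proof -
    have "hinner H (A x) (A y) + hinner H (B x) (B y)
        = hinner H x (adjoint H A (A y) \<oplus>\<^bsub>H\<^esub> adjoint H B (B y))"
      using xy AB[OF xy(1)] linear_opD(1)[OF lin(1)] linear_opD(1)[OF lin(2)]
      by (simp add: hinner_adjoint adjoint_closed hinner_add_right)
    with eq[OF xy(2)] show ?thesis by simp
  qed
  with lin hilbert_space_axioms show ?R by blast
next
  assume R: ?R
  then interpret hilbert_space H by simp
  have sum: "hinner H (A x) (A y) + hinner H (B x) (B y) = hinner H x y"
    if "x \<in> carrier H" "y \<in> carrier H" for x y
    using R that by auto
  have lin: "linear_op H H A" "linear_op H H B" using R by auto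
  have cl: "A x \<in> carrier H" "B x \<in> carrier H" if "x \<in> carrier H" for x
    using linear_opD(1)[OF lin(1)] linear_opD(1)[OF lin(2)] that by auto
  have "hnorm H (A x) \<le> 1 * hnorm H x \<and> hnorm H (B x) \<le> 1 * hnorm H x" if x: "x \<in> carrier H" for x
  proof -
    have "(hnorm H (A x))\<^sup>2 + (hnorm H (B x))\<^sup>2 = (hnorm H x)\<^sup>2"
      using sum[OF x x] x cl by (simp add: hnorm_power2 flip: plus_complex.simps)
    then have "(hnorm H (A x))\<^sup>2 \<le> (hnorm H x)\<^sup>2" "(hnorm H (B x))\<^sup>2 \<le> (hnorm H x)\<^sup>2"
      using zero_le_power2[of "hnorm H (A x)"] zero_le_power2[of "hnorm H (B x)"] by linarith+
    then show ?thesis using x cl by (simp add: abs_le_square_iff[symmetric])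
  qed
  with lin have AB: "bounded_op H H A" "bounded_op H H B"
    unfolding bounded_op_def by blast+
  have "adjoint H A (A y) \<oplus>\<^bsub>H\<^esub> adjoint H B (B y) = y" if y: "y \<in> carrier H" for y
  proof (rule hinner_eqI)
    fix z assume z: "z \<in> carrier H"
    have "hinner H z (adjoint H A (A y) \<oplus>\<^bsub>H\<^esub> adjoint H B (B y)) = hinner H z y"
      using AB y z cl sum by (simp add: hinner_adjoint adjoint_closed hinner_add_right)
    then show "hinner H (adjoint H A (A y) \<oplus>\<^bsub>H\<^esub> adjoint H B (B y)) z = hinner H y z"
      using hinner_commute[of z y] hinner_commute[of z "adjoint H A (A y) \<oplus>\<^bsub>H\<^esub> adjoint H B (B y)"]
        AB y z cl by (simp add: adjoint_closed)
  qed (use AB y cl in \<open>simp_all add: adjoint_closed\<close>)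
  with AB show ?L using R by (simp add: P_module_def)
qed

section \<open>Completion\<close>

context inner_product_space
begin

lemma hCauchyD:
  assumes "hCauchy H f"
  shows "f n \<in> carrier H"
    and "e > 0 \<Longrightarrow> \<exists>N. \<forall>m\<ge>N. \<forall>n\<ge>N. hnorm H (f m \<ominus> f n) < e"
  using assms by (auto simp: hCauchy_def)

lemma hCauchyI:
  assumes "\<And>n. f n \<in> carrier H"
    and "\<And>e. e > 0 \<Longrightarrow> \<exists>N. \<forall>m\<ge>N. \<forall>n\<ge>N. hnorm H (f m \<ominus> f n) \<le> e"
  shows "hCauchy H f"
  unfolding hCauchy_def
proof (intro conjI allI impI)
  fix e :: real assume "e > 0"
  then have "e / 2 > 0" "e / 2 < e" by auto
  then show "\<exists>N. \<forall>m\<ge>N. \<forall>n\<ge>N. hnorm H (f m \<ominus> f n) < e"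
    using assms(2)[of "e / 2"] by (meson order_le_less_trans)
qed (fact assms)

lemma hCauchy_const: "x \<in> carrier H \<Longrightarrow> hCauchy H (\<lambda>_. x)"
  by (intro hCauchyI) simp_all

lemma hCauchy_add:
  assumes f: "hCauchy H f" and g: "hCauchy H g"
  shows "hCauchy H (\<lambda>n. f n \<oplus> g n)"
proof (rule hCauchyI)
  note fg [simp] = hCauchyD(1)[OF f] hCauchyD(1)[OF g]
  show "f n \<oplus> g n \<in> carrier H" for n by simp
  fix e :: real assume "e > 0"
  then obtain N M where N: "\<forall>m\<ge>N. \<forall>n\<ge>N. hnorm H (f m \<ominus> f n) < e / 2"
    and M: "\<forall>m\<ge>M. \<forall>n\<ge>M. hnorm H (g m \<ominus> g n) < e / 2"
    using hCauchyD(2)[OF f, of "e / 2"] hCauchyD(2)[OF g, of "e / 2"] by auto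
  have eq: "(f m \<oplus> g m) \<ominus> (f n \<oplus> g n) = (f m \<ominus> f n) \<oplus> (g m \<ominus> g n)" for m n
    by (rule hinner_eqI) (simp_all add: hinner_left)
  show "\<exists>N. \<forall>m\<ge>N. \<forall>n\<ge>N. hnorm H ((f m \<oplus> g m) \<ominus> (f n \<oplus> g n)) \<le> e"
  proof (intro exI[of _ "max N M"] allI impI)
    fix m n assume *: "m \<ge> max N M" "n \<ge> max N M"
    have "hnorm H (f m \<ominus> f n) < e / 2" "hnorm H (g m \<ominus> g n) < e / 2" using N M * by auto
    then show "hnorm H ((f m \<oplus> g m) \<ominus> (f n \<oplus> g n)) \<le> e"
      unfolding eq using hnorm_triangle[of "f m \<ominus> f n" "g m \<ominus> g n"] by simp
  qed
qed

lemma hCauchy_smult: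
  assumes f: "hCauchy H f"
  shows "hCauchy H (\<lambda>n. c \<odot> f n)"
proof (rule hCauchyI)
  note f' [simp] = hCauchyD(1)[OF f]
  show "c \<odot> f n \<in> carrier H" for n by simp
  fix e :: real assume e: "e > 0"
  then have "e / (cmod c + 1) > 0" by (simp add: add_nonneg_pos)
  then obtain N where N: "\<forall>m\<ge>N. \<forall>n\<ge>N. hnorm H (f m \<ominus> f n) < e / (cmod c + 1)"
    using hCauchyD(2)[OF f] by blast
  have eq: "c \<odot> f m \<ominus> c \<odot> f n = c \<odot> (f m \<ominus> f n)" for m n
    by (rule hinner_eqI) (simp_all add: hinner_left right_diff_distrib)
  show "\<exists>N. \<forall>m\<ge>N. \<forall>n\<ge>N. hnorm H (c \<odot> f m \<ominus> c \<odot> f n) \<le> e"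
  proof (intro exI[of _ N] allI impI)
    fix m n assume "m \<ge> N" "n \<ge> N"
    then have "hnorm H (f m \<ominus> f n) * (cmod c + 1) < e"
      using N by (simp add: pos_less_divide_eq add_nonneg_pos)
    moreover have "cmod c * hnorm H (f m \<ominus> f n) \<le> hnorm H (f m \<ominus> f n) * (cmod c + 1)"
      by (simp add: algebra_simps)
    ultimately show "hnorm H (c \<odot> f m \<ominus> c \<odot> f n) \<le> e"
      unfolding eq by (simp add: hnorm_smult)
  qed
qed

lemma hCauchy_minus:
  assumes f: "hCauchy H f" and g: "hCauchy H g"
  shows "hCauchy H (\<lambda>n. f n \<ominus> g n)"
proof -
  have "f n \<ominus> g n = f n \<oplus> (-1) \<odot> g n" for n
    by (rule hinner_eqI) (simp_all add: hinner_left hCauchyD(1)[OF f] hCauchyD(1)[OF g])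
  then show ?thesis using hCauchy_add[OF f hCauchy_smult[OF g, of "-1"]] by simp
qed

lemma hCauchy_bounded:
  assumes f: "hCauchy H f"
  obtains B where "B > 0" "\<And>n. hnorm H (f n) \<le> B"
proof -
  obtain N where N: "\<forall>m\<ge>N. \<forall>n\<ge>N. hnorm H (f m \<ominus> f n) < 1"
    using hCauchyD(2)[OF f, of 1] by auto
  define B where "B = Max ((\<lambda>n. hnorm H (f n)) ` {..N}) + 1"
  have le: "hnorm H (f n) \<le> B - 1" if "n \<le> N" for n
    unfolding B_def using that by (auto intro!: Max_ge)
  have "hnorm H (f n) \<le> B" for n
  proof (cases "n \<le> N")
    case False
    then show ?thesis
      using N[rule_format, of n N] le[of N] hnorm_triangle_minus[of "f n" "f N"] hCauchyD(1)[OF f]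
      by force
  qed (use le in force)
  moreover have "B > 0" using le[of 0] hnorm_nonneg[OF hCauchyD(1)[OF f, of 0]] by linarith
  ultimately show ?thesis using that by blast
qed

lemma hinner_difference_bound:
  assumes "a \<in> carrier H" "a' \<in> carrier H" "b \<in> carrier H" "b' \<in> carrier H"
  shows "cmod (hinner H a b - hinner H a' b') \<le> hnorm H (a \<ominus> a') * hnorm H b + hnorm H a' * hnorm H (b \<ominus> b')"
proof -
  have "hinner H a b - hinner H a' b' = hinner H (a \<ominus> a') b + hinner H a' (b \<ominus> b')"
    using assms by (simp add: hinner_left hinner_right)
  then show ?thesis
    using assms by (auto intro!: norm_triangle_mono Cauchy_Schwarz)
qed

lemma hinner_hCauchy_convergent:
  assumes f: "hCauchy H f" and g: "hCauchy H g"
  shows "convergent (\<lambda>n. hinner H (f n) (g n))"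
proof (rule Cauchy_convergent, rule CauchyI)
  note [simp] = hCauchyD(1)[OF f] hCauchyD(1)[OF g]
  fix e :: real assume e: "e > 0"
  obtain B where B: "B > 0" "\<And>n. hnorm H (f n) \<le> B" using hCauchy_bounded[OF f] by blast
  obtain C where C: "C > 0" "\<And>n. hnorm H (g n) \<le> C" using hCauchy_bounded[OF g] by blast
  obtain N where N: "\<forall>m\<ge>N. \<forall>n\<ge>N. hnorm H (f m \<ominus> f n) < e / (2 * C)"
    using hCauchyD(2)[OF f, of "e / (2 * C)"] C(1) e by auto
  obtain M where M: "\<forall>m\<ge>M. \<forall>n\<ge>M. hnorm H (g m \<ominus> g n) < e / (2 * B)"
    using hCauchyD(2)[OF g, of "e / (2 * B)"] B(1) e by auto
  show "\<exists>M. \<forall>m\<ge>M. \<forall>n\<ge>M. norm (hinner H (f m) (g m) - hinner H (f n) (g n)) < e"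
  proof (intro exI[of _ "max N M"] allI impI)
    fix m n assume *: "m \<ge> max N M" "n \<ge> max N M"
    have "norm (hinner H (f m) (g m) - hinner H (f n) (g n))
        \<le> hnorm H (f m \<ominus> f n) * hnorm H (g m) + hnorm H (f n) * hnorm H (g m \<ominus> g n)"
      by (rule hinner_difference_bound) simp_all
    also have "\<dots> \<le> hnorm H (f m \<ominus> f n) * C + B * hnorm H (g m \<ominus> g n)"
      using B C by (intro add_mono mult_mono) (auto intro: less_imp_le)
    also have "\<dots> < e / (2 * C) * C + B * (e / (2 * B))"
      using N M * B(1) C(1) by (intro add_strict_mono mult_strict_left_mono mult_strict_right_mono) auto
    also have "\<dots> = e" using B(1) C(1) by simp
    finally show "norm (hinner H (f m) (g m) - hinner H (f n) (g n)) < e" .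
  qed
qed

text \<open>
  The operations of the completion are definite descriptions over representatives. The next lemmas
  evaluate them on the classes of given Cauchy sequences.
\<close>

lemma equiv_null_rel: "equiv {f. hCauchy H f} (null_rel H)"
proof (rule equivI)
  show "null_rel H \<subseteq> {f. hCauchy H f} \<times> {f. hCauchy H f}" by (auto simp: null_rel_def)
  show "refl_on {f. hCauchy H f} (null_rel H)"
    by (auto simp: refl_on_def null_rel_def hCauchyD)
  show "sym (null_rel H)"
    by (auto simp: sym_def null_rel_def hCauchyD hnorm_minus_commute)
  show "trans (null_rel H)"
  proof (rule transI)
    fix f g h assume fg: "(f, g) \<in> null_rel H" and gh: "(g, h) \<in> null_rel H"
    have C: "hCauchy H f" "hCauchy H g" "hCauchy H h"
      using fg gh by (auto simp: null_rel_def)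
    have "(\<lambda>n. hnorm H (f n \<ominus> g n) + hnorm H (g n \<ominus> h n)) \<longlonglongrightarrow> 0 + 0"
      using fg gh unfolding null_rel_def by (intro tendsto_intros) auto
    then have "(\<lambda>n. hnorm H (f n \<ominus> h n)) \<longlonglongrightarrow> 0"
      by (rule_tac squeeze_zero) (use C in \<open>auto intro!: hnorm_minus_triangle simp: hCauchyD\<close>)
    then show "(f, h) \<in> null_rel H" using C by (simp add: null_rel_def)
  qed
qed

lemma cclass_eq_iff:
  assumes "hCauchy H f" "hCauchy H g"
  shows "cclass H f = cclass H g \<longleftrightarrow> (\<lambda>n. hnorm H (f n \<ominus> g n)) \<longlonglongrightarrow> 0"
  using eq_equiv_class_iff[OF equiv_null_rel, of f g] assms by (simp add: cclass_def null_rel_def)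

lemma carrier_completion_iff: "X \<in> carrier (completion H) \<longleftrightarrow> (\<exists>f. hCauchy H f \<and> X = cclass H f)"
  by (auto simp: completion_def cclass_def quotient_def)

lemma cclass_in_carrier [simp]: "hCauchy H f \<Longrightarrow> cclass H f \<in> carrier (completion H)"
  by (auto simp: carrier_completion_iff)

lemma in_cclass_iff:
  assumes "hCauchy H f"
  shows "g \<in> cclass H f \<longleftrightarrow> hCauchy H g \<and> (\<lambda>n. hnorm H (f n \<ominus> g n)) \<longlonglongrightarrow> 0"
  using assms by (auto simp: cclass_def null_rel_def)

lemma self_in_cclass: "hCauchy H f \<Longrightarrow> f \<in> cclass H f"
  by (simp add: in_cclass_iff hCauchyD)

lemma add_cclass:
  assumes f: "hCauchy H f" and g: "hCauchy H g"
  shows "cclass H f \<oplus>\<^bsub>completion H\<^esub> cclass H g = cclass H (\<lambda>n. f n \<oplus> g n)"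
proof -
  have "(THE Z. \<exists>f'\<in>cclass H f. \<exists>g'\<in>cclass H g. Z = cclass H (\<lambda>n. f' n \<oplus> g' n)) = cclass H (\<lambda>n. f n \<oplus> g n)"
  proof (rule the_equality)
    fix Z assume "\<exists>f'\<in>cclass H f. \<exists>g'\<in>cclass H g. Z = cclass H (\<lambda>n. f' n \<oplus> g' n)"
    then obtain f' g' where *: "hCauchy H f'" "(\<lambda>n. hnorm H (f n \<ominus> f' n)) \<longlonglongrightarrow> 0"
      "hCauchy H g'" "(\<lambda>n. hnorm H (g n \<ominus> g' n)) \<longlonglongrightarrow> 0" and Z: "Z = cclass H (\<lambda>n. f' n \<oplus> g' n)"
      using f g by (auto simp: in_cclass_iff)
    have eq: "(f n \<oplus> g n) \<ominus> (f' n \<oplus> g' n) = (f n \<ominus> f' n) \<oplus> (g n \<ominus> g' n)" for n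
      using f g * by (intro hinner_eqI) (simp_all add: hinner_left hCauchyD)
    have "(\<lambda>n. hnorm H (f n \<ominus> f' n) + hnorm H (g n \<ominus> g' n)) \<longlonglongrightarrow> 0 + 0"
      using * by (intro tendsto_intros)
    then have "(\<lambda>n. hnorm H ((f n \<oplus> g n) \<ominus> (f' n \<oplus> g' n))) \<longlonglongrightarrow> 0"
      by (rule_tac squeeze_zero) (use f g * in \<open>auto simp: eq hCauchyD intro!: hnorm_triangle\<close>)
    then show "Z = cclass H (\<lambda>n. f n \<oplus> g n)"
      unfolding Z using f g * by (subst eq_commute) (simp add: cclass_eq_iff hCauchy_add)
  qed (use f g self_in_cclass in blast)
  then show ?thesis by (simp add: completion_def)
qed

lemma smult_cclass:
  assumes f: "hCauchy H f"
  shows "c \<odot>\<^bsub>completion H\<^esub> cclass H f = cclass H (\<lambda>n. c \<odot> f n)"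
proof -
  have "(THE Z. \<exists>f'\<in>cclass H f. Z = cclass H (\<lambda>n. c \<odot> f' n)) = cclass H (\<lambda>n. c \<odot> f n)"
  proof (rule the_equality)
    fix Z assume "\<exists>f'\<in>cclass H f. Z = cclass H (\<lambda>n. c \<odot> f' n)"
    then obtain f' where *: "hCauchy H f'" "(\<lambda>n. hnorm H (f n \<ominus> f' n)) \<longlonglongrightarrow> 0"
      and Z: "Z = cclass H (\<lambda>n. c \<odot> f' n)"
      using f by (auto simp: in_cclass_iff)
    have eq: "c \<odot> f n \<ominus> c \<odot> f' n = c \<odot> (f n \<ominus> f' n)" for n
      using f * by (intro hinner_eqI) (simp_all add: hinner_left hCauchyD right_diff_distrib)
    have "(\<lambda>n. cmod c * hnorm H (f n \<ominus> f' n)) \<longlonglongrightarrow> cmod c * 0"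
      using * by (intro tendsto_intros)
    then have "(\<lambda>n. hnorm H (c \<odot> f n \<ominus> c \<odot> f' n)) \<longlonglongrightarrow> 0"
      using f * by (simp add: eq hnorm_smult hCauchyD)
    then show "Z = cclass H (\<lambda>n. c \<odot> f n)"
      unfolding Z using f * by (subst eq_commute) (simp add: cclass_eq_iff hCauchy_smult)
  qed (use f self_in_cclass in blast)
  then show ?thesis by (simp add: completion_def)
qed

lemma hinner_cclass:
  assumes f: "hCauchy H f" and g: "hCauchy H g"
  shows "(\<lambda>n. hinner H (f n) (g n)) \<longlonglongrightarrow> hinner (completion H) (cclass H f) (cclass H g)"
proof -
  obtain z where z: "(\<lambda>n. hinner H (f n) (g n)) \<longlonglongrightarrow> z"
    using hinner_hCauchy_convergent[OF f g] by (auto simp: convergent_def)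
  have "(THE z. \<exists>f'\<in>cclass H f. \<exists>g'\<in>cclass H g. (\<lambda>n. hinner H (f' n) (g' n)) \<longlonglongrightarrow> z) = z"
  proof (rule the_equality)
    fix z' assume "\<exists>f'\<in>cclass H f. \<exists>g'\<in>cclass H g. (\<lambda>n. hinner H (f' n) (g' n)) \<longlonglongrightarrow> z'"
    then obtain f' g' where *: "hCauchy H f'" "(\<lambda>n. hnorm H (f n \<ominus> f' n)) \<longlonglongrightarrow> 0"
      "hCauchy H g'" "(\<lambda>n. hnorm H (g n \<ominus> g' n)) \<longlonglongrightarrow> 0" and z': "(\<lambda>n. hinner H (f' n) (g' n)) \<longlonglongrightarrow> z'"
      using f g by (auto simp: in_cclass_iff)
    obtain B where B: "B > 0" "\<And>n. hnorm H (f' n) \<le> B" using hCauchy_bounded[OF *(1)] by blast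
    obtain C where C: "C > 0" "\<And>n. hnorm H (g n) \<le> C" using hCauchy_bounded[OF g] by blast
    have "(\<lambda>n. hnorm H (f n \<ominus> f' n) * C + B * hnorm H (g n \<ominus> g' n)) \<longlonglongrightarrow> 0 * C + B * 0"
      using * by (intro tendsto_intros)
    then have "(\<lambda>n. norm (hinner H (f n) (g n) - hinner H (f' n) (g' n))) \<longlonglongrightarrow> 0"
    proof (rule_tac squeeze_zero)
      fix n
      have "norm (hinner H (f n) (g n) - hinner H (f' n) (g' n))
        \<le> hnorm H (f n \<ominus> f' n) * hnorm H (g n) + hnorm H (f' n) * hnorm H (g n \<ominus> g' n)"
        using f g * by (intro hinner_difference_bound) (simp_all add: hCauchyD)
      also have "\<dots> \<le> hnorm H (f n \<ominus> f' n) * C + B * hnorm H (g n \<ominus> g' n)"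
        using B C f g * by (intro add_mono mult_mono) (auto intro: less_imp_le simp: hCauchyD)
      finally show "norm (hinner H (f n) (g n) - hinner H (f' n) (g' n))
        \<le> hnorm H (f n \<ominus> f' n) * C + B * hnorm H (g n \<ominus> g' n)" .
    qed simp_all
    then have "(\<lambda>n. hinner H (f n) (g n) - hinner H (f' n) (g' n)) \<longlonglongrightarrow> 0"
      by (rule tendsto_norm_zero_cancel)
    then have "(\<lambda>n. hinner H (f n) (g n) - (hinner H (f n) (g n) - hinner H (f' n) (g' n))) \<longlonglongrightarrow> z - 0"
      using z by (intro tendsto_diff)
    then show "z' = z" using z' LIMSEQ_unique by auto
  qed (use f g z self_in_cclass in blast)
  then show ?thesis using z by (simp add: completion_def)
qed

lemma inner_product_space_completion: "inner_product_space (completion H)"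
proof (rule inner_product_spaceI)
  let ?C = "completion H"
  have zero: "\<zero>\<^bsub>?C\<^esub> = cclass H (\<lambda>_. \<zero>)" by (simp add: completion_def)
  show "\<zero>\<^bsub>?C\<^esub> \<in> carrier ?C" by (simp add: zero hCauchy_const)
  fix X Y Z and c :: complex
  {
    assume "X \<in> carrier ?C" then obtain f where f: "hCauchy H f" "X = cclass H f"
      by (auto simp: carrier_completion_iff)
    note [simp] = hCauchyD(1)[OF f(1)]
    show "c \<odot>\<^bsub>?C\<^esub> X \<in> carrier ?C"
      using f by (simp add: smult_cclass hCauchy_smult)
    show "hinner ?C \<zero>\<^bsub>?C\<^esub> X = 0"
      using hinner_cclass[OF hCauchy_const f(1), of \<zero>] LIMSEQ_unique[OF _ tendsto_const]
      by (simp add: zero f hinner_zero_left)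
    have "(\<lambda>n. Re (hinner H (f n) (f n))) \<longlonglongrightarrow> Re (hinner ?C X X)"
      unfolding f using hinner_cclass[OF f(1) f(1)] by (intro tendsto_intros)
    then show "0 \<le> Re (hinner ?C X X)"
      by (rule LIMSEQ_le_const) (simp add: hinner_nonneg)
    assume "Y \<in> carrier ?C" then obtain g where g: "hCauchy H g" "Y = cclass H g"
      by (auto simp: carrier_completion_iff)
    note [simp] = hCauchyD(1)[OF g(1)]
    show "X \<oplus>\<^bsub>?C\<^esub> Y \<in> carrier ?C"
      using f g by (simp add: add_cclass hCauchy_add)
    have "(\<lambda>n. c * hinner H (f n) (g n)) \<longlonglongrightarrow> c * hinner ?C X Y"
      unfolding f g using hinner_cclass[OF f(1) g(1)] by (intro tendsto_intros)
    then show "hinner ?C (c \<odot>\<^bsub>?C\<^esub> X) Y = c * hinner ?C X Y"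
      using hinner_cclass[OF hCauchy_smult[OF f(1)] g(1), of c] LIMSEQ_unique
      by (fastforce simp: f g smult_cclass hinner_left)
    have "(\<lambda>n. cnj (hinner H (f n) (g n))) \<longlonglongrightarrow> cnj (hinner ?C X Y)"
      unfolding f g using hinner_cclass[OF f(1) g(1)] by (intro tendsto_intros)
    moreover have "(\<lambda>n. cnj (hinner H (f n) (g n))) = (\<lambda>n. hinner H (g n) (f n))"
      by (simp flip: hinner_commute)
    ultimately show "hinner ?C Y X = cnj (hinner ?C X Y)"
      using hinner_cclass[OF g(1) f(1)] LIMSEQ_unique by (simp add: f g)
    {
      assume *: "\<And>z. z \<in> carrier ?C \<Longrightarrow> hinner ?C X z = hinner ?C Y z"
      let ?h = "\<lambda>n. f n \<ominus> g n"
      have h: "hCauchy H ?h" using f g by (simp add: hCauchy_minus)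
      have "(\<lambda>n. hinner H (f n) (?h n) - hinner H (g n) (?h n)) \<longlonglongrightarrow>
          hinner ?C X (cclass H ?h) - hinner ?C Y (cclass H ?h)"
        unfolding f g using f g h by (intro tendsto_diff hinner_cclass)
      then have "(\<lambda>n. hinner H (?h n) (?h n)) \<longlonglongrightarrow> 0"
        using *[of "cclass H ?h"] h by (simp add: hinner_minus_left)
      then have "(\<lambda>n. hnorm H (?h n)) \<longlonglongrightarrow> sqrt (Re 0)"
        unfolding hnorm_def by (intro tendsto_intros)
      then show "X = Y" using f g by (simp add: cclass_eq_iff)
    }
    assume "Z \<in> carrier ?C" then obtain h where h: "hCauchy H h" "Z = cclass H h"
      by (auto simp: carrier_completion_iff)
    note [simp] = hCauchyD(1)[OF h(1)]
    have "(\<lambda>n. hinner H (f n) (h n) + hinner H (g n) (h n)) \<longlonglongrightarrow> hinner ?C X Z + hinner ?C Y Z"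
      unfolding f g h using f g h by (intro tendsto_add hinner_cclass)
    then show "hinner ?C (X \<oplus>\<^bsub>?C\<^esub> Y) Z = hinner ?C X Z + hinner ?C Y Z"
      using hinner_cclass[OF hCauchy_add[OF f(1) g(1)] h(1)] LIMSEQ_unique
      by (fastforce simp: f g h add_cclass hinner_left)
  }
qed

interpretation C: inner_product_space "completion H"
  by (rule inner_product_space_completion)

lemma hnorm_cclass: "hCauchy H f \<Longrightarrow> (\<lambda>n. hnorm H (f n)) \<longlonglongrightarrow> hnorm (completion H) (cclass H f)"
  unfolding hnorm_def by (intro tendsto_intros hinner_cclass)

lemma minus_cclass:
  assumes f: "hCauchy H f" and g: "hCauchy H g"
  shows "cclass H f \<ominus>\<^bsub>completion H\<^esub> cclass H g = cclass H (\<lambda>n. f n \<ominus> g n)"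
proof -
  have "cclass H f \<ominus>\<^bsub>completion H\<^esub> cclass H g
      = cclass H f \<oplus>\<^bsub>completion H\<^esub> (-1) \<odot>\<^bsub>completion H\<^esub> cclass H g"
    using f g by (intro C.hinner_eqI) (simp_all add: C.hinner_left)
  also have "\<dots> = cclass H (\<lambda>n. f n \<oplus> (-1) \<odot> g n)"
    using f g by (simp add: smult_cclass add_cclass hCauchy_smult)
  also have "(\<lambda>n. f n \<oplus> (-1) \<odot> g n) = (\<lambda>n. f n \<ominus> g n)"
    using f g by (intro ext hinner_eqI) (simp_all add: hinner_left hCauchyD)
  finally show ?thesis .
qed

definition emb :: "'a \<Rightarrow> (nat \<Rightarrow> 'a) set" where
  "emb x = cclass H (\<lambda>_. x)"

lemma emb_closed [simp]: "x \<in> carrier H \<Longrightarrow> emb x \<in> carrier (completion H)"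
  by (simp add: emb_def hCauchy_const)

lemma hinner_emb:
  "\<lbrakk>x \<in> carrier H; y \<in> carrier H\<rbrakk> \<Longrightarrow> hinner (completion H) (emb x) (emb y) = hinner H x y"
  using hinner_cclass[OF hCauchy_const hCauchy_const] LIMSEQ_unique[OF _ tendsto_const]
  by (fastforce simp: emb_def)

lemma hnorm_emb: "x \<in> carrier H \<Longrightarrow> hnorm (completion H) (emb x) = hnorm H x"
  by (simp add: hnorm_def hinner_emb)

lemma linear_op_emb: "linear_op H (completion H) emb"
  by (auto simp: linear_op_def emb_def add_cclass smult_cclass hCauchy_const)

lemma hlim_emb:
  assumes f: "hCauchy H f"
  shows "hlim (completion H) (\<lambda>n. emb (f n)) (cclass H f)"
  unfolding hlim_def
proof (rule LIMSEQ_I)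
  note [simp] = hCauchyD(1)[OF f]
  fix e :: real assume "e > 0"
  then obtain N where N: "\<forall>m\<ge>N. \<forall>n\<ge>N. hnorm H (f m \<ominus> f n) < e / 2"
    using hCauchyD(2)[OF f, of "e / 2"] by auto
  show "\<exists>N. \<forall>n\<ge>N. norm (hnorm (completion H) (emb (f n) \<ominus>\<^bsub>completion H\<^esub> cclass H f) - 0) < e"
  proof (intro exI[of _ N] allI impI)
    fix n assume n: "n \<ge> N"
    have "(\<lambda>m. hnorm H (f n \<ominus> f m)) \<longlonglongrightarrow> hnorm (completion H) (cclass H (\<lambda>m. f n \<ominus> f m))"
      using f by (intro hnorm_cclass hCauchy_minus hCauchy_const) simp_all
    then have "hnorm (completion H) (cclass H (\<lambda>m. f n \<ominus> f m)) \<le> e / 2"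
      using N n by (intro LIMSEQ_le_const2) (auto intro!: exI[of _ N] less_imp_le)
    moreover have "emb (f n) \<ominus>\<^bsub>completion H\<^esub> cclass H f = cclass H (\<lambda>m. f n \<ominus> f m)"
      using f by (simp add: emb_def minus_cclass hCauchy_const)
    moreover have "0 \<le> hnorm (completion H) (cclass H (\<lambda>m. f n \<ominus> f m))"
      using f by (intro C.hnorm_nonneg cclass_in_carrier hCauchy_minus hCauchy_const) simp_all
    ultimately show "norm (hnorm (completion H) (emb (f n) \<ominus>\<^bsub>completion H\<^esub> cclass H f) - 0) < e"
      using \<open>e > 0\<close> f by simp
  qed
qed

lemma dense_emb: "dense_in (completion H) (emb ` carrier H)"
  unfolding dense_in_def
proof (intro conjI ballI allI impI)
  fix X and e :: real assume "X \<in> carrier (completion H)" and e: "e > 0"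
  then obtain f where f: "hCauchy H f" "X = cclass H f" by (auto simp: carrier_completion_iff)
  note [simp] = hCauchyD(1)[OF f(1)]
  obtain n where "hnorm (completion H) (emb (f n) \<ominus>\<^bsub>completion H\<^esub> X) < e"
    using LIMSEQ_D[OF hlim_emb[OF f(1), unfolded hlim_def] e] f by auto
  then show "\<exists>d\<in>emb ` carrier H. hnorm (completion H) (X \<ominus>\<^bsub>completion H\<^esub> d) < e"
    using f by (auto simp: C.hnorm_minus_commute[of "cclass H f"])
qed auto

text \<open>
  A Cauchy sequence of the completion is approximated termwise by vectors \<open>x n\<close> of the original space.
  These form a Cauchy sequence, and its class is the limit.
\<close>

lemma hilbert_space_completion: "hilbert_space (completion H)"
proof
  let ?C = "completion H"
  fix F assume F: "hCauchy ?C F"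
  note [simp] = C.hCauchyD(1)[OF F]
  have "\<exists>x\<in>carrier H. hnorm ?C (F n \<ominus>\<^bsub>?C\<^esub> emb x) < 1 / real (Suc n)" for n
    using C.dense_inD[OF dense_emb, of "F n" "1 / real (Suc n)"] by auto
  then obtain x where x [simp]: "\<And>n. x n \<in> carrier H"
    and Fx: "\<And>n. hnorm ?C (F n \<ominus>\<^bsub>?C\<^esub> emb (x n)) < 1 / real (Suc n)" by metis
  have emb_minus: "hnorm ?C (emb a \<ominus>\<^bsub>?C\<^esub> emb b) = hnorm H (a \<ominus> b)" if "a \<in> carrier H" "b \<in> carrier H" for a b
    using that linear_op_minus[OF inner_product_space_axioms C.inner_product_space_axioms linear_op_emb that]
    by (metis hnorm_emb M.minus_closed)
  have "hCauchy H x"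
  proof (rule hCauchyI)
    fix e :: real assume e: "e > 0"
    obtain N where N: "\<forall>m\<ge>N. \<forall>n\<ge>N. hnorm ?C (F m \<ominus>\<^bsub>?C\<^esub> F n) < e / 3"
      using C.hCauchyD(2)[OF F, of "e / 3"] e by auto
    obtain M where M: "1 / real (Suc M) < e / 3"
      using nat_approx_posE[of "e / 3"] e by auto
    show "\<exists>N. \<forall>m\<ge>N. \<forall>n\<ge>N. hnorm H (x m \<ominus> x n) \<le> e"
    proof (intro exI[of _ "max N M"] allI impI)
      fix m n assume *: "m \<ge> max N M" "n \<ge> max N M"
      have "1 / real (Suc m) \<le> 1 / real (Suc M)" "1 / real (Suc n) \<le> 1 / real (Suc M)"
        using * by (simp_all add: frac_le)
      moreover have "hnorm ?C (F m \<ominus>\<^bsub>?C\<^esub> F n) < e / 3" using N * by auto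
      ultimately show "hnorm H (x m \<ominus> x n) \<le> e"
        using C.hnorm_minus_triangle[of "emb (x m)" "F m" "emb (x n)"]
          C.hnorm_minus_triangle[of "F m" "F n" "emb (x n)"] Fx[of m] Fx[of n] M
          C.hnorm_minus_commute[of "F m" "emb (x m)"] emb_minus[of "x m" "x n"] by simp
    qed
  qed simp
  then have lim: "hlim ?C (\<lambda>n. emb (x n)) (cclass H x)" and X: "cclass H x \<in> carrier ?C"
    by (simp_all add: hlim_emb)
  have "(\<lambda>n. 1 / real (Suc n) + hnorm ?C (emb (x n) \<ominus>\<^bsub>?C\<^esub> cclass H x)) \<longlonglongrightarrow> 0 + 0"
    using lim unfolding hlim_def by (intro tendsto_add lim_1_over_n[THEN LIMSEQ_Suc])
  then have "hlim ?C F (cclass H x)"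
    unfolding hlim_def
  proof (rule_tac squeeze_zero)
    fix n
    show "hnorm ?C (F n \<ominus>\<^bsub>?C\<^esub> cclass H x) \<le> 1 / real (Suc n) + hnorm ?C (emb (x n) \<ominus>\<^bsub>?C\<^esub> cclass H x)"
      using C.hnorm_minus_triangle[of "F n" "emb (x n)" "cclass H x"] Fx[of n] X by simp
  qed (use X in simp_all)
  with X show "\<exists>X\<in>carrier ?C. hlim ?C F X" by blast
qed

lemma hCauchy_contraction:
  assumes T: "linear_op H H T" "\<And>x. x \<in> carrier H \<Longrightarrow> hnorm H (T x) \<le> hnorm H x"
    and f: "hCauchy H f"
  shows "hCauchy H (\<lambda>n. T (f n))"
proof (rule hCauchyI)
  note [simp] = hCauchyD(1)[OF f] linear_opD(1)[OF T(1)]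
  fix e :: real assume "e > 0"
  then obtain N where N: "\<forall>m\<ge>N. \<forall>n\<ge>N. hnorm H (f m \<ominus> f n) < e"
    using hCauchyD(2)[OF f] by blast
  have le: "hnorm H (T (f m) \<ominus> T (f n)) \<le> hnorm H (f m \<ominus> f n)" for m n
    using T(2)[of "f m \<ominus> f n"]
      linear_op_minus[OF inner_product_space_axioms inner_product_space_axioms T(1), of "f m" "f n"] by simp
  show "\<exists>N. \<forall>m\<ge>N. \<forall>n\<ge>N. hnorm H (T (f m) \<ominus> T (f n)) \<le> e"
    using N le by (meson less_imp_le order_trans)
qed (use f T in \<open>simp add: linear_opD(1)[OF T(1)] hCauchyD\<close>)

lemma extend_op_cclass:
  assumes T: "linear_op H H T" "\<And>x. x \<in> carrier H \<Longrightarrow> hnorm H (T x) \<le> hnorm H x"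
    and f: "hCauchy H f"
  shows "extend_op H T (cclass H f) = cclass H (\<lambda>n. T (f n))"
  unfolding extend_op_def
proof (rule the_equality)
  fix Z assume "\<exists>f'\<in>cclass H f. Z = cclass H (\<lambda>n. T (f' n))"
  then obtain f' where *: "hCauchy H f'" "(\<lambda>n. hnorm H (f n \<ominus> f' n)) \<longlonglongrightarrow> 0"
    and Z: "Z = cclass H (\<lambda>n. T (f' n))"
    using f by (auto simp: in_cclass_iff)
  note [simp] = hCauchyD(1)[OF f] hCauchyD(1)[OF *(1)] linear_opD(1)[OF T(1)]
  have "hnorm H (T (f n) \<ominus> T (f' n)) \<le> hnorm H (f n \<ominus> f' n)" for n
    using T(2)[of "f n \<ominus> f' n"]
      linear_op_minus[OF inner_product_space_axioms inner_product_space_axioms T(1), of "f n" "f' n"] by simp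
  then have "(\<lambda>n. hnorm H (T (f n) \<ominus> T (f' n))) \<longlonglongrightarrow> 0"
    by (intro squeeze_zero[OF *(2)]) simp_all
  then show "Z = cclass H (\<lambda>n. T (f n))"
    unfolding Z using f * hCauchy_contraction[OF T]
    by (subst eq_commute) (simp add: cclass_eq_iff)
qed (use f self_in_cclass in blast)

end

section \<open>Trees labelled by vectors\<close>

lemma shape_simps [simp]:
  "shape (Leaf x) = Leaf ()" "shape (Node l r) = Node (shape l) (shape r)"
  by (simp_all add: shape_def)

lemma same_shape_induct [consumes 1, case_names Leaf Node]:
  assumes "shape s = shape t"
    and "\<And>x y. P (Leaf x) (Leaf y)"
    and "\<And>l r l' r'. \<lbrakk>shape l = shape l'; shape r = shape r'; P l l'; P r r'\<rbrakk> \<Longrightarrow> P (Node l r) (Node l' r')"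
  shows "P s t"
  using assms(1)
proof (induction s arbitrary: t)
  case (Leaf x)
  then show ?case by (cases t) (simp_all add: assms)
next
  case (Node l r)
  then show ?case by (cases t) (simp_all add: assms)
qed

text \<open>
  Attaches carets until no leaf has depth less than \<open>n\<close>. For large \<open>n\<close> the result is the full tree of
  depth \<open>n\<close>, whatever the shape of the given tree. Comparing these full trees replaces a confluence
  argument for the growth relation.
\<close>

fun expand :: "('a \<Rightarrow> 'a) \<Rightarrow> ('a \<Rightarrow> 'a) \<Rightarrow> nat \<Rightarrow> 'a dtree \<Rightarrow> 'a dtree" where
  "expand A B 0 t = t"
| "expand A B (Suc n) (Leaf x) = Node (expand A B n (Leaf (A x))) (expand A B n (Leaf (B x)))"
| "expand A B (Suc n) (Node l r) = Node (expand A B n l) (expand A B n r)"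

lemma grows_Node:
  assumes "grows A B l l'" "grows A B r r'"
  shows "grows A B (Node l r) (Node l' r')"
proof -
  have "grows A B (Node l r) (Node l' r)" using assms(1)
    by (induction rule: rtranclp_induct) (auto intro: caret_left rtranclp.rtrancl_into_rtrancl)
  also have "grows A B (Node l' r) (Node l' r')" using assms(2)
    by (induction rule: rtranclp_induct) (auto intro: caret_right rtranclp.rtrancl_into_rtrancl)
  finally show ?thesis .
qed

lemma grows_expand: "grows A B t (expand A B n t)"
proof (induction n arbitrary: t)
  case (Suc n)
  show ?case
  proof (cases t)
    case (Leaf x)
    have "grows A B t (Node (Leaf (A x)) (Leaf (B x)))" using Leaf by (auto intro: caret_leaf)
    also have "grows A B \<dots> (expand A B (Suc n) t)" using Leaf Suc.IH by (simp add: grows_Node)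
    finally show ?thesis .
  qed (simp add: grows_Node Suc.IH)
qed simp

text \<open>
  Trees which represent the same vector of the direct limit, see \<open>sim_iff\<close>.
\<close>

definition sim :: "('a \<Rightarrow> 'a) \<Rightarrow> ('a \<Rightarrow> 'a) \<Rightarrow> 'a dtree \<Rightarrow> 'a dtree \<Rightarrow> bool" where
  "sim A B s t \<longleftrightarrow> (\<forall>\<^sub>F n in sequentially. expand A B n s = expand A B n t)"

lemma sim_refl [simp]: "sim A B t t"
  by (simp add: sim_def)

lemma sim_sym: "sim A B s t \<Longrightarrow> sim A B t s"
  by (simp add: sim_def eq_commute)

lemma sim_trans: "\<lbrakk>sim A B s t; sim A B t u\<rbrakk> \<Longrightarrow> sim A B s u"
  unfolding sim_def by (auto elim: eventually_elim2)

lemma sim_Node: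
  "sim A B (Node l r) (Node l' r') \<longleftrightarrow> sim A B l l' \<and> sim A B r r'"
  unfolding sim_def by (subst eventually_sequentially_Suc[symmetric]) (simp add: eventually_conj_iff)

lemma caret_imp_sim: "caret A B s t \<Longrightarrow> sim A B s t"
proof (induction rule: caret.induct)
  case (caret_leaf x)
  show ?case unfolding sim_def
    by (subst eventually_sequentially_Suc[symmetric]) simp
qed (simp_all add: sim_Node)

lemma grows_imp_sim: "grows A B s t \<Longrightarrow> sim A B s t"
  by (induction rule: rtranclp_induct) (auto intro: sim_trans caret_imp_sim)

lemma sim_expand: "sim A B t (expand A B n t)"
  by (intro grows_imp_sim grows_expand)

lemma sim_iff: "sim A B s t \<longleftrightarrow> (\<exists>u. grows A B s u \<and> grows A B t u)"
proof
  assume "sim A B s t"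
  then obtain n where "expand A B n s = expand A B n t"
    by (auto simp: sim_def eventually_sequentially)
  then show "\<exists>u. grows A B s u \<and> grows A B t u"
    using grows_expand by metis
qed (blast intro: grows_imp_sim sim_sym sim_trans)

primrec full_tree :: "nat \<Rightarrow> unit dtree" where
  "full_tree 0 = Leaf ()"
| "full_tree (Suc n) = Node (full_tree n) (full_tree n)"

lemma shape_expand: "\<forall>\<^sub>F n in sequentially. shape (expand A B n t) = full_tree n"
proof (induction t)
  case (Leaf x)
  have "shape (expand A B n (Leaf y)) = full_tree n" for n y
    by (induction n arbitrary: y) simp_all
  then show ?case by simp
next
  case (Node l r)
  then show ?case
    by (subst eventually_sequentially_Suc[symmetric]) (simp add: eventually_conj)
qed

text \<open>
  The inner product of two vectors of the direct limit, computed on representatives of arbitrary shapes: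
  when a leaf meets an inner node, a caret is attached to the leaf.
\<close>

function tree_inner :: "'a hspace \<Rightarrow> ('a \<Rightarrow> 'a) \<Rightarrow> ('a \<Rightarrow> 'a) \<Rightarrow> 'a dtree \<Rightarrow> 'a dtree \<Rightarrow> complex" where
  "tree_inner H A B (Leaf x) (Leaf y) = hinner H x y"
| "tree_inner H A B (Leaf x) (Node l r) = tree_inner H A B (Leaf (A x)) l + tree_inner H A B (Leaf (B x)) r"
| "tree_inner H A B (Node l r) (Leaf y) = tree_inner H A B l (Leaf (A y)) + tree_inner H A B r (Leaf (B y))"
| "tree_inner H A B (Node l r) (Node l' r') = tree_inner H A B l l' + tree_inner H A B r r'"
  by pat_completeness auto
termination
  by (relation "measure (\<lambda>(H, A, B, s, t). size (shape s) + size (shape t))") simp_all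

lemma tree_inner_same_shape: "shape s = shape t \<Longrightarrow> tree_inner H A B s t = dtree_inner H s t"
  by (induction rule: same_shape_induct) simp_all

text \<open>
  A P-module in the form of \<open>P_module_iff\<close>.
\<close>

locale P_mod = hilbert_space H for H :: "'a hspace" (structure) +
  fixes A B :: "'a \<Rightarrow> 'a"
  assumes linear_A: "linear_op H H A" and linear_B: "linear_op H H B"
    and hinner_AB: "\<lbrakk>x \<in> carrier H; y \<in> carrier H\<rbrakk> \<Longrightarrow>
      hinner H (A x) (A y) + hinner H (B x) (B y) = hinner H x y"
begin

lemmas A = linear_opD[OF linear_A] linear_op_zero[OF inner_product_space_axioms inner_product_space_axioms linear_A]
lemmas B = linear_opD[OF linear_B] linear_op_zero[OF inner_product_space_axioms inner_product_space_axioms linear_B]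

abbreviation adm :: "'a dtree \<Rightarrow> bool" where "adm t \<equiv> labels t \<subseteq> carrier H"

lemma adm_expand [simp]: "adm t \<Longrightarrow> adm (expand A B n t)"
  by (induction n arbitrary: t; case_tac t) (simp_all add: A B)

lemma adm_add [simp]: "\<lbrakk>shape s = shape t; adm s; adm t\<rbrakk> \<Longrightarrow> adm (dtree_add H s t)"
  by (induction rule: same_shape_induct) auto

lemma adm_smult [simp]: "adm t \<Longrightarrow> adm (map_dtree ((\<odot>) c) t)"
  by (auto simp: dtree.set_map)

lemma shape_add [simp]: "shape s = shape t \<Longrightarrow> shape (dtree_add H s t) = shape t"
  by (induction rule: same_shape_induct) auto

lemma expand_add:
  "\<lbrakk>shape s = shape t; adm s; adm t\<rbrakk> \<Longrightarrow>
    expand A B n (dtree_add H s t) = dtree_add H (expand A B n s) (expand A B n t)"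
proof (induction n arbitrary: s t)
  case (Suc n)
  show ?case
  proof (cases s)
    case (Leaf x)
    with Suc.prems obtain y where t: "t = Leaf y" by (cases t) auto
    then show ?thesis using Suc.prems Leaf Suc.IH[of "Leaf (A x)" "Leaf (A y)"] Suc.IH[of "Leaf (B x)" "Leaf (B y)"]
      by (simp add: A B)
  next
    case (Node l r)
    with Suc.prems obtain l' r' where t: "t = Node l' r'" by (cases t) auto
    then show ?thesis using Suc.prems Node Suc.IH[of l l'] Suc.IH[of r r'] by simp
  qed
qed simp

lemma expand_smult: "adm t \<Longrightarrow> expand A B n (map_dtree ((\<odot>) c) t) = map_dtree ((\<odot>) c) (expand A B n t)"
proof (induction n arbitrary: t)
  case (Suc n)
  show ?case
  proof (cases t)
    case (Leaf x)
    then show ?thesis using Suc.prems Suc.IH[of "Leaf (A x)"] Suc.IH[of "Leaf (B x)"] by (simp add: A B)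
  next
    case (Node l r)
    then show ?thesis using Suc.prems Suc.IH[of l] Suc.IH[of r] by simp
  qed
qed simp

abbreviation G :: "'a dtree \<Rightarrow> 'a dtree \<Rightarrow> complex" where "G \<equiv> tree_inner H A B"

text \<open>
  Induction along the recursion of \<^const>\<open>tree_inner\<close>, for admissible trees and fixed \<open>A\<close> and \<open>B\<close>.
\<close>

lemma tree_pair_induct [consumes 2, case_names Leaf_Leaf Leaf_Node Node_Leaf Node_Node]:
  assumes st: "adm s" "adm t"
    and step: "\<And>x y. \<lbrakk>x \<in> carrier H; y \<in> carrier H\<rbrakk> \<Longrightarrow> P (Leaf x) (Leaf y)"
      "\<And>x l r. \<lbrakk>x \<in> carrier H; adm l; adm r; P (Leaf (A x)) l; P (Leaf (B x)) r\<rbrakk> \<Longrightarrow> P (Leaf x) (Node l r)"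
      "\<And>l r y. \<lbrakk>adm l; adm r; y \<in> carrier H; P l (Leaf (A y)); P r (Leaf (B y))\<rbrakk> \<Longrightarrow> P (Node l r) (Leaf y)"
      "\<And>l r l' r'. \<lbrakk>adm l; adm r; adm l'; adm r'; P l l'; P r r'\<rbrakk> \<Longrightarrow> P (Node l r) (Node l' r')"
  shows "P s t"
proof -
  have "H' = H \<longrightarrow> A' = A \<longrightarrow> B' = B \<longrightarrow> adm s \<longrightarrow> adm t \<longrightarrow> P s t" for H' A' B'
    by (induction H' A' B' s t rule: tree_inner.induct) (auto intro!: step simp: A B)
  then show ?thesis using st by simp
qed

lemma tree_inner_commute: "\<lbrakk>adm s; adm t\<rbrakk> \<Longrightarrow> G t s = cnj (G s t)"
  by (induction s t rule: tree_pair_induct) (simp_all add: hinner_commute[symmetric])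

text \<open>
  Attaching carets does not change inner products, because \<open>\<langle>A x, A y\<rangle> + \<langle>B x, B y\<rangle> = \<langle>x, y\<rangle>\<close>. Hence
  \<^const>\<open>tree_inner\<close> is well defined on the direct limit.
\<close>

lemma tree_inner_expand_left: "\<lbrakk>adm s; adm t\<rbrakk> \<Longrightarrow> G (expand A B n s) t = G s t"
proof (induction n arbitrary: s t)
  case (Suc n)
  then show ?case by (cases s; cases t) (simp_all add: A B hinner_AB)
qed simp

lemma sim_tree_inner:
  assumes "sim A B s s'" "sim A B t t'" "adm s" "adm s'" "adm t" "adm t'"
  shows "G s t = G s' t'"
proof -
  obtain n where n: "expand A B n s = expand A B n s'"
    using assms(1) by (auto simp: sim_def eventually_sequentially)
  obtain m where m: "expand A B m t = expand A B m t'"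
    using assms(2) by (auto simp: sim_def eventually_sequentially)
  have "G s t = G s' t" using assms n by (metis tree_inner_expand_left)
  also have "\<dots> = cnj (G t s')" using assms tree_inner_commute by blast
  also have "G t s' = G t' s'" using assms m by (metis tree_inner_expand_left)
  also have "cnj \<dots> = G s' t'" using assms tree_inner_commute[of t' s'] by simp
  finally show ?thesis .
qed

lemma tree_inner_add:
  "\<lbrakk>shape s = shape t; adm s; adm t; adm u\<rbrakk> \<Longrightarrow> G (dtree_add H s t) u = G s u + G t u"
proof (induction u arbitrary: s t)
  case (Leaf z)
  then show ?case
  proof (induction arbitrary: z rule: same_shape_induct)
    case (Node l r l' r')
    then show ?case by (simp add: A B)
  qed (simp add: hinner_left)
next
  case (Node u1 u2)
  show ?case
  proof (cases s)
    case (Leaf x)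
    with Node.prems obtain y where t: "t = Leaf y" by (cases t) auto
    then show ?thesis
      using Node.prems Leaf Node.IH(1)[of "Leaf (A x)" "Leaf (A y)"] Node.IH(2)[of "Leaf (B x)" "Leaf (B y)"]
      by (simp add: A B)
  next
    case (Node l r)
    with Node.prems obtain l' r' where t: "t = Node l' r'" by (cases t) auto
    then show ?thesis using Node.prems Node Node.IH(1)[of l l'] Node.IH(2)[of r r'] by simp
  qed
qed

lemma tree_inner_smult: "\<lbrakk>adm s; adm t\<rbrakk> \<Longrightarrow> G (map_dtree ((\<odot>) c) s) t = c * G s t"
  by (induction s t rule: tree_pair_induct) (simp_all add: A B hinner_left algebra_simps)

lemma tree_inner_zero: "adm t \<Longrightarrow> G (Leaf \<zero>) t = 0"
  by (induction t) (simp_all add: A B hinner_left)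

lemma tree_inner_nonneg: "adm t \<Longrightarrow> 0 \<le> Re (G t t)"
  by (induction t) (simp_all add: hinner_nonneg)

text \<open>
  The labels can be recovered one after the other by testing against trees with a single nonzero label.
\<close>

lemma tree_inner_separating:
  assumes "shape s = shape t" "adm s" "adm t" "\<And>u. adm u \<Longrightarrow> G s u = G t u"
  shows "s = t"
  using assms
proof (induction rule: same_shape_induct)
  case (Leaf x y)
  have "x = y"
  proof (rule hinner_eqI)
    fix z assume "z \<in> carrier H"
    then show "hinner H x z = hinner H y z" using Leaf(3)[of "Leaf z"] by simp
  qed (use Leaf in simp_all)
  then show ?case by simp
next
  case (Node l r l' r')
  have 0: "G u (Leaf \<zero>) = 0" if "adm u" for u
    using tree_inner_commute[of "Leaf \<zero>" u] tree_inner_zero[of u] that by simp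
  have "l = l'"
  proof (rule Node.IH)
    fix u assume "adm u" then show "G l u = G l' u"
      using Node.prems(3)[of "Node u (Leaf \<zero>)"] Node.prems 0 by simp
  qed (use Node.prems in simp_all)
  moreover have "r = r'"
  proof (rule Node.IH)
    fix u assume "adm u" then show "G r u = G r' u"
      using Node.prems(3)[of "Node (Leaf \<zero>) u"] Node.prems 0 by simp
  qed (use Node.prems in simp_all)
  ultimately show ?case by simp
qed

section \<open>The direct limit over trees\<close>

abbreviation D :: "'a dtree set hspace" where "D \<equiv> dlimit H A B"
abbreviation cls :: "'a dtree \<Rightarrow> 'a dtree set" where "cls \<equiv> dl_class H A B"

lemma dl_rel_iff: "(s, t) \<in> dl_rel H A B \<longleftrightarrow> adm s \<and> adm t \<and> sim A B s t"
  by (simp add: dl_rel_def sim_iff)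

lemma in_cls_iff: "t \<in> cls s \<longleftrightarrow> adm s \<and> adm t \<and> sim A B s t"
  by (simp add: dl_class_def dl_rel_iff)

lemma cls_eq_iff: "\<lbrakk>adm s; adm t\<rbrakk> \<Longrightarrow> cls s = cls t \<longleftrightarrow> sim A B s t"
  by (auto simp: set_eq_iff in_cls_iff intro: sim_trans sim_sym)

lemma carrier_D_iff: "X \<in> carrier D \<longleftrightarrow> (\<exists>t. adm t \<and> X = cls t)"
  by (auto simp: dlimit_def quotient_def dl_class_def)

lemma cls_closed [simp]: "adm t \<Longrightarrow> cls t \<in> carrier D"
  by (auto simp: carrier_D_iff)

lemma cls_expand [simp]: "adm t \<Longrightarrow> cls (expand A B n t) = cls t"
  by (simp add: cls_eq_iff sim_sym sim_expand)

text \<open>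
  Expanding both representatives far enough makes their shapes equal. Asking for inner nodes at the
  root gives access to the subtrees.
\<close>

lemma same_shape_reps:
  assumes "X \<in> carrier D" "Y \<in> carrier D"
  obtains s t where "adm s" "adm t" "shape s = shape t" "X = cls s" "Y = cls t" "\<exists>l r. s = Node l r"
proof -
  obtain s0 t0 where s0: "adm s0" "X = cls s0" and t0: "adm t0" "Y = cls t0"
    using assms by (auto simp: carrier_D_iff)
  have "\<forall>\<^sub>F n in sequentially. n > 0 \<and> shape (expand A B n s0) = full_tree n \<and> shape (expand A B n t0) = full_tree n"
    by (intro eventually_conj shape_expand eventually_gt_at_top)
  then obtain n where n: "n > 0" "shape (expand A B n s0) = full_tree n" "shape (expand A B n t0) = full_tree n"
    by (auto simp: eventually_sequentially)
  moreover have "\<exists>l r. expand A B n s0 = Node l r"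
    using n(1,2) by (cases n; cases "expand A B n s0") auto
  ultimately show ?thesis
    using that[of "expand A B n s0" "expand A B n t0"] s0 t0 by simp
qed

lemma Node_rep:
  assumes "X \<in> carrier D"
  obtains l r where "adm l" "adm r" "X = cls (Node l r)"
  using same_shape_reps[OF assms assms] by (metis Un_subset_iff dtree.set(2))

lemma hinner_cls: "\<lbrakk>adm s; adm t\<rbrakk> \<Longrightarrow> hinner D (cls s) (cls t) = G s t"
proof -
  assume st: "adm s" "adm t"
  have "(THE z. \<exists>s'\<in>cls s. \<exists>t'\<in>cls t. shape s' = shape t' \<and> z = dtree_inner H s' t') = G s t"
  proof (rule the_equality)
    obtain s' t' where "adm s'" "adm t'" "shape s' = shape t'" "cls s = cls s'" "cls t = cls t'"
      by (rule same_shape_reps[of "cls s" "cls t"]) (use st in auto)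
    moreover from this have "G s t = G s' t'"
      using st by (intro sim_tree_inner) (simp_all add: cls_eq_iff)
    moreover have "G s' t' = dtree_inner H s' t'"
      by (rule tree_inner_same_shape) fact
    ultimately have "s' \<in> cls s" "t' \<in> cls t" "shape s' = shape t'" "G s t = dtree_inner H s' t'"
      by (simp_all add: in_cls_iff)
    then show "\<exists>s'\<in>cls s. \<exists>t'\<in>cls t. shape s' = shape t' \<and> G s t = dtree_inner H s' t'" by blast
  next
    fix z assume "\<exists>s'\<in>cls s. \<exists>t'\<in>cls t. shape s' = shape t' \<and> z = dtree_inner H s' t'"
    then obtain s' t' where *: "sim A B s s'" "adm s'" "sim A B t t'" "adm t'" "shape s' = shape t'"
      and z: "z = dtree_inner H s' t'" by (auto simp: in_cls_iff)
    show "z = G s t"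
      unfolding z tree_inner_same_shape[OF *(5), of H A B, symmetric]
      using sim_sym[OF *(1)] sim_sym[OF *(3)] * st by (intro sim_tree_inner)
  qed
  then show ?thesis by (simp add: dlimit_def)
qed

lemma sim_add:
  assumes "sim A B s s'" "sim A B t t'" "shape s = shape t" "shape s' = shape t'" "adm s" "adm s'" "adm t" "adm t'"
  shows "sim A B (dtree_add H s t) (dtree_add H s' t')"
  using assms(1,2) unfolding sim_def by (rule eventually_elim2) (use assms in \<open>simp add: expand_add\<close>)

lemma sim_smult:
  assumes "sim A B s t" "adm s" "adm t"
  shows "sim A B (map_dtree ((\<odot>) c) s) (map_dtree ((\<odot>) c) t)"
  using assms(1) unfolding sim_def by (rule eventually_mono) (use assms in \<open>simp add: expand_smult\<close>)

lemma add_cls: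
  assumes "adm s" "adm t" "shape s = shape t"
  shows "cls s \<oplus>\<^bsub>D\<^esub> cls t = cls (dtree_add H s t)"
proof -
  have "(THE Z. \<exists>s'\<in>cls s. \<exists>t'\<in>cls t. shape s' = shape t' \<and> Z = cls (dtree_add H s' t')) = cls (dtree_add H s t)"
  proof (rule the_equality)
    show "\<exists>s'\<in>cls s. \<exists>t'\<in>cls t. shape s' = shape t' \<and> cls (dtree_add H s t) = cls (dtree_add H s' t')"
      using assms in_cls_iff sim_refl by blast
  next
    fix Z assume "\<exists>s'\<in>cls s. \<exists>t'\<in>cls t. shape s' = shape t' \<and> Z = cls (dtree_add H s' t')"
    then obtain s' t' where *: "sim A B s s'" "adm s'" "sim A B t t'" "adm t'" "shape s' = shape t'"
      and Z: "Z = cls (dtree_add H s' t')" by (auto simp: in_cls_iff)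
    have "sim A B (dtree_add H s' t') (dtree_add H s t)"
      using sim_sym[OF *(1)] sim_sym[OF *(3)] * assms by (intro sim_add)
    then show "Z = cls (dtree_add H s t)" using * assms by (simp add: Z cls_eq_iff)
  qed
  then show ?thesis by (simp add: dlimit_def)
qed

lemma smult_cls:
  assumes "adm t"
  shows "c \<odot>\<^bsub>D\<^esub> cls t = cls (map_dtree ((\<odot>) c) t)"
proof -
  have "(THE Z. \<exists>t'\<in>cls t. Z = cls (map_dtree ((\<odot>) c) t')) = cls (map_dtree ((\<odot>) c) t)"
  proof (rule the_equality)
    show "\<exists>t'\<in>cls t. cls (map_dtree ((\<odot>) c) t) = cls (map_dtree ((\<odot>) c) t')"
      using assms in_cls_iff sim_refl by blast
  next
    fix Z assume "\<exists>t'\<in>cls t. Z = cls (map_dtree ((\<odot>) c) t')"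
    then obtain t' where *: "sim A B t t'" "adm t'" and Z: "Z = cls (map_dtree ((\<odot>) c) t')"
      by (auto simp: in_cls_iff)
    have "sim A B (map_dtree ((\<odot>) c) t') (map_dtree ((\<odot>) c) t)"
      using sim_sym[OF *(1)] * assms by (intro sim_smult)
    then show "Z = cls (map_dtree ((\<odot>) c) t)" using * assms by (simp add: Z cls_eq_iff)
  qed
  then show ?thesis by (simp add: dlimit_def)
qed

lemma inner_product_space_D: "inner_product_space D"
proof (rule inner_product_spaceI)
  have zero: "\<zero>\<^bsub>D\<^esub> = cls (Leaf \<zero>)" by (simp add: dlimit_def)
  show "\<zero>\<^bsub>D\<^esub> \<in> carrier D" by (simp add: zero)
  fix X Y Z and c :: complex
  {
    assume X: "X \<in> carrier D" then obtain s where s: "adm s" "X = cls s"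
      by (auto simp: carrier_D_iff)
    show "c \<odot>\<^bsub>D\<^esub> X \<in> carrier D"
      using s by (simp add: smult_cls)
    show "hinner D \<zero>\<^bsub>D\<^esub> X = 0"
      using s by (simp add: zero hinner_cls tree_inner_zero)
    show "0 \<le> Re (hinner D X X)"
      using s by (simp add: hinner_cls tree_inner_nonneg)
    assume Y: "Y \<in> carrier D"
    obtain s t where st: "adm s" "adm t" "shape s = shape t" "X = cls s" "Y = cls t" "\<exists>l r. s = Node l r"
      using same_shape_reps[OF X Y] .
    note s = st(1,4) and t = st(2,5) and st = st(3)
    show "X \<oplus>\<^bsub>D\<^esub> Y \<in> carrier D"
      using s t st by (simp add: add_cls)
    show "hinner D (c \<odot>\<^bsub>D\<^esub> X) Y = c * hinner D X Y"
      using s t by (simp add: smult_cls hinner_cls tree_inner_smult)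
    show "hinner D Y X = cnj (hinner D X Y)"
      using s t tree_inner_commute[OF s(1) t(1)] by (simp add: hinner_cls)
    {
      assume *: "\<And>Z. Z \<in> carrier D \<Longrightarrow> hinner D X Z = hinner D Y Z"
      have "s = t"
      proof (rule tree_inner_separating[OF st])
        fix u assume "adm u" then show "G s u = G t u"
          using *[of "cls u"] s t by (simp add: hinner_cls)
      qed (use s t in auto)
      then show "X = Y" using s t by simp
    }
    assume "Z \<in> carrier D" then obtain u where u: "adm u" "Z = cls u"
      by (auto simp: carrier_D_iff)
    then show "hinner D (X \<oplus>\<^bsub>D\<^esub> Y) Z = hinner D X Z + hinner D Y Z"
      using s t st by (simp add: add_cls hinner_cls tree_inner_add)
  }
qed

lemma subtree_op_cls:
  assumes "adm l" "adm r"
  shows "subtree_op H A B i (cls (Node l r)) = cls (if i then r else l)"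
  unfolding subtree_op_def
proof (rule the_equality)
  show "\<exists>l' r'. Node l' r' \<in> cls (Node l r) \<and> cls (if i then r else l) = cls (if i then r' else l')"
    using assms in_cls_iff[of "Node l r" "Node l r"] by auto
next
  fix Z assume "\<exists>l' r'. Node l' r' \<in> cls (Node l r) \<and> Z = cls (if i then r' else l')"
  then obtain l' r' where "adm l'" "adm r'" "sim A B l l'" "sim A B r r'"
    and Z: "Z = cls (if i then r' else l')"
    by (auto simp: in_cls_iff sim_Node)
  then have "cls l' = cls l" "cls r' = cls r" using assms by (simp_all add: cls_eq_iff sim_sym)
  then show "Z = cls (if i then r else l)" by (simp add: Z)
qed

lemma subtree_op_cls_Leaf:
  assumes "x \<in> carrier H"
  shows "subtree_op H A B i (cls (Leaf x)) = cls (Leaf (if i then B x else A x))"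
proof -
  have "cls (Leaf x) = cls (Node (Leaf (A x)) (Leaf (B x)))"
    using cls_expand[of "Leaf x" 1] assms by simp
  then show ?thesis using assms by (simp add: subtree_op_cls A B)
qed

lemma linear_subtree_op: "linear_op D D (subtree_op H A B i)"
  unfolding linear_op_def
proof (intro conjI ballI allI)
  fix X Y c assume X: "X \<in> carrier D"
  obtain l r where lr: "adm l" "adm r" "X = cls (Node l r)" using Node_rep[OF X] .
  then show "subtree_op H A B i X \<in> carrier D" by (simp add: subtree_op_cls)
  show "subtree_op H A B i (c \<odot>\<^bsub>D\<^esub> X) = c \<odot>\<^bsub>D\<^esub> subtree_op H A B i X"
    using lr by (simp add: smult_cls subtree_op_cls)
  assume Y: "Y \<in> carrier D"
  obtain s t where st: "adm s" "adm t" "shape s = shape t" "X = cls s" "Y = cls t" "\<exists>l r. s = Node l r"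
    using same_shape_reps[OF X Y] .
  moreover from this obtain l r l' r' where "s = Node l r" "t = Node l' r'" by (cases t) auto
  ultimately show "subtree_op H A B i (X \<oplus>\<^bsub>D\<^esub> Y) = subtree_op H A B i X \<oplus>\<^bsub>D\<^esub> subtree_op H A B i Y"
    by (simp add: add_cls subtree_op_cls)
qed

lemma hinner_subtree_op:
  assumes X: "X \<in> carrier D" and Y: "Y \<in> carrier D"
  shows "hinner D X Y = hinner D (subtree_op H A B False X) (subtree_op H A B False Y)
    + hinner D (subtree_op H A B True X) (subtree_op H A B True Y)"
proof -
  obtain l r where lr: "adm l" "adm r" "X = cls (Node l r)" using Node_rep[OF X] .
  obtain l' r' where lr': "adm l'" "adm r'" "Y = cls (Node l' r')" using Node_rep[OF Y] .
  show ?thesis using lr lr' by (simp add: subtree_op_cls hinner_cls)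
qed

end

section \<open>Cuntz systems\<close>

lemma trees_labels_image: "{t. labels t \<subseteq> f ` C} = map_dtree f ` {s. labels s \<subseteq> C}"
proof (intro equalityI subsetI)
  fix t assume "t \<in> {t. labels t \<subseteq> f ` C}"
  then have "labels t \<subseteq> f ` C" by simp
  then have "\<exists>s. labels s \<subseteq> C \<and> t = map_dtree f s"
  proof (induction t)
    case (Leaf y)
    then obtain x where "x \<in> C" "y = f x" by auto
    then show ?case by (intro exI[of _ "Leaf x"]) simp
  next
    case (Node l r)
    then obtain l' r' where "labels l' \<subseteq> C" "l = map_dtree f l'" "labels r' \<subseteq> C" "r = map_dtree f r'" by auto
    then show ?case by (intro exI[of _ "Node l' r'"]) simp
  qed
  then show "t \<in> map_dtree f ` {s. labels s \<subseteq> C}" by auto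
qed (fastforce simp: dtree.set_map)

text \<open>
  A representation of the Cuntz algebra by the isometries \<open>S i\<close>, with the adjoints \<open>T i\<close> as part of the
  data. For a Pythagorean representation \<open>T i\<close> is the operator \<open>\<tau>\<^sub>i\<close>.
\<close>

locale cuntz_system = hilbert_space H for H :: "'a hspace" (structure) +
  fixes S T :: "bool \<Rightarrow> 'a \<Rightarrow> 'a"
  assumes S_linear: "linear_op H H (S i)" and T_linear: "linear_op H H (T i)"
    and hinner_S_left: "\<lbrakk>x \<in> carrier H; y \<in> carrier H\<rbrakk> \<Longrightarrow> hinner H (S i x) y = hinner H x (T i y)"
    and T_S: "x \<in> carrier H \<Longrightarrow> T i (S j x) = (if i = j then x else \<zero>)"
    and S_T: "x \<in> carrier H \<Longrightarrow> S False (T False x) \<oplus> S True (T True x) = x"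
begin

lemmas S = linear_opD[OF S_linear] linear_op_zero[OF inner_product_space_axioms inner_product_space_axioms S_linear]
  linear_op_minus[OF inner_product_space_axioms inner_product_space_axioms S_linear]
lemmas T = linear_opD[OF T_linear] linear_op_zero[OF inner_product_space_axioms inner_product_space_axioms T_linear]
  linear_op_minus[OF inner_product_space_axioms inner_product_space_axioms T_linear]

lemma S_closed [simp]: "x \<in> carrier H \<Longrightarrow> S i x \<in> carrier H" by (rule S)
lemma T_closed [simp]: "x \<in> carrier H \<Longrightarrow> T i x \<in> carrier H" by (rule T)

lemma hinner_S_right: "\<lbrakk>x \<in> carrier H; y \<in> carrier H\<rbrakk> \<Longrightarrow> hinner H y (S i x) = hinner H (T i y) x"
  using hinner_S_left[of x y i] hinner_commute[of "S i x" y] hinner_commute[of x "T i y"] by simp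

lemma parseval:
  assumes "x \<in> carrier H" "y \<in> carrier H"
  shows "hinner H x y = hinner H (T False x) (T False y) + hinner H (T True x) (T True y)"
proof -
  have "hinner H x y = hinner H (S False (T False x) \<oplus> S True (T True x)) y"
    using assms by (simp add: S_T)
  then show ?thesis using assms by (simp add: hinner_left hinner_S_left del: S_T)
qed

lemma hnorm_T: "x \<in> carrier H \<Longrightarrow> (hnorm H x)\<^sup>2 = (hnorm H (T False x))\<^sup>2 + (hnorm H (T True x))\<^sup>2"
  by (simp add: hnorm_power2 parseval[of x x])

lemma hnorm_T_le: "x \<in> carrier H \<Longrightarrow> hnorm H (T i x) \<le> hnorm H x"
proof -
  assume x: "x \<in> carrier H"
  have "(hnorm H (T i x))\<^sup>2 \<le> (hnorm H x)\<^sup>2"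
    using hnorm_T[OF x] by (cases i) simp_all
  then show ?thesis using x by (simp add: abs_le_square_iff[symmetric])
qed

lemma eq_if_T_eq:
  assumes "x \<in> carrier H" "y \<in> carrier H" "\<And>i. T i x = T i y"
  shows "x = y"
proof -
  have "x = S False (T False x) \<oplus> S True (T True x)" using S_T[OF assms(1)] by (rule sym)
  also have "\<dots> = S False (T False y) \<oplus> S True (T True y)" by (simp only: assms(3))
  also have "\<dots> = y" by (rule S_T) fact
  finally show ?thesis .
qed

lemma fold_T_closed [simp]: "x \<in> carrier H \<Longrightarrow> fold T u x \<in> carrier H"
  by (induction u arbitrary: x) simp_all

lemma hnorm_fold_T_le: "x \<in> carrier H \<Longrightarrow> hnorm H (fold T u x) \<le> hnorm H x"
proof (induction u arbitrary: x)
  case (Cons i u)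
  then show ?case using order_trans[OF Cons.IH[OF T_closed] hnorm_T_le[of x i]] by simp
qed simp

lemma word_op_Nil [simp]: "word_op Z [] = id" and word_op_Cons [simp]: "word_op Z (i # u) = Z i \<circ> word_op Z u"
  by (simp_all add: word_op_def)

lemma word_op_closed [simp]: "x \<in> carrier H \<Longrightarrow> word_op S u x \<in> carrier H"
  by (induction u) simp_all

lemma adjoint_word_op: "x \<in> carrier H \<Longrightarrow> adjoint H (word_op S u) x = fold T u x"
proof (rule adjoint_eqI)
  fix z assume "z \<in> carrier H" "x \<in> carrier H"
  then show "hinner H (word_op S u z) x = hinner H z (fold T u x)"
    by (induction u arbitrary: x) (simp_all add: hinner_S_left)
qed simp

text \<open>
  The sum of the vectors \<open>S\<^sub>u x\<^sub>u\<close> over the leaves \<open>u\<close> of a tree with labels \<open>x\<^sub>u\<close>.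
\<close>

primrec ev :: "'a dtree \<Rightarrow> 'a" where
  "ev (Leaf x) = x"
| "ev (Node l r) = S False (ev l) \<oplus> S True (ev r)"

lemma ev_closed [simp]: "labels t \<subseteq> carrier H \<Longrightarrow> ev t \<in> carrier H"
  by (induction t) simp_all

lemma T_ev_Node:
  "\<lbrakk>labels l \<subseteq> carrier H; labels r \<subseteq> carrier H\<rbrakk> \<Longrightarrow> T i (ev (Node l r)) = ev (if i then r else l)"
  by (simp add: T T_S)

definition generating :: "'a set \<Rightarrow> bool" where
  "generating W \<longleftrightarrow> W \<subseteq> carrier H \<and> dense_in H (ev ` {t. labels t \<subseteq> W})"

definition T_invariant :: "'a set \<Rightarrow> bool" where
  "T_invariant W \<longleftrightarrow> (\<forall>i. \<forall>x\<in>W. T i x \<in> W)"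

lemma T_invariantD: "\<lbrakk>T_invariant W; x \<in> W\<rbrakk> \<Longrightarrow> T i x \<in> W"
  by (simp add: T_invariant_def)

lemma generatingI:
  assumes W: "W \<subseteq> carrier H"
    and approx: "\<And>x e. \<lbrakk>x \<in> carrier H; e > 0\<rbrakk> \<Longrightarrow> \<exists>t. labels t \<subseteq> W \<and> hnorm H (x \<ominus> ev t) < e"
  shows "generating W"
  unfolding generating_def dense_in_def
proof (intro conjI ballI allI impI)
  show "ev ` {t. labels t \<subseteq> W} \<subseteq> carrier H" using W by (auto intro!: ev_closed)
  fix x and e :: real assume "x \<in> carrier H" "e > 0"
  then show "\<exists>d\<in>ev ` {t. labels t \<subseteq> W}. hnorm H (x \<ominus> d) < e" using approx by blast
qed fact

lemma generatingD:
  assumes "generating W" "x \<in> carrier H" "e > 0"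
  obtains t where "labels t \<subseteq> W" "hnorm H (x \<ominus> ev t) < e"
proof -
  have "dense_in H (ev ` {t. labels t \<subseteq> W})" using assms(1) by (simp add: generating_def)
  then obtain d where "d \<in> ev ` {t. labels t \<subseteq> W}" "hnorm H (x \<ominus> d) < e"
    using assms(2,3) unfolding dense_in_def by blast
  then show ?thesis using that by blast
qed

end

text \<open>
  By the surjectivity assumption the vector \<open>x\<close> with \<open>T i x = y\<close> and vanishing other component exists,
  and the Parseval identity says that this vector is the value of the adjoint of \<open>T i\<close> at \<open>y\<close>.
\<close>

lemma cuntz_systemI:
  fixes H :: "'a hspace" (structure)
  assumes H: "hilbert_space H"
    and T: "\<And>i. linear_op H H (T i)"
    and parseval: "\<And>x y. \<lbrakk>x \<in> carrier H; y \<in> carrier H\<rbrakk> \<Longrightarrow>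
      hinner H x y = hinner H (T False x) (T False y) + hinner H (T True x) (T True y)"
    and surj: "\<And>i y. y \<in> carrier H \<Longrightarrow> \<exists>x\<in>carrier H. T i x = y \<and> T (\<not> i) x = \<zero>"
    and S: "\<And>i y. y \<in> carrier H \<Longrightarrow> S i y = adjoint H (T i) y"
  shows "cuntz_system H S T"
proof -
  interpret hilbert_space H by fact
  have T_closed [simp]: "T i x \<in> carrier H" if "x \<in> carrier H" for i x
    using linear_opD(1)[OF T that] .
  have *: "S i y \<in> carrier H \<and> T i (S i y) = y \<and> T (\<not> i) (S i y) = \<zero> \<and>
    (\<forall>z\<in>carrier H. hinner H (T i z) y = hinner H z (S i y))" if y: "y \<in> carrier H" for i y
  proof -
    obtain x where x: "x \<in> carrier H" "T i x = y" "T (\<not> i) x = \<zero>" using surj y by blast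
    have inner: "hinner H (T i z) y = hinner H z x" if "z \<in> carrier H" for z
      using x that parseval[of z x] by (cases i) (simp_all add: hinner_right)
    then have "S i y = x" using x y by (simp add: S adjoint_eqI)
    then show ?thesis using x inner by simp
  qed
  note S_closed [simp] = *[THEN conjunct1]
  have adj: "hinner H z (S i y) = hinner H (T i z) y" if "y \<in> carrier H" "z \<in> carrier H" for i y z
    using * that by simp
  have adj': "hinner H (S i y) z = hinner H y (T i z)" if "y \<in> carrier H" "z \<in> carrier H" for i y z
    using adj[OF that] hinner_commute[of z "S i y"] hinner_commute[of "T i z" y] that by simp
  show ?thesis
  proof
    fix i show "linear_op H H (T i)" by (rule T)
    show "linear_op H H (S i)"
      unfolding linear_op_def
      by (auto intro!: hinner_eqI simp: adj' hinner_left)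
  next
    fix x assume x: "x \<in> carrier H"
    show "T i (S j x) = (if i = j then x else \<zero>)" for i j
      using *[OF x, of j] by (cases i; cases j) auto
    show "S False (T False x) \<oplus> S True (T True x) = x"
      using x by (intro hinner_eqI) (simp_all add: hinner_left adj' parseval[symmetric])
  qed (fact adj')
qed

context cuntz_system
begin

lemma eq_ev_if_T_eq:
  assumes "x \<in> carrier H" "labels l \<subseteq> carrier H" "labels r \<subseteq> carrier H"
    "T False x = ev l" "T True x = ev r"
  shows "x = ev (Node l r)"
proof (rule eq_if_T_eq)
  show "T i x = T i (ev (Node l r))" for i
    using assms by (cases i) (simp_all only: T_ev_Node if_True if_False)
qed (use assms in simp_all)

end

section \<open>Intertwining unitaries\<close>

locale cuntz_pair = H: cuntz_system H S T + K: cuntz_system K S' T'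
  for H :: "'a hspace" and S T and K :: "'b hspace" and S' T' +
  fixes U :: "'a \<Rightarrow> 'b"
  assumes U: "unitary_op H K U"
begin

lemmas U_lin = linear_opD[OF unitary_opD(1)[OF U]]
lemma U_closed [simp]: "x \<in> carrier H \<Longrightarrow> U x \<in> carrier K" by (rule unitary_opD(3)[OF U])
lemma U_inner: "\<lbrakk>x \<in> carrier H; y \<in> carrier H\<rbrakk> \<Longrightarrow> hinner K (U x) (U y) = hinner H x y"
  by (rule unitary_opD(4)[OF U])

lemma U_eqI:
  assumes "x \<in> carrier K" "y \<in> carrier K"
    and "\<And>z. z \<in> carrier H \<Longrightarrow> hinner K x (U z) = hinner K y (U z)"
  shows "x = y"
  by (rule K.hinner_eqI) (use assms unitary_op_surj[OF U] in metis)+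

lemma intertwines_S_iff_T:
  "(\<forall>i. \<forall>x\<in>carrier H. U (S i x) = S' i (U x)) \<longleftrightarrow> (\<forall>i. \<forall>x\<in>carrier H. U (T i x) = T' i (U x))"
proof (intro iffI allI ballI)
  fix i x assume *: "\<forall>i. \<forall>x\<in>carrier H. U (S i x) = S' i (U x)" and x: "x \<in> carrier H"
  show "U (T i x) = T' i (U x)"
  proof (rule U_eqI)
    fix z assume z: "z \<in> carrier H"
    have "hinner K (U (T i x)) (U z) = hinner H x (S i z)"
      using x z by (simp add: U_inner H.hinner_S_right)
    also have "\<dots> = hinner K (U x) (S' i (U z))"
      using x z * U_inner[of x "S i z"] by simp
    finally show "hinner K (U (T i x)) (U z) = hinner K (T' i (U x)) (U z)"
      using x z by (simp add: K.hinner_S_right)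
  qed (use x in simp_all)
next
  fix i x assume *: "\<forall>i. \<forall>x\<in>carrier H. U (T i x) = T' i (U x)" and x: "x \<in> carrier H"
  show "U (S i x) = S' i (U x)"
  proof (rule U_eqI)
    fix z assume z: "z \<in> carrier H"
    have "hinner K (U (S i x)) (U z) = hinner H x (T i z)"
      using x z by (simp add: U_inner H.hinner_S_left)
    also have "\<dots> = hinner K (U x) (T' i (U z))"
      using x z * U_inner[of x "T i z"] by simp
    finally show "hinner K (U (S i x)) (U z) = hinner K (S' i (U x)) (U z)"
      using x z by (simp add: K.hinner_S_left)
  qed (use x in simp_all)
qed

end

section \<open>The Pythagorean representation as a Cuntz system\<close>

context P_mod
begin

interpretation D: inner_product_space D by (rule inner_product_space_D)
interpretation C: hilbert_space "completion D" by (rule D.hilbert_space_completion)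

lemma hnorm_subtree_op: "X \<in> carrier D \<Longrightarrow> hnorm D (subtree_op H A B i X) \<le> hnorm D X"
proof -
  assume X: "X \<in> carrier D"
  note cl [simp] = linear_opD(1)[OF linear_subtree_op X]
  have "(hnorm D X)\<^sup>2 = (hnorm D (subtree_op H A B False X))\<^sup>2 + (hnorm D (subtree_op H A B True X))\<^sup>2"
    using X by (simp add: D.hnorm_power2 hinner_subtree_op[OF X X])
  then have "(hnorm D (subtree_op H A B i X))\<^sup>2 \<le> (hnorm D X)\<^sup>2" by (cases i) simp_all
  then show ?thesis using X by (simp add: abs_le_square_iff[symmetric])
qed

lemmas tau_cclass = D.extend_op_cclass[OF linear_subtree_op hnorm_subtree_op, folded tau_def]
lemmas hCauchy_subtree_op = D.hCauchy_contraction[OF linear_subtree_op hnorm_subtree_op]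

lemma tau_emb: "X \<in> carrier D \<Longrightarrow> tau H A B i (D.emb X) = D.emb (subtree_op H A B i X)"
  by (simp add: D.emb_def tau_cclass D.hCauchy_const)

lemma cuntz_system_Pi: "cuntz_system (Pi_space H A B) (Pi_gen H A B) (tau H A B)"
proof (rule cuntz_systemI)
  note [simp] = linear_opD(1)[OF linear_subtree_op]
  show "hilbert_space (Pi_space H A B)"
    unfolding Pi_space_def by (rule D.hilbert_space_completion)
  show "linear_op (Pi_space H A B) (Pi_space H A B) (tau H A B i)" for i
    unfolding linear_op_def Pi_space_def
  proof (intro conjI ballI allI)
    fix X assume "X \<in> carrier (completion D)"
    then obtain f where f: "hCauchy D f" "X = cclass D f" by (auto simp: D.carrier_completion_iff)
    note [simp] = D.hCauchyD(1)[OF f(1)]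
    show "tau H A B i X \<in> carrier (completion D)"
      using f by (simp add: tau_cclass hCauchy_subtree_op)
    show "tau H A B i (c \<odot>\<^bsub>completion D\<^esub> X) = c \<odot>\<^bsub>completion D\<^esub> tau H A B i X" for c
      using f by (simp add: tau_cclass hCauchy_subtree_op D.smult_cclass D.hCauchy_smult linear_opD[OF linear_subtree_op])
    fix Y assume "Y \<in> carrier (completion D)"
    then obtain g where g: "hCauchy D g" "Y = cclass D g" by (auto simp: D.carrier_completion_iff)
    note [simp] = D.hCauchyD(1)[OF g(1)]
    show "tau H A B i (X \<oplus>\<^bsub>completion D\<^esub> Y) = tau H A B i X \<oplus>\<^bsub>completion D\<^esub> tau H A B i Y"
      using f g by (simp add: tau_cclass hCauchy_subtree_op D.add_cclass D.hCauchy_add linear_opD[OF linear_subtree_op])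
  qed
  show "Pi_gen H A B i y = adjoint (Pi_space H A B) (tau H A B i) y" for i y
    by (simp add: Pi_gen_def)
  fix X assume "X \<in> carrier (Pi_space H A B)"
  then obtain f where f: "hCauchy D f" "X = cclass D f" by (auto simp: D.carrier_completion_iff Pi_space_def)
  note [simp] = D.hCauchyD(1)[OF f(1)]
  {
    fix Y assume "Y \<in> carrier (Pi_space H A B)"
    then obtain g where g: "hCauchy D g" "Y = cclass D g" by (auto simp: D.carrier_completion_iff Pi_space_def)
    note [simp] = D.hCauchyD(1)[OF g(1)]
    let ?F = "subtree_op H A B False" and ?T = "subtree_op H A B True"
    have "(\<lambda>n. hinner D (?F (f n)) (?F (g n)) + hinner D (?T (f n)) (?T (g n))) \<longlonglongrightarrow>
      hinner (completion D) (cclass D (\<lambda>n. ?F (f n))) (cclass D (\<lambda>n. ?F (g n)))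
      + hinner (completion D) (cclass D (\<lambda>n. ?T (f n))) (cclass D (\<lambda>n. ?T (g n)))"
      using f g by (intro tendsto_add D.hinner_cclass hCauchy_subtree_op) simp_all
    moreover have "(\<lambda>n. hinner D (f n) (g n)) \<longlonglongrightarrow> hinner (completion D) X Y"
      unfolding f g using f g by (intro D.hinner_cclass)
    ultimately show "hinner (Pi_space H A B) X Y
        = hinner (Pi_space H A B) (tau H A B False X) (tau H A B False Y)
        + hinner (Pi_space H A B) (tau H A B True X) (tau H A B True Y)"
      using f g LIMSEQ_unique by (fastforce simp: Pi_space_def tau_cclass hinner_subtree_op[symmetric])
  }
  fix i
  have "\<forall>n. \<exists>t. adm t \<and> f n = cls t" using D.hCauchyD(1)[OF f(1)] carrier_D_iff by blast
  then obtain t where t: "\<And>n. adm (t n)" "\<And>n. f n = cls (t n)" by metis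
  \<comment> \<open>the adjoint of \<open>\<tau>\<^sub>i\<close> grafts a tree below the root and puts \<open>0\<close> at the other child\<close>
  define g where "g n = cls (if i then Node (Leaf \<zero>) (t n) else Node (t n) (Leaf \<zero>))" for n
  have g_closed [simp]: "g n \<in> carrier D" for n using t by (simp add: g_def)
  have g: "subtree_op H A B i (g n) = f n" "subtree_op H A B (\<not> i) (g n) = \<zero>\<^bsub>D\<^esub>" for n
    using t subtree_op_cls[of "Leaf \<zero>" "t n"] subtree_op_cls[of "t n" "Leaf \<zero>"]
    by (auto simp: g_def dlimit_def)
  have "hnorm D (g m \<ominus>\<^bsub>D\<^esub> g n) = hnorm D (f m \<ominus>\<^bsub>D\<^esub> f n)" for m n
  proof -
    have "subtree_op H A B j (g m \<ominus>\<^bsub>D\<^esub> g n) = (if j = i then f m \<ominus>\<^bsub>D\<^esub> f n else \<zero>\<^bsub>D\<^esub>)" for j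
      using g linear_op_minus[OF inner_product_space_D inner_product_space_D linear_subtree_op, of "g m" "g n" j]
      by (cases i; cases j) simp_all
    then show ?thesis
      using hinner_subtree_op[of "g m \<ominus>\<^bsub>D\<^esub> g n" "g m \<ominus>\<^bsub>D\<^esub> g n"]
      by (cases i) (simp_all add: hnorm_def D.hinner_left)
  qed
  then have gC: "hCauchy D g" using f(1) by (simp add: hCauchy_def)
  show "\<exists>Y\<in>carrier (Pi_space H A B). tau H A B i Y = X \<and> tau H A B (\<not> i) Y = \<zero>\<^bsub>Pi_space H A B\<^esub>"
  proof (intro bexI conjI)
    show "cclass D g \<in> carrier (Pi_space H A B)" using gC by (simp add: Pi_space_def)
  qed (use gC in \<open>simp_all add: tau_cclass g f Pi_space_def\<close>, simp add: completion_def)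
qed

text \<open>
  The copy of the P-module in its representation, given by the trees with a single vertex.
\<close>

definition iota :: "'a \<Rightarrow> (nat \<Rightarrow> 'a dtree set) set" where
  "iota x = D.emb (cls (Leaf x))"

interpretation Pi: cuntz_system "Pi_space H A B" "Pi_gen H A B" "tau H A B"
  by (rule cuntz_system_Pi)

lemma emb_closed [simp]: "adm t \<Longrightarrow> D.emb (cls t) \<in> carrier (Pi_space H A B)"
  by (simp add: Pi_space_def)

lemma iota_closed [simp]: "x \<in> carrier H \<Longrightarrow> iota x \<in> carrier (Pi_space H A B)"
  by (simp add: iota_def)

lemma hinner_iota: "\<lbrakk>x \<in> carrier H; y \<in> carrier H\<rbrakk> \<Longrightarrow> hinner (Pi_space H A B) (iota x) (iota y) = hinner H x y"
  by (simp add: iota_def Pi_space_def D.hinner_emb hinner_cls)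

lemma linear_iota: "linear_op H (Pi_space H A B) iota"
  using linear_opD[OF D.linear_op_emb]
  by (auto simp: linear_op_def iota_def Pi_space_def add_cls[of "Leaf x" "Leaf y" for x y, simplified, symmetric]
      smult_cls[of "Leaf x" for x, simplified, symmetric])

lemma tau_iota: "x \<in> carrier H \<Longrightarrow> tau H A B i (iota x) = iota (if i then B x else A x)"
  by (simp add: iota_def tau_emb subtree_op_cls_Leaf)

lemma ev_map_iota: "adm t \<Longrightarrow> Pi.ev (map_dtree iota t) = D.emb (cls t)"
proof (induction t)
  case (Leaf x)
  then show ?case by (simp add: iota_def)
next
  case (Node l r)
  have "D.emb (cls (Node l r)) = Pi.ev (Node (map_dtree iota l) (map_dtree iota r))"
    using Node by (intro Pi.eq_ev_if_T_eq) (auto simp: tau_emb subtree_op_cls dtree.set_map)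
  then show ?case by simp
qed

lemma carrier_D: "carrier D = cls ` {t. adm t}"
  using carrier_D_iff by blast

lemma emb_carrier_D: "D.emb ` carrier D = Pi.ev ` {t. labels t \<subseteq> iota ` carrier H}"
  by (simp add: trees_labels_image image_image ev_map_iota carrier_D)

lemma generating_iota: "Pi.generating (iota ` carrier H)"
  unfolding Pi.generating_def emb_carrier_D[symmetric]
  using D.dense_emb by (auto simp: Pi_space_def[symmetric])

lemma T_invariant_iota: "Pi.T_invariant (iota ` carrier H)"
  using A B by (auto simp: Pi.T_invariant_def tau_iota)

primrec child :: "bool \<Rightarrow> 'a dtree \<Rightarrow> 'a dtree" where
  "child i (Leaf x) = Leaf (if i then B x else A x)"
| "child i (Node l r) = (if i then r else l)"

text \<open>
  A vector of the representation is a limit of trees, and so is a vector of \<open>K\<close> as \<open>j ` carrier H\<close>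
  generates. In both spaces the inner product of two trees is \<^const>\<open>tree_inner\<close>: for a leaf and an inner
  node this is the Parseval identity together with \<open>T i \<circ> j = j \<circ> A\<close> or \<open>j \<circ> B\<close>. So the unitary is
  obtained from \<open>gram_unitary\<close>.
\<close>

theorem universal:
  assumes K: "cuntz_system K S T"
    and j_closed: "\<And>x. x \<in> carrier H \<Longrightarrow> j x \<in> carrier K"
    and j_inner: "\<And>x y. \<lbrakk>x \<in> carrier H; y \<in> carrier H\<rbrakk> \<Longrightarrow> hinner K (j x) (j y) = hinner H x y"
    and T_j: "\<And>i x. x \<in> carrier H \<Longrightarrow> T i (j x) = j (if i then B x else A x)"
    and gen: "cuntz_system.generating K S (j ` carrier H)"
  obtains U where "unitary_op (Pi_space H A B) K U"
    and "\<And>i x. x \<in> carrier (Pi_space H A B) \<Longrightarrow> U (tau H A B i x) = T i (U x)"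
proof -
  interpret K: cuntz_system K S T by fact
  define f where "f t = D.emb (cls t)" for t
  define g where "g t = K.ev (map_dtree j t)" for t
  have f_closed [simp]: "f t \<in> carrier (Pi_space H A B)" if "adm t" for t using that by (simp add: f_def)
  have lab [simp]: "labels (map_dtree j t) \<subseteq> carrier K" if "adm t" for t
    using that j_closed by (auto simp: dtree.set_map)
  have g_closed [simp]: "g t \<in> carrier K" if "adm t" for t using that by (simp add: g_def)
  have child_adm [simp]: "adm (child i t)" if "adm t" for i t using that by (cases t) (auto simp: A B)
  have T_g: "T i (g t) = g (child i t)" if "adm t" for i t
    using that by (cases t) (simp_all add: g_def T_j K.T_ev_Node[of "map_dtree j _" "map_dtree j _", simplified])
  have T_f: "tau H A B i (f t) = f (child i t)" if "adm t" for i t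
    using that by (cases t) (simp_all add: f_def tau_emb subtree_op_cls_Leaf subtree_op_cls)
  have gram: "hinner (Pi_space H A B) (f s) (f t) = hinner K (g s) (g t)" if "adm s" "adm t" for s t
  proof -
    have "hinner K (g s) (g t) = G s t" using that
    proof (induction s t rule: tree_pair_induct)
      case (Leaf_Leaf x y)
      then show ?case by (simp add: g_def j_inner)
    next
      case (Leaf_Node x l r)
      then show ?case by (subst K.parseval) (simp_all add: T_g)
    next
      case (Node_Leaf l r y)
      then show ?case by (subst K.parseval) (simp_all add: T_g)
    next
      case (Node_Node l r l' r')
      then show ?case by (subst K.parseval) (simp_all add: T_g)
    qed
    then show ?thesis using that by (simp add: f_def Pi_space_def D.hinner_emb hinner_cls)
  qed
  have f_dense: "dense_in (Pi_space H A B) (f ` {t. adm t})"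
  proof -
    have "f ` {t. adm t} = D.emb ` carrier D"
      by (simp add: f_def carrier_D image_image)
    then show ?thesis using D.dense_emb by (simp add: Pi_space_def)
  qed
  have g_dense: "dense_in K (g ` {t. adm t})"
    using gen by (simp add: K.generating_def g_def trees_labels_image image_image)
  obtain U where U: "unitary_op (Pi_space H A B) K U" and Uf: "\<And>t. adm t \<Longrightarrow> U (f t) = g t"
    using gram_unitary[of "Pi_space H A B" K "{t. adm t}" f g] gram f_dense g_dense
      Pi.hilbert_space_axioms K.hilbert_space_axioms by auto
  interpret UU: cuntz_pair "Pi_space H A B" "Pi_gen H A B" "tau H A B" K S T U
    by unfold_locales (fact U)
  have "U (Pi_gen H A B i x) = S i (U x)" if x: "x \<in> carrier (Pi_space H A B)" for i x
  proof (rule K.dense_in_eqI[OF g_dense])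
    fix y assume "y \<in> g ` {t. adm t}"
    then obtain t where t: "adm t" "y = g t" by blast
    have "hinner K (U (Pi_gen H A B i x)) (g t) = hinner (Pi_space H A B) (Pi_gen H A B i x) (f t)"
      using x t UU.U_inner[of "Pi_gen H A B i x" "f t"] by (simp add: Uf)
    also have "\<dots> = hinner K (U x) (g (child i t))"
      using x t UU.U_inner[of x "f (child i t)"] by (simp add: Uf Pi.hinner_S_left T_f)
    also have "\<dots> = hinner K (S i (U x)) (g t)"
      using x t by (simp add: K.hinner_S_left T_g)
    finally show "hinner K (U (Pi_gen H A B i x)) y = hinner K (S i (U x)) y" by (simp add: t)
  qed (use x in simp_all)
  then have "U (tau H A B i x) = T i (U x)" if "x \<in> carrier (Pi_space H A B)" for i x
    using UU.intertwines_S_iff_T that by blast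
  with U show ?thesis using that by blast
qed

end

section \<open>The action of V in a Cuntz system\<close>

definition maps_cone :: "(bool stream \<Rightarrow> bool stream) \<Rightarrow> bool list \<Rightarrow> bool list \<Rightarrow> bool" where
  "maps_cone v u u' \<longleftrightarrow> (\<forall>w. v (u @- w) = u' @- w)"

lemma word_eq_if_cones_eq:
  fixes a b :: "bool list"
  assumes "\<And>w. a @- w = b @- w"
  shows "a = b"
  using assms
proof (induction a arbitrary: b)
  case Nil
  show ?case
  proof (cases b)
    case (Cons c b')
    then show ?thesis using arg_cong[OF Nil[of "sconst (\<not> c)"], of shd] by simp
  qed simp
next
  case (Cons c a)
  show ?case
  proof (cases b)
    case Nil
    then show ?thesis using arg_cong[OF Cons.prems[of "sconst (\<not> c)"], of shd] by simp
  next
    case (Cons d b')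
    have "c # a = d # b'"
      using Cons.IH[of b'] Cons.prems Cons by (metis shift.simps(2) stream.inject)
    then show ?thesis using Cons by simp
  qed
qed

lemma prefix_if_cones_meet:
  fixes a b :: "bool list"
  assumes "a @- w = b @- w'" "length b \<le> length a"
  obtains c where "a = b @ c"
proof -
  have "take (length b) a = stake (length b) (a @- w)"
    using assms(2) by (simp add: stake_shift)
  also have "\<dots> = b" by (simp add: assms(1) stake_shift)
  finally show ?thesis using that append_take_drop_id by metis
qed

lemma standard_partition_meets:
  assumes "standard_partition \<mu>"
  obtains j w where "j < length \<mu>" "x = \<mu> ! j @- w"
  using assms unfolding standard_partition_def by metis

lemma standard_partition_disjoint:
  assumes "standard_partition \<mu>" "i < length \<mu>" "j < length \<mu>" "\<mu> ! i @- w = \<mu> ! j @- w'"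
  shows "i = j"
  using assms unfolding standard_partition_def by metis

lemma standard_partition_long_word:
  assumes \<mu>: "standard_partition \<mu>" and long: "\<And>u. u \<in> set \<mu> \<Longrightarrow> length u \<le> length r"
  obtains j c where "j < length \<mu>" "r = \<mu> ! j @ c"
proof -
  obtain j w where j: "j < length \<mu>" "r @- sconst True = \<mu> ! j @- w"
    by (rule standard_partition_meets[OF \<mu>])
  with long obtain c where "r = \<mu> ! j @ c" by (auto elim: prefix_if_cones_meet)
  with j that show ?thesis by blast
qed

lemma long_words: "\<exists>N. \<forall>u\<in>set \<mu>. length u \<le> N"
  by (rule exI[of _ "sum_list (map length \<mu>)"]) (auto intro: member_le_sum_list)

context cuntz_system
begin

lemma fold_T_minus: "\<lbrakk>x \<in> carrier H; y \<in> carrier H\<rbrakk> \<Longrightarrow> fold T u (x \<ominus> y) = fold T u x \<ominus> fold T u y"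
  by (induction u arbitrary: x y) (simp_all add: T)

lemma fold_T_zero [simp]: "fold T u \<zero> = \<zero>"
  by (induction u) (simp_all add: T)

lemma eq_if_fold_T_eq:
  assumes "x \<in> carrier H" "y \<in> carrier H" "\<And>r. length r = n \<Longrightarrow> fold T r x = fold T r y"
  shows "x = y"
  using assms
proof (induction n arbitrary: x y)
  case 0
  then show ?case using 0(3)[of "[]"] by simp
next
  case (Suc n)
  show ?case
  proof (rule eq_if_T_eq)
    show "T i x = T i y" for i
    proof (rule Suc.IH)
      fix r :: "bool list" assume "length r = n"
      then show "fold T r (T i x) = fold T r (T i y)" using Suc.prems(3)[of "i # r"] by simp
    qed (use Suc.prems in simp_all)
  qed (use Suc.prems in simp_all)
qed

lemma fold_T_word_op: "x \<in> carrier H \<Longrightarrow> fold T u (word_op S u x) = x"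
  by (induction u) (simp_all add: T_S)

lemma fold_T_word_op_disjoint:
  assumes "x \<in> carrier H" "\<And>w w'. u @- w \<noteq> u' @- w'"
  shows "fold T u (word_op S u' x) = \<zero>"
  using assms(2)
proof (induction u arbitrary: u')
  case Nil
  then show ?case using Nil[of "u' @- sconst True" "sconst True"] by simp
next
  case (Cons a u)
  show ?case
  proof (cases u')
    case Nil
    then show ?thesis using Cons.prems[of "sconst True" "(a # u) @- sconst True"] by simp
  next
    case (Cons b v)
    show ?thesis
    proof (cases "a = b")
      case True
      have "fold T u (word_op S v x) = \<zero>"
        by (rule Cons.IH) (use Cons.prems Cons True in auto)
      then show ?thesis using True Cons assms(1) by (simp add: T_S)
    next
      case False
      then show ?thesis using Cons assms(1) by (simp add: T_S)
    qed
  qed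
qed

lemma hinner_word_op_left:
  "\<lbrakk>x \<in> carrier H; y \<in> carrier H\<rbrakk> \<Longrightarrow> hinner H (word_op S u x) y = hinner H x (fold T u y)"
  by (induction u arbitrary: y) (simp_all add: hinner_S_left)

lemma hinner_word_op_right:
  "\<lbrakk>x \<in> carrier H; y \<in> carrier H\<rbrakk> \<Longrightarrow> hinner H y (word_op S u x) = hinner H (fold T u y) x"
  using hinner_word_op_left[of x y u] hinner_commute[of "word_op S u x" y] hinner_commute[of x "fold T u y"] by simp

lemma fold_T_finsum:
  assumes f: "finite I" "f \<in> I \<rightarrow> carrier H"
  shows "fold T u (\<Oplus>i\<in>I. f i) = (\<Oplus>i\<in>I. fold T u (f i))"
proof (rule hinner_eqI)
  have f': "f i \<in> carrier H" if "i \<in> I" for i using f that by auto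
  show "fold T u (\<Oplus>i\<in>I. f i) \<in> carrier H" "(\<Oplus>i\<in>I. fold T u (f i)) \<in> carrier H"
    using f' by (auto intro!: fold_T_closed M.finsum_closed)
  fix z assume z: "z \<in> carrier H"
  have "hinner H (fold T u (\<Oplus>i\<in>I. f i)) z = (\<Sum>i\<in>I. hinner H (f i) (word_op S u z))"
    using f z by (simp add: hinner_finsum_left M.finsum_closed flip: hinner_word_op_right)
  also have "\<dots> = hinner H (\<Oplus>i\<in>I. fold T u (f i)) z"
    using f f' z by (subst hinner_finsum_left) (auto simp: hinner_word_op_right)
  finally show "hinner H (fold T u (\<Oplus>i\<in>I. f i)) z = hinner H (\<Oplus>i\<in>I. fold T u (f i)) z" .
qed

lemma partition_eqI:
  assumes \<mu>: "standard_partition \<mu>" and "x \<in> carrier H" "y \<in> carrier H"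
    and eq: "\<And>i. i < length \<mu> \<Longrightarrow> fold T (\<mu> ! i) x = fold T (\<mu> ! i) y"
  shows "x = y"
proof -
  obtain N where N: "\<forall>u\<in>set \<mu>. length u \<le> N" using long_words by blast
  show ?thesis
  proof (rule eq_if_fold_T_eq[of _ _ N])
    fix r :: "bool list" assume "length r = N"
    then have "length u \<le> length r" if "u \<in> set \<mu>" for u
      using N that by auto
    then obtain j c where "j < length \<mu>" "r = \<mu> ! j @ c"
      using standard_partition_long_word[OF \<mu>] by blast
    then show "fold T r x = fold T r y" using eq by simp
  qed fact+
qed

lemma fold_T_partition_sum:
  assumes \<nu>: "standard_partition \<nu>" and f: "\<And>j. j < length \<nu> \<Longrightarrow> f j \<in> carrier H" and i: "i < length \<nu>"
  shows "fold T (\<nu> ! i) (\<Oplus>j\<in>{..<length \<nu>}. word_op S (\<nu> ! j) (f j)) = f i"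
proof -
  have fold_f: "fold T (\<nu> ! i) (word_op S (\<nu> ! j) (f j)) = (if i = j then f i else \<zero>)"
    if j: "j < length \<nu>" for j
  proof (cases "i = j")
    case False
    then have "\<nu> ! i @- w \<noteq> \<nu> ! j @- w'" for w w'
      using standard_partition_disjoint[OF \<nu>] i j by metis
    then show ?thesis using f j False by (simp add: fold_T_word_op_disjoint)
  qed (use f j in \<open>simp add: fold_T_word_op\<close>)
  have "fold T (\<nu> ! i) (\<Oplus>j\<in>{..<length \<nu>}. word_op S (\<nu> ! j) (f j))
      = (\<Oplus>j\<in>{..<length \<nu>}. fold T (\<nu> ! i) (word_op S (\<nu> ! j) (f j)))"
    using f by (intro fold_T_finsum) auto
  also have "\<dots> = (\<Oplus>j\<in>{..<length \<nu>}. if i = j then f i else \<zero>)"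
    using i f by (intro M.finsum_cong') (auto simp: fold_f)
  also have "\<dots> = f i"
    using i f by (intro M.finsum_singleton) auto
  finally show ?thesis .
qed

lemma partition_parseval:
  assumes \<mu>: "standard_partition \<mu>" and x: "x \<in> carrier H" and y: "y \<in> carrier H"
  shows "hinner H x y = (\<Sum>j<length \<mu>. hinner H (fold T (\<mu> ! j) x) (fold T (\<mu> ! j) y))"
proof -
  have "x = (\<Oplus>j\<in>{..<length \<mu>}. word_op S (\<mu> ! j) (fold T (\<mu> ! j) x))"
    by (rule partition_eqI[OF \<mu>]) (use x in \<open>auto intro!: M.finsum_closed simp: fold_T_partition_sum[OF \<mu>]\<close>)
  then have "hinner H x y = hinner H (\<Oplus>j\<in>{..<length \<mu>}. word_op S (\<mu> ! j) (fold T (\<mu> ! j) x)) y"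
    by (rule arg_cong)
  also have "\<dots> = (\<Sum>j<length \<mu>. hinner H (fold T (\<mu> ! j) x) (fold T (\<mu> ! j) y))"
    using x y by (subst hinner_finsum_left) (auto simp: hinner_word_op_left)
  finally show ?thesis .
qed

lemma V_op_table:
  assumes v: "is_table v \<mu>0 \<nu>0" and x: "x \<in> carrier H"
  obtains \<mu> \<nu> where "is_table v \<mu> \<nu>" "V_op H S v x \<in> carrier H"
    "\<And>i. i < length \<mu> \<Longrightarrow> fold T (\<nu> ! i) (V_op H S v x) = fold T (\<mu> ! i) x"
proof -
  obtain \<mu> \<nu> where some: "(SOME (\<mu>, \<nu>). is_table v \<mu> \<nu>) = (\<mu>, \<nu>)" by fastforce
  have table: "is_table v \<mu> \<nu>"
    using someI[of "\<lambda>(\<mu>, \<nu>). is_table v \<mu> \<nu>" "(\<mu>0, \<nu>0)"] v some by simp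
  then have \<nu>: "standard_partition \<nu>" "length \<mu> = length \<nu>" by (auto simp: is_table_def)
  have V: "V_op H S v x = (\<Oplus>j\<in>{..<length \<nu>}. word_op S (\<nu> ! j) (fold T (\<mu> ! j) x))"
    using x \<nu>(2) by (simp add: V_op_def some adjoint_word_op)
  have "fold T (\<nu> ! i) (V_op H S v x) = fold T (\<mu> ! i) x" if "i < length \<mu>" for i
    unfolding V using \<nu> that x by (intro fold_T_partition_sum) auto
  moreover have "V_op H S v x \<in> carrier H" unfolding V using x by (intro M.finsum_closed) simp
  ultimately show ?thesis using that table by blast
qed

lemma V_op_closed:
  assumes "v \<in> thompson_V" "x \<in> carrier H"
  shows "V_op H S v x \<in> carrier H"
proof -
  obtain \<mu> \<nu> where "is_table v \<mu> \<nu>" using assms(1) by (auto simp: thompson_V_def)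
  then show ?thesis by (rule V_op_table[OF _ assms(2)])
qed

text \<open>
  This characterizes the operator of an element of \<open>V\<close> independently of the table which was chosen in its
  definition. Below a word \<open>u\<close> all sufficiently long words extend some \<open>\<mu>\<^sub>j\<close> of the table, where the
  claim is known, and a vector is determined by its components at all words of a given length.
\<close>

lemma fold_T_V_op:
  assumes v: "v \<in> thompson_V" and x: "x \<in> carrier H" and u: "maps_cone v u u'"
  shows "fold T u' (V_op H S v x) = fold T u x"
proof -
  define y where "y = V_op H S v x"
  obtain \<mu>0 \<nu>0 where "is_table v \<mu>0 \<nu>0" using v by (auto simp: thompson_V_def)
  then obtain \<mu> \<nu> where table: "is_table v \<mu> \<nu>" and y: "y \<in> carrier H"
    and fold_y: "\<And>i. i < length \<mu> \<Longrightarrow> fold T (\<nu> ! i) y = fold T (\<mu> ! i) x"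
    unfolding y_def by (rule V_op_table[OF _ x]) blast
  have \<mu>: "standard_partition \<mu>" using table by (simp add: is_table_def)
  obtain N where N: "\<forall>u\<in>set \<mu>. length u \<le> N" using long_words by blast
  have "fold T u' y = fold T u x"
  proof (rule eq_if_fold_T_eq[of _ _ N])
    fix r :: "bool list" assume "length r = N"
    then have "length u' \<le> length (u @ r)" if "u' \<in> set \<mu>" for u'
      using N that by auto
    then obtain j c where j: "j < length \<mu>" "u @ r = \<mu> ! j @ c"
      using standard_partition_long_word[OF \<mu>] by blast
    have "u' @ r = \<nu> ! j @ c"
    proof (rule word_eq_if_cones_eq)
      fix w
      have "(u' @ r) @- w = v (u @- r @- w)" using u by (simp add: maps_cone_def)
      also have "u @- r @- w = \<mu> ! j @- c @- w" using j(2) by (metis shift_append)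
      also have "v \<dots> = \<nu> ! j @- c @- w" using table j by (simp add: is_table_def)
      finally show "(u' @ r) @- w = (\<nu> ! j @ c) @- w" by simp
    qed
    then have "fold T (u' @ r) y = fold T (u @ r) x" using j fold_y by simp
    then show "fold T r (fold T u' y) = fold T r (fold T u x)" by simp
  qed (use x y in simp_all)
  then show ?thesis by (simp add: y_def)
qed

lemma hnorm_V_op:
  assumes v: "v \<in> thompson_V" and x: "x \<in> carrier H"
  shows "hnorm H (V_op H S v x) = hnorm H x"
proof -
  obtain \<mu> \<nu> where table: "is_table v \<mu> \<nu>" using v by (auto simp: thompson_V_def)
  then have "maps_cone v (\<mu> ! j) (\<nu> ! j)" if "j < length \<mu>" for j
    using that by (auto simp: is_table_def maps_cone_def)
  then have fold: "fold T (\<nu> ! j) (V_op H S v x) = fold T (\<mu> ! j) x" if "j < length \<mu>" for j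
    using fold_T_V_op[OF v x] that by blast
  have part: "standard_partition \<mu>" "standard_partition \<nu>" "length \<nu> = length \<mu>"
    using table by (auto simp: is_table_def)
  have "hinner H (V_op H S v x) (V_op H S v x) = hinner H x x"
    using partition_parseval[OF part(1) x x] partition_parseval[OF part(2) V_op_closed[OF v x] V_op_closed[OF v x]]
    by (simp add: part fold)
  then show ?thesis by (simp add: hnorm_def)
qed

lemma V_op_eqI:
  assumes v: "v \<in> thompson_V" and x: "x \<in> carrier H" and y: "y \<in> carrier H"
    and eq: "\<And>u u'. maps_cone v u u' \<Longrightarrow> fold T u' y = fold T u x"
  shows "V_op H S v x = y"
proof -
  obtain \<mu> \<nu> where table: "is_table v \<mu> \<nu>" using v by (auto simp: thompson_V_def)
  show ?thesis
  proof (rule partition_eqI)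
    show "standard_partition \<nu>" using table by (simp add: is_table_def)
    fix i assume "i < length \<nu>"
    then have "maps_cone v (\<mu> ! i) (\<nu> ! i)" using table by (simp add: is_table_def maps_cone_def)
    then show "fold T (\<nu> ! i) (V_op H S v x) = fold T (\<nu> ! i) y"
      using eq fold_T_V_op[OF v x] by simp
  qed (use V_op_closed v x y in auto)
qed

end

context cuntz_pair
begin

lemma U_fold_T:
  assumes "\<And>i x. x \<in> carrier H \<Longrightarrow> U (T i x) = T' i (U x)" "x \<in> carrier H"
  shows "U (fold T u x) = fold T' u (U x)"
  using assms(2) by (induction u arbitrary: x) (simp_all add: assms(1))

lemma U_V_op:
  assumes int: "\<And>i x. x \<in> carrier H \<Longrightarrow> U (T i x) = T' i (U x)"
    and v: "v \<in> thompson_V" and x: "x \<in> carrier H"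
  shows "U (V_op H S v x) = V_op K S' v (U x)"
proof (rule K.V_op_eqI[symmetric])
  fix u u' assume "maps_cone v u u'"
  then show "fold T' u' (U (V_op H S v x)) = fold T' u (U x)"
    using H.fold_T_V_op[OF v x] H.V_op_closed[OF v x] x by (simp flip: U_fold_T[OF int])
qed (use H.V_op_closed[OF v x] v x in simp_all)

end

section \<open>Elements of Thompson's group F from pairs of trees\<close>

fun leaf_words :: "unit dtree \<Rightarrow> bool list list" where
  "leaf_words (Leaf x) = [[]]"
| "leaf_words (Node l r) = map ((#) False) (leaf_words l) @ map ((#) True) (leaf_words r)"

lemma standard_partition_leaf_words: "standard_partition (leaf_words t)"
proof (induction t)
  case (Leaf x)
  show ?case by (auto simp: standard_partition_def)
next
  case (Node l r)
  show ?case unfolding standard_partition_def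
  proof
    fix x :: "bool stream"
    obtain b x' where x: "x = b ## x'" by (cases x)
    let ?n = "length (leaf_words l)" and ?P = "\<lambda>j. j < length (leaf_words (Node l r)) \<and> (\<exists>w. x = leaf_words (Node l r) ! j @- w)"
    show "\<exists>!j. ?P j"
    proof (cases b)
      case False
      obtain j where j: "j < ?n" "\<exists>w. x' = leaf_words l ! j @- w"
        and uniq: "\<And>i. \<lbrakk>i < ?n; \<exists>w. x' = leaf_words l ! i @- w\<rbrakk> \<Longrightarrow> i = j"
        using Node.IH(1) unfolding standard_partition_def by metis
      show ?thesis
      proof (rule ex1I[of _ j])
        show "?P j" using j False x by (auto simp: nth_append)
        fix i assume "?P i"
        then show "i = j" using False x uniq[of i] by (auto simp: nth_append split: if_splits)
      qed
    next
      case True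
      obtain j where j: "j < length (leaf_words r)" "\<exists>w. x' = leaf_words r ! j @- w"
        and uniq: "\<And>i. \<lbrakk>i < length (leaf_words r); \<exists>w. x' = leaf_words r ! i @- w\<rbrakk> \<Longrightarrow> i = j"
        using Node.IH(2) unfolding standard_partition_def by metis
      show ?thesis
      proof (rule ex1I[of _ "?n + j"])
        show "?P (?n + j)" using j True x by (auto simp: nth_append)
        fix i assume "?P i"
        then show "i = ?n + j" using True x uniq[of "i - ?n"] by (auto simp: nth_append split: if_splits)
      qed
    qed
  qed
qed

lemma lex_sorted_leaf_words: "lex_sorted (leaf_words t)"
  by (induction t) (auto simp: lex_sorted_def sorted_wrt_append sorted_wrt_map)

text \<open>
  The element which maps the \<open>j\<close>-th leaf of \<open>s\<close> to the \<open>j\<close>-th leaf of \<open>t\<close>.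
\<close>

lemma tree_pair_in_F:
  assumes "length (leaf_words s) = length (leaf_words t)"
  obtains v where "v \<in> thompson_F"
    and "\<And>u u'. (u, u') \<in> set (zip (leaf_words s) (leaf_words t)) \<Longrightarrow> maps_cone v u u'"
proof -
  define J where "J x = (THE j. j < length (leaf_words s) \<and> (\<exists>w. x = leaf_words s ! j @- w))" for x
  define v where "v x = leaf_words t ! J x @- sdrop (length (leaf_words s ! J x)) x" for x
  have "J (leaf_words s ! j @- w) = j" if "j < length (leaf_words s)" for j w
    unfolding J_def
    by (rule the_equality) (use that standard_partition_disjoint[OF standard_partition_leaf_words] in blast)+
  then have v: "v (leaf_words s ! j @- w) = leaf_words t ! j @- w" if "j < length (leaf_words s)" for j w
    using that by (simp add: v_def sdrop_shift)
  then have "is_table v (leaf_words s) (leaf_words t)"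
    using assms by (simp add: is_table_def standard_partition_leaf_words)
  then have "v \<in> thompson_F"
    unfolding thompson_F_def using lex_sorted_leaf_words by blast
  moreover have "maps_cone v u u'" if "(u, u') \<in> set (zip (leaf_words s) (leaf_words t))" for u u'
    using that v by (auto simp: maps_cone_def in_set_zip)
  ultimately show ?thesis using that by blast
qed

text \<open>
  The tree with \<open>n\<close> carets along the branch \<open>b b b \<dots>\<close>.
\<close>

primrec comb :: "bool \<Rightarrow> nat \<Rightarrow> unit dtree" where
  "comb b 0 = Leaf ()"
| "comb b (Suc n) = (if b then Node (Leaf ()) (comb b n) else Node (comb b n) (Leaf ()))"

lemma length_comb [simp]: "length (leaf_words (comb b n)) = Suc n"
  by (cases b; induction n) simp_all

lemma comb_True_nth: "j \<le> n \<Longrightarrow> leaf_words (comb True n) ! j = (if j < n then replicate j True @ [False] else replicate n True)"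
proof (induction n arbitrary: j)
  case (Suc n)
  then show ?case by (cases j) auto
qed simp

lemma comb_False_nth: "j \<le> n \<Longrightarrow> leaf_words (comb False n) ! j = (if j = 0 then replicate n False else replicate (n - j) False @ [True])"
proof (induction n arbitrary: j)
  case (Suc n)
  show ?case
  proof (cases "j \<le> n")
    case True
    then show ?thesis using Suc.IH[of j] by (auto simp: nth_append Suc_diff_le)
  next
    case False
    then have "j = Suc n" using Suc.prems by simp
    then show ?thesis by (simp add: nth_append)
  qed
qed simp

text \<open>
  The pairs of leaves of the element given by two opposite combs, which is a power of \<open>x\<^sub>0\<close> or of its
  inverse. For \<open>b = True\<close> the order of the leaves is reversed, so \<open>j\<close> counts from the right.
\<close>

lemma comb_pair:
  assumes "j \<le> m" "m > 0"
  shows "(if j = 0 then replicate m b else replicate (m - j) b @ [\<not> b],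
      if j = m then replicate m (\<not> b) else replicate j (\<not> b) @ [b])
    \<in> set (zip (leaf_words (comb b m)) (leaf_words (comb (\<not> b) m)))"
proof (cases b)
  case False
  then show ?thesis unfolding in_set_zip
    by (intro exI[of _ j]) (use assms in \<open>simp add: comb_False_nth comb_True_nth\<close>)
next
  case True
  then show ?thesis unfolding in_set_zip
    by (intro exI[of _ "m - j"]) (use assms in \<open>auto simp add: comb_False_nth comb_True_nth\<close>)
qed

text \<open>
  Puts \<open>t\<close> at the end of the branch \<open>w\<close>, so that the element of a pair of grafted trees acts inside the
  cone of \<open>w\<close> only. The leaves off the branch are the words of \<open>siblings w\<close>.
\<close>

primrec graft :: "bool list \<Rightarrow> unit dtree \<Rightarrow> unit dtree" where
  "graft [] t = t"
| "graft (b # w) t = (if b then Node (Leaf ()) (graft w t) else Node (graft w t) (Leaf ()))"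

primrec siblings :: "bool list \<Rightarrow> bool list list" where
  "siblings [] = []"
| "siblings (b # w) = [\<not> b] # map ((#) b) (siblings w)"

lemma length_graft: "length (leaf_words s) = length (leaf_words t) \<Longrightarrow> length (leaf_words (graft w s)) = length (leaf_words (graft w t))"
  by (induction w) simp_all

lemma Cons_pair_in_image:
  "(c # u, d # u') \<in> (\<lambda>(x, y). (e # x, e # y)) ` P \<longleftrightarrow> c = e \<and> d = e \<and> (u, u') \<in> P"
  by auto

lemma graft_pairs:
  assumes "length (leaf_words s) = length (leaf_words t)"
  shows "(u, u') \<in> set (zip (leaf_words s) (leaf_words t)) \<Longrightarrow>
      (w @ u, w @ u') \<in> set (zip (leaf_words (graft w s)) (leaf_words (graft w t)))"
    and "v \<in> set (siblings w) \<Longrightarrow> (v, v) \<in> set (zip (leaf_words (graft w s)) (leaf_words (graft w t)))"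
proof -
  show "(u, u') \<in> set (zip (leaf_words s) (leaf_words t)) \<Longrightarrow>
      (w @ u, w @ u') \<in> set (zip (leaf_words (graft w s)) (leaf_words (graft w t)))"
    using length_graft[OF assms] by (induction w) (simp_all add: zip_map_map Cons_pair_in_image)
  show "v \<in> set (siblings w) \<Longrightarrow> (v, v) \<in> set (zip (leaf_words (graft w s)) (leaf_words (graft w t)))"
    using length_graft[OF assms] by (induction w arbitrary: v) (auto simp: zip_map_map Cons_pair_in_image)
qed

lemma local_translation_in_F:
  assumes "m > 0"
  obtains g where "g \<in> thompson_F" "\<And>v. v \<in> set (siblings w) \<Longrightarrow> maps_cone g v v"
    "\<And>j. j \<le> m \<Longrightarrow> maps_cone g (w @ (if j = 0 then replicate m b else replicate (m - j) b @ [\<not> b]))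
       (w @ (if j = m then replicate m (\<not> b) else replicate j (\<not> b) @ [b]))"
proof -
  have len: "length (leaf_words (comb b m)) = length (leaf_words (comb (\<not> b) m))" by simp
  obtain g where g: "g \<in> thompson_F"
    "\<And>u u'. (u, u') \<in> set (zip (leaf_words (graft w (comb b m))) (leaf_words (graft w (comb (\<not> b) m)))) \<Longrightarrow> maps_cone g u u'"
    using tree_pair_in_F[OF length_graft[OF len]] by blast
  show ?thesis
    by (rule that[OF g(1)]; rule g(2)) (use graft_pairs[OF len] comb_pair assms in blast)+
qed

text \<open>
  A comb with \<open>n\<close> carets hanging below the child \<open>b\<close> of the root has as many leaves as the comb with \<open>n + 1\<close>
  carets, and all but two pairs of corresponding leaves differ only in the initial letter \<open>b\<close>. A single
  element thus serves all \<open>k < n\<close>.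
\<close>

lemma shift_in_F:
  obtains f where "f \<in> thompson_F"
    "\<And>k. k < n \<Longrightarrow> maps_cone f (b # replicate k (\<not> b) @ [b]) (replicate k (\<not> b) @ [b])"
proof -
  let ?s = "if b then Node (Leaf ()) (comb (\<not> b) n) else Node (comb (\<not> b) n) (Leaf ())"
  have pair: "(b # replicate k (\<not> b) @ [b], replicate k (\<not> b) @ [b]) \<in> set (zip (leaf_words ?s) (leaf_words (comb (\<not> b) (Suc n))))"
    if k: "k < n" for k
  proof (cases b)
    case False
    then show ?thesis unfolding in_set_zip
      by (intro exI[of _ k]) (use k in \<open>simp add: comb_True_nth nth_append del: comb.simps\<close>)
  next
    case True
    then show ?thesis unfolding in_set_zip
      by (intro exI[of _ "Suc (n - k)"]) (use k in \<open>simp add: comb_False_nth nth_append del: comb.simps\<close>)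
  qed
  have len: "length (leaf_words ?s) = length (leaf_words (comb (\<not> b) (Suc n)))"
    by (simp del: comb.simps)
  show ?thesis
    by (rule tree_pair_in_F[OF len]) (rule that, assumption, use pair in blast)
qed

lemma thompson_F_subset_T: "thompson_F \<subseteq> thompson_T"
proof
  fix v assume "v \<in> thompson_F"
  then obtain \<mu> \<nu> where "is_table v \<mu> \<nu>" "lex_sorted \<mu>" "lex_sorted (rotate 0 \<nu>)"
    by (auto simp: thompson_F_def)
  then show "v \<in> thompson_T" unfolding thompson_T_def by blast
qed

lemma thompson_T_subset_V: "thompson_T \<subseteq> thompson_V"
  unfolding thompson_T_def thompson_V_def by blast

section \<open>Intertwiners of F are intertwiners of Cuntz systems\<close>

context cuntz_system
begin

text \<open>
  Iterates of \<open>T i\<close> are treated as components \<open>fold T (replicate n i)\<close> at constant words, so they must not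
  be turned into function powers.
\<close>

declare fold_replicate [simp del]

text \<open>
  Diffuseness at a vector, along the two constant sequences of letters.
\<close>

definition vanishing :: "'a \<Rightarrow> bool" where
  "vanishing x \<longleftrightarrow> (\<forall>i. (\<lambda>n. hnorm H (fold T (replicate n i) x)) \<longlonglongrightarrow> 0)"

lemma vanishing_if_generating:
  assumes gen: "generating W" and W: "\<And>x. x \<in> W \<Longrightarrow> vanishing x" and x: "x \<in> carrier H"
  shows "vanishing x"
  unfolding vanishing_def
proof
  fix i
  have WH: "W \<subseteq> carrier H" using gen by (simp add: generating_def)
  have tree: "(\<lambda>n. hnorm H (fold T (replicate n i) (ev t))) \<longlonglongrightarrow> 0" if "labels t \<subseteq> W" for t
    using that
  proof (induction t)
    case (Leaf x)
    then show ?case using W by (simp add: vanishing_def)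
  next
    case (Node l r)
    have lr: "labels l \<subseteq> carrier H" "labels r \<subseteq> carrier H" using Node.prems WH by auto
    have "(\<lambda>n. hnorm H (fold T (replicate (Suc n) i) (ev (Node l r)))) \<longlonglongrightarrow> 0"
      using Node T_ev_Node[OF lr, of i] by (cases i) (simp_all del: ev.simps)
    then show ?case by (rule LIMSEQ_imp_Suc)
  qed
  show "(\<lambda>n. hnorm H (fold T (replicate n i) x)) \<longlonglongrightarrow> 0"
  proof (rule LIMSEQ_I)
    fix e :: real assume "e > 0"
    then obtain t where t: "labels t \<subseteq> W" "hnorm H (x \<ominus> ev t) < e / 2"
      using generatingD[OF gen x, of "e / 2"] by auto
    obtain N where N: "\<And>n. n \<ge> N \<Longrightarrow> norm (hnorm H (fold T (replicate n i) (ev t)) - 0) < e / 2"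
      using LIMSEQ_D[OF tree[OF t(1)], of "e / 2"] \<open>e > 0\<close> by auto
    show "\<exists>N. \<forall>n\<ge>N. norm (hnorm H (fold T (replicate n i) x) - 0) < e"
    proof (intro exI[of _ N] allI impI)
      fix n assume "n \<ge> N"
      have ev: "ev t \<in> carrier H" using t(1) WH by (intro ev_closed) auto
      have "hnorm H (fold T (replicate n i) x)
          \<le> hnorm H (fold T (replicate n i) (ev t)) + hnorm H (fold T (replicate n i) (x \<ominus> ev t))"
        using x ev hnorm_triangle_minus by (simp add: fold_T_minus)
      also have "\<dots> < e / 2 + e / 2"
      proof (rule add_strict_mono)
        show "hnorm H (fold T (replicate n i) (ev t)) < e / 2" using N[OF \<open>n \<ge> N\<close>] by simp
        show "hnorm H (fold T (replicate n i) (x \<ominus> ev t)) < e / 2"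
          using hnorm_fold_T_le[of "x \<ominus> ev t" "replicate n i"] x ev t(2) by simp
      qed
      finally show "norm (hnorm H (fold T (replicate n i) x) - 0) < e" using x by simp
    qed
  qed
qed

lemma parseval_digit:
  "\<lbrakk>x \<in> carrier H; y \<in> carrier H\<rbrakk> \<Longrightarrow>
    hinner H x y = hinner H (T b x) (T b y) + hinner H (T (\<not> b) x) (T (\<not> b) y)"
  using parseval[of x y] by (cases b) simp_all

lemma comb_parseval:
  assumes "x \<in> carrier H" "y \<in> carrier H"
  shows "hinner H x y = (\<Sum>j<n. hinner H (fold T (replicate j (\<not> b) @ [b]) x) (fold T (replicate j (\<not> b) @ [b]) y))
    + hinner H (fold T (replicate n (\<not> b)) x) (fold T (replicate n (\<not> b)) y)"
proof (induction n)
  case (Suc n)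
  let ?x = "fold T (replicate n (\<not> b)) x" and ?y = "fold T (replicate n (\<not> b)) y"
  have "hinner H ?x ?y = hinner H (T b ?x) (T b ?y) + hinner H (T (\<not> b) ?x) (T (\<not> b) ?y)"
    by (rule parseval_digit) (use assms in simp_all)
  moreover have "fold T (replicate (Suc n) (\<not> b)) z = T (\<not> b) (fold T (replicate n (\<not> b)) z)" for z
    by (simp only: replicate_append_same[symmetric] replicate_Suc fold_append comp_apply fold_simps)
  ultimately show ?case using Suc.IH by simp
qed simp

text \<open>
  If two vectors agree in the components off the branch \<open>w\<close>, only the component at \<open>w\<close> contributes to the
  difference of their inner products with \<open>z\<close>.
\<close>

lemma sibling_inner_difference:
  assumes "x \<in> carrier H" "y \<in> carrier H" "z \<in> carrier H"
    and "\<And>v. v \<in> set (siblings w) \<Longrightarrow> fold T v y = fold T v x"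
  shows "hinner H y z - hinner H x z
    = hinner H (fold T w y) (fold T w z) - hinner H (fold T w x) (fold T w z)"
  using assms
proof (induction w arbitrary: x y z)
  case (Cons b w)
  have "hinner H (T b y) (T b z) - hinner H (T b x) (T b z)
    = hinner H (fold T w (T b y)) (fold T w (T b z)) - hinner H (fold T w (T b x)) (fold T w (T b z))"
  proof (rule Cons.IH)
    fix v assume "v \<in> set (siblings w)"
    then show "fold T v (T b y) = fold T v (T b x)" using Cons.prems(4)[of "b # v"] by simp
  qed (use Cons.prems in simp_all)
  moreover have "T (\<not> b) y = T (\<not> b) x" using Cons.prems(4)[of "[\<not> b]"] by simp
  ultimately show ?case
    using Cons.prems parseval_digit[of y z b] parseval_digit[of x z b] by simp
qed simp

text \<open>
  The assumptions hold if \<open>h m\<close> is the image of \<open>a\<close> under the \<open>m\<close>-th power of \<open>x\<^sub>0\<close> (or of its inverse).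
  Expand the inner product with \<open>c\<close> along the comb with \<open>N\<close> carets in the direction opposite to \<open>b\<close>. Its last term is small, uniformly in
  \<open>m\<close>, because \<open>c\<close> is vanishing, and each of the \<open>N\<close> other terms tends to \<open>0\<close> as \<open>m\<close> grows, because the
  component of \<open>h m\<close> is a component of \<open>a\<close> at a word that starts with many letters \<open>b\<close>.
\<close>

lemma weak_null_if_translated:
  assumes a: "a \<in> carrier H" "vanishing a" and c: "c \<in> carrier H" "vanishing c"
    and h: "\<And>m. h m \<in> carrier H" "\<And>m. hnorm H (h m) \<le> B"
    and translated: "\<And>m j. j \<le> m \<Longrightarrow>
      fold T (replicate j (\<not> b) @ [b]) (h m)
      = fold T (if j = 0 then replicate (Suc m) b else replicate (Suc m - j) b @ [\<not> b]) a"
  shows "(\<lambda>m. hinner H (h m) c) \<longlonglongrightarrow> 0"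
proof (rule LIMSEQ_I)
  fix e :: real assume e: "e > 0"
  have B: "B \<ge> 0" using h(2)[of 0] hnorm_nonneg[OF h(1)[of 0]] by linarith
  have "(\<lambda>n. B * hnorm H (fold T (replicate n (\<not> b)) c)) \<longlonglongrightarrow> B * 0"
    using c by (intro tendsto_intros) (simp add: vanishing_def)
  \<comment> \<open>the depth of the comb makes its last term small, uniformly in \<open>m\<close>\<close>
  then obtain N where N: "B * hnorm H (fold T (replicate N (\<not> b)) c) < e / 2"
    using order_tendstoD(2)[of _ "B * 0" sequentially "e / 2"] e by (auto simp: eventually_sequentially)
  have tail: "hnorm H (fold T (replicate j (\<not> b) @ [b]) (h m)) \<le> hnorm H (fold T (replicate (Suc m - j) b) a)"
    if "j \<le> m" for j m
    using hnorm_T_le[of "fold T (replicate (Suc m - j) b) a" "\<not> b"] a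
    unfolding translated[OF that] by simp
  have "(\<lambda>m. hnorm H (fold T (replicate (Suc m - j) b) a)) \<longlonglongrightarrow> 0" for j
  proof -
    have "filterlim (\<lambda>m. Suc m - j) sequentially sequentially"
      by (rule filterlim_compose[OF filterlim_minus_const_nat_at_top filterlim_Suc])
    moreover have "(\<lambda>n. hnorm H (fold T (replicate n b) a)) \<longlonglongrightarrow> 0"
      using a by (simp add: vanishing_def)
    ultimately show ?thesis by (rule filterlim_compose[rotated])
  qed
  then have "(\<lambda>m. \<Sum>j<N. hnorm H (fold T (replicate (Suc m - j) b) a) * hnorm H c) \<longlonglongrightarrow> (\<Sum>j<N. 0 * hnorm H c)"
    by (intro tendsto_intros)
  \<comment> \<open>now \<open>N\<close> is fixed, and each of the other terms tends to \<open>0\<close>\<close>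
  then obtain M where M: "\<And>m. m \<ge> M \<Longrightarrow> (\<Sum>j<N. hnorm H (fold T (replicate (Suc m - j) b) a) * hnorm H c) < e / 2"
    using order_tendstoD(2)[of _ "\<Sum>j<N. 0 * hnorm H c" sequentially "e / 2"] e by (auto simp: eventually_sequentially)
  show "\<exists>M. \<forall>m\<ge>M. norm (hinner H (h m) c - 0) < e"
  proof (intro exI[of _ "max M N"] allI impI)
    fix m assume m: "m \<ge> max M N"
    let ?w = "\<lambda>j. replicate j (\<not> b) @ [b]"
    have "norm (\<Sum>j<N. hinner H (fold T (?w j) (h m)) (fold T (?w j) c))
        \<le> (\<Sum>j<N. hnorm H (fold T (replicate (Suc m - j) b) a) * hnorm H c)"
    proof (rule sum_norm_le)
      fix j assume "j \<in> {..<N}"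
      then have "j \<le> m" using m by simp
      have "norm (hinner H (fold T (?w j) (h m)) (fold T (?w j) c))
          \<le> hnorm H (fold T (?w j) (h m)) * hnorm H (fold T (?w j) c)"
        using h c by (intro Cauchy_Schwarz fold_T_closed)
      also have "\<dots> \<le> hnorm H (fold T (replicate (Suc m - j) b) a) * hnorm H c"
        using tail[OF \<open>j \<le> m\<close>] h c a hnorm_fold_T_le[of c "?w j"] by (intro mult_mono hnorm_nonneg fold_T_closed)
      finally show "norm (hinner H (fold T (?w j) (h m)) (fold T (?w j) c))
          \<le> hnorm H (fold T (replicate (Suc m - j) b) a) * hnorm H c" .
    qed
    also have "\<dots> < e / 2" using M m by simp
    finally have 1: "norm (\<Sum>j<N. hinner H (fold T (?w j) (h m)) (fold T (?w j) c)) < e / 2" .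
    have "norm (hinner H (fold T (replicate N (\<not> b)) (h m)) (fold T (replicate N (\<not> b)) c))
        \<le> hnorm H (fold T (replicate N (\<not> b)) (h m)) * hnorm H (fold T (replicate N (\<not> b)) c)"
      using h c by (intro Cauchy_Schwarz fold_T_closed)
    also have "\<dots> \<le> B * hnorm H (fold T (replicate N (\<not> b)) c)"
      using order_trans[OF hnorm_fold_T_le[OF h(1)] h(2)] c
      by (intro mult_right_mono) simp_all
    also have "\<dots> < e / 2" by (rule N)
    finally show "norm (hinner H (h m) c - 0) < e"
      unfolding comb_parseval[OF h(1) c(1), where n = N and b = b] diff_0_right
      using 1 by (intro norm_triangle_lt) simp
  qed
qed

end

text \<open>
  The elements \<open>g m\<close> act as the powers of \<open>x\<^sub>0\<close> (or of its inverse, depending on \<open>b\<close>) inside the cone of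
  \<open>w\<close> and trivially outside.
\<close>

definition cone_translations :: "bool list \<Rightarrow> bool \<Rightarrow> (nat \<Rightarrow> bool stream \<Rightarrow> bool stream) \<Rightarrow> bool" where
  "cone_translations w b g \<longleftrightarrow> (\<forall>m. g m \<in> thompson_F \<and> (\<forall>v\<in>set (siblings w). maps_cone (g m) v v) \<and>
     (\<forall>j\<le>Suc m. maps_cone (g m)
        (w @ (if j = 0 then replicate (Suc m) b else replicate (Suc m - j) b @ [\<not> b]))
        (w @ (if j = Suc m then replicate (Suc m) (\<not> b) else replicate j (\<not> b) @ [b]))))"

lemma cone_translations_exist: obtains g where "cone_translations w b g"
proof -
  have "\<exists>g. g \<in> thompson_F \<and> (\<forall>v\<in>set (siblings w). maps_cone g v v) \<and>
     (\<forall>j\<le>Suc m. maps_cone g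
        (w @ (if j = 0 then replicate (Suc m) b else replicate (Suc m - j) b @ [\<not> b]))
        (w @ (if j = Suc m then replicate (Suc m) (\<not> b) else replicate j (\<not> b) @ [b])))" for m
    using local_translation_in_F[of "Suc m" w b] by (metis zero_less_Suc)
  then show ?thesis using that unfolding cone_translations_def by metis
qed

lemma thompson_F_subset_V: "thompson_F \<subseteq> thompson_V"
  using thompson_F_subset_T thompson_T_subset_V by blast

context cuntz_system
begin

lemma fold_T_cone_translation:
  assumes g: "cone_translations w b g" and x: "x \<in> carrier H" and j: "j \<le> Suc m"
  shows "fold T (if j = Suc m then replicate (Suc m) (\<not> b) else replicate j (\<not> b) @ [b]) (fold T w (V_op H S (g m) x))
    = fold T (if j = 0 then replicate (Suc m) b else replicate (Suc m - j) b @ [\<not> b]) (fold T w x)"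
proof -
  have gm: "g m \<in> thompson_V" using g thompson_F_subset_V by (auto simp: cone_translations_def)
  have "maps_cone (g m)
        (w @ (if j = 0 then replicate (Suc m) b else replicate (Suc m - j) b @ [\<not> b]))
        (w @ (if j = Suc m then replicate (Suc m) (\<not> b) else replicate j (\<not> b) @ [b]))"
    using g j unfolding cone_translations_def by blast
  from fold_T_V_op[OF gm x this] show ?thesis by (simp only: fold_append comp_apply)
qed

text \<open>
  The operators of \<open>g m\<close> tend weakly to \<open>1 - S\<^sub>w T\<^sub>w\<close>: they do not affect the components off the branch
  \<open>w\<close>, and the component at \<open>w\<close> tends weakly to \<open>0\<close>.
\<close>

lemma cone_translations_weak_limit:
  assumes g: "cone_translations w b g" and van: "\<And>x. x \<in> carrier H \<Longrightarrow> vanishing x"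
    and x: "x \<in> carrier H" and z: "z \<in> carrier H"
  shows "(\<lambda>m. hinner H (V_op H S (g m) x) z) \<longlonglongrightarrow> hinner H x z - hinner H (fold T w x) (fold T w z)"
proof -
  have gm: "g m \<in> thompson_V" for m using g thompson_F_subset_V by (auto simp: cone_translations_def)
  let ?y = "\<lambda>m. V_op H S (g m) x"
  have y: "?y m \<in> carrier H" for m using gm x by (rule V_op_closed)
  have "(\<lambda>m. hinner H (fold T w (?y m)) (fold T w z)) \<longlonglongrightarrow> 0"
  proof (rule weak_null_if_translated[of "fold T w x" _ _ "hnorm H x" b])
    fix m
    show "hnorm H (fold T w (?y m)) \<le> hnorm H x"
      using hnorm_fold_T_le[OF y, of w m] by (simp add: hnorm_V_op[OF gm x])
    fix j assume "j \<le> m"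
    then show "fold T (replicate j (\<not> b) @ [b]) (fold T w (?y m))
      = fold T (if j = 0 then replicate (Suc m) b else replicate (Suc m - j) b @ [\<not> b]) (fold T w x)"
      using fold_T_cone_translation[OF g x, of j m] by (simp del: replicate.simps)
  qed (use x y z van in simp_all)
  then have "(\<lambda>m. hinner H x z - hinner H (fold T w x) (fold T w z) + hinner H (fold T w (?y m)) (fold T w z))
      \<longlonglongrightarrow> hinner H x z - hinner H (fold T w x) (fold T w z) + 0"
    by (intro tendsto_add tendsto_const)
  moreover have "hinner H x z - hinner H (fold T w x) (fold T w z) + hinner H (fold T w (?y m)) (fold T w z)
      = hinner H (?y m) z" for m
  proof -
    have "fold T v (?y m) = fold T v x" if "v \<in> set (siblings w)" for v
      using g that by (intro fold_T_V_op gm x) (auto simp: cone_translations_def)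
    from sibling_inner_difference[OF x y z this] show ?thesis by (simp add: algebra_simps)
  qed
  ultimately show ?thesis by simp
qed

end

text \<open>
  The weak limits show that \<open>U\<close> preserves \<open>\<langle>T\<^sub>w y, T\<^sub>w z\<rangle>\<close> for every word \<open>w\<close>. If some element of \<open>F\<close> maps the
  cone of \<open>u\<close> onto the cone of \<open>u'\<close>, then \<open>U\<close> preserves \<open>\<langle>T\<^sub>u x, T\<^bsub>u'\<^esub> z\<rangle>\<close> as well. Finally \<open>\<langle>T\<^sub>b x, z\<rangle>\<close>
  is expanded along a comb. All terms but the last one are preserved by \<open>shift_in_F\<close>, and the last
  one tends to \<open>0\<close> since \<open>z\<close> and \<open>U z\<close> are vanishing.
\<close>

theorem (in cuntz_pair) F_intertwiner_intertwines_T: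
  assumes vanH: "\<And>x. x \<in> carrier H \<Longrightarrow> H.vanishing x" and vanK: "\<And>x. x \<in> carrier K \<Longrightarrow> K.vanishing x"
    and int: "\<And>v x. \<lbrakk>v \<in> thompson_F; x \<in> carrier H\<rbrakk> \<Longrightarrow> U (V_op H S v x) = V_op K S' v (U x)"
    and x: "x \<in> carrier H"
  shows "U (T b x) = T' b (U x)"
proof -
  have cone: "hinner H (fold T w y) (fold T w z) = hinner K (fold T' w (U y)) (fold T' w (U z))"
    if y: "y \<in> carrier H" and z: "z \<in> carrier H" for w y z
  proof -
    obtain g where g: "cone_translations w False g" by (rule cone_translations_exist)
    then have gm: "g m \<in> thompson_F" for m by (simp add: cone_translations_def)
    have "(\<lambda>m. hinner H (V_op H S (g m) y) z) \<longlonglongrightarrow> hinner H y z - hinner H (fold T w y) (fold T w z)"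
      using H.cone_translations_weak_limit[OF g vanH y z] .
    moreover have "(\<lambda>m. hinner K (V_op K S' (g m) (U y)) (U z)) \<longlonglongrightarrow>
        hinner K (U y) (U z) - hinner K (fold T' w (U y)) (fold T' w (U z))"
      using y z by (intro K.cone_translations_weak_limit[OF g vanK]) simp_all
    moreover have "hinner K (V_op K S' (g m) (U y)) (U z) = hinner H (V_op H S (g m) y) z" for m
      using y z int[OF gm y, of m] H.V_op_closed[of "g m" y] gm[of m] thompson_F_subset_V
        U_inner[of "V_op H S (g m) y" z] by auto
    ultimately have "hinner H y z - hinner H (fold T w y) (fold T w z)
        = hinner K (U y) (U z) - hinner K (fold T' w (U y)) (fold T' w (U z))"
      using LIMSEQ_unique by auto
    then show ?thesis using y z by (simp add: U_inner)
  qed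
  have cones: "hinner H (fold T u x) (fold T u' z) = hinner K (fold T' u (U x)) (fold T' u' (U z))"
    if f: "f \<in> thompson_F" "maps_cone f u u'" and z: "z \<in> carrier H" for f u u' z
  proof -
    have f': "f \<in> thompson_V" using f thompson_F_subset_V by blast
    have "hinner H (fold T u x) (fold T u' z) = hinner H (fold T u' (V_op H S f x)) (fold T u' z)"
      using H.fold_T_V_op[OF f' x f(2)] by simp
    also have "\<dots> = hinner K (fold T' u' (V_op K S' f (U x))) (fold T' u' (U z))"
      using H.V_op_closed[OF f' x] z by (simp add: cone int[OF f(1) x])
    also have "\<dots> = hinner K (fold T' u (U x)) (fold T' u' (U z))"
      using K.fold_T_V_op[OF f' U_closed[OF x] f(2)] by simp
    finally show ?thesis .
  qed
  show ?thesis
  proof (rule U_eqI)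
    fix z assume z: "z \<in> carrier H"
    let ?r = "\<lambda>n. replicate n (\<not> b)"
    \<comment> \<open>the remainder of the comb expansion bounds \<open>?d\<close> for every \<open>n\<close>\<close>
    let ?d = "hinner H (T b x) z - hinner K (T' b (U x)) (U z)"
    let ?t = "\<lambda>n. hnorm H x * hnorm H (fold T (?r n) z) + hnorm K (U x) * hnorm K (fold T' (?r n) (U z))"
    have "?t \<longlonglongrightarrow> hnorm H x * 0 + hnorm K (U x) * 0"
      using vanH[OF z] vanK[of "U z"] z unfolding H.vanishing_def K.vanishing_def by (intro tendsto_intros) auto
    moreover have "norm ?d \<le> ?t n" for n
    proof -
      obtain f where f: "f \<in> thompson_F"
        "\<And>k. k < n \<Longrightarrow> maps_cone f (b # ?r k @ [b]) (?r k @ [b])"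
        using shift_in_F[of n b] by blast
      have "hinner H (fold T (?r k @ [b]) (T b x)) (fold T (?r k @ [b]) z)
          = hinner K (fold T' (?r k @ [b]) (T' b (U x))) (fold T' (?r k @ [b]) (U z))" if "k < n" for k
        using cones[OF f(1) f(2)[OF that] z] by simp
      then have "?d = hinner H (fold T (?r n) (T b x)) (fold T (?r n) z)
          - hinner K (fold T' (?r n) (T' b (U x))) (fold T' (?r n) (U z))"
        using x z H.comb_parseval[of "T b x" z, where n = n and b = b] K.comb_parseval[of "T' b (U x)" "U z", where n = n and b = b] by simp
      also have "norm \<dots> \<le> hnorm H (fold T (?r n) (T b x)) * hnorm H (fold T (?r n) z)
          + hnorm K (fold T' (?r n) (T' b (U x))) * hnorm K (fold T' (?r n) (U z))"
        using x z by (intro order_trans[OF norm_triangle_ineq4] add_mono H.Cauchy_Schwarz K.Cauchy_Schwarz) simp_all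
      also have "\<dots> \<le> ?t n"
        using H.hnorm_fold_T_le[of x "b # ?r n"] K.hnorm_fold_T_le[of "U x" "b # ?r n"] x z
        by (intro add_mono mult_right_mono) simp_all
      finally show ?thesis .
    qed
    ultimately have "(\<lambda>n::nat. norm ?d) \<longlonglongrightarrow> 0" by (rule_tac squeeze_zero[of ?t]) simp_all
    then have "?d = 0" by (simp add: LIMSEQ_const_iff)
    then show "hinner K (U (T b x)) (U z) = hinner K (T' b (U x)) (U z)"
      using x z by (simp add: U_inner)
  qed (use x in simp_all)
qed

section \<open>Finite dimensional subspaces\<close>

lemma bounded_real_convergent_subseq:
  fixes f :: "nat \<Rightarrow> real"
  assumes "\<And>n. \<bar>f n\<bar> \<le> B"
  obtains r where "strict_mono r" "convergent (\<lambda>n. f (r n))"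
proof -
  obtain r where r: "strict_mono r" "monoseq (\<lambda>n. f (r n))" using seq_monosub[of f] by blast
  moreover have "Bseq (\<lambda>n. f (r n))" using assms by (intro BseqI'[of _ B]) simp
  ultimately show ?thesis using that Bseq_monoseq_convergent by blast
qed

lemma bounded_complex_convergent_subseq:
  fixes f :: "nat \<Rightarrow> complex"
  assumes B: "\<And>n. cmod (f n) \<le> B"
  obtains r where "strict_mono r" "convergent (\<lambda>n. f (r n))"
proof -
  obtain r where r: "strict_mono r" "convergent (\<lambda>n. Re (f (r n)))"
    using bounded_real_convergent_subseq[of "\<lambda>n. Re (f n)" B] abs_Re_le_cmod B order_trans by blast
  obtain s where s: "strict_mono s" "convergent (\<lambda>n. Im (f (r (s n))))"
    using bounded_real_convergent_subseq[of "\<lambda>n. Im (f (r n))" B] abs_Im_le_cmod B order_trans by blast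
  obtain a b where a: "(\<lambda>n. Re (f (r n))) \<longlonglongrightarrow> a" and b: "(\<lambda>n. Im (f (r (s n)))) \<longlonglongrightarrow> b"
    using r(2) s(2) by (auto simp: convergent_def)
  have "(\<lambda>n. Re (f (r (s n)))) \<longlonglongrightarrow> a"
    using LIMSEQ_subseq_LIMSEQ[OF a s(1)] by (simp add: o_def)
  with b have "(\<lambda>n. Complex (Re (f (r (s n)))) (Im (f (r (s n))))) \<longlonglongrightarrow> Complex a b"
    by (intro tendsto_Complex)
  then have "convergent (\<lambda>n. f ((r \<circ> s) n))" by (auto simp: convergent_def)
  moreover have "strict_mono (r \<circ> s)" using r(1) s(1) by (rule strict_mono_o)
  ultimately show ?thesis using that by blast
qed

lemma finitely_many_convergent_subseq:
  fixes f :: "nat \<Rightarrow> nat \<Rightarrow> complex"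
  assumes B: "\<And>i k. i < n \<Longrightarrow> cmod (f i k) \<le> B"
  obtains r where "strict_mono r" "\<And>i. i < n \<Longrightarrow> convergent (\<lambda>k. f i (r k))"
proof -
  have "\<exists>r. strict_mono r \<and> (\<forall>i<n. convergent (\<lambda>k. f i (r k)))" using B
  proof (induction n)
    case 0
    have "strict_mono (\<lambda>k::nat. k)" by (simp add: strict_mono_def)
    then show ?case by auto
  next
    case (Suc n)
    then obtain r where r: "strict_mono r" "\<forall>i<n. convergent (\<lambda>k. f i (r k))" by auto
    obtain s where s: "strict_mono s" "convergent (\<lambda>k. f n (r (s k)))"
      using bounded_complex_convergent_subseq[of "\<lambda>k. f n (r k)" B] Suc.prems by auto
    have "convergent (\<lambda>k. f i ((r \<circ> s) k))" if "i < Suc n" for i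
    proof (cases "i = n")
      case False
      then have "convergent (\<lambda>k. f i (r k))" using that r(2) by simp
      then obtain l where "(\<lambda>k. f i (r k)) \<longlonglongrightarrow> l" by (auto simp: convergent_def)
      from LIMSEQ_subseq_LIMSEQ[OF this s(1)] show ?thesis by (auto simp: o_def convergent_def)
    qed (use s in simp)
    moreover have "strict_mono (r \<circ> s)" using r(1) s(1) by (rule strict_mono_o)
    ultimately show ?case by blast
  qed
  then show ?thesis using that by blast
qed

context inner_product_space
begin

definition subspace :: "'a set \<Rightarrow> bool" where
  "subspace V \<longleftrightarrow> V \<subseteq> carrier H \<and> \<zero> \<in> V \<and> (\<forall>x\<in>V. \<forall>y\<in>V. x \<oplus> y \<in> V) \<and> (\<forall>c. \<forall>x\<in>V. c \<odot> x \<in> V)"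

lemma subspaceD:
  assumes "subspace V"
  shows "x \<in> V \<Longrightarrow> x \<in> carrier H" "\<zero> \<in> V" "\<lbrakk>x \<in> V; y \<in> V\<rbrakk> \<Longrightarrow> x \<oplus> y \<in> V" "x \<in> V \<Longrightarrow> c \<odot> x \<in> V"
  using assms by (auto simp: subspace_def)

lemma subspace_minus:
  assumes V: "subspace V" and "x \<in> V" "y \<in> V"
  shows "x \<ominus> y \<in> V"
proof -
  have "x \<ominus> y = x \<oplus> (-1) \<odot> y"
    using assms subspaceD(1)[OF V] by (intro hinner_eqI) (simp_all add: hinner_left)
  then show ?thesis using assms by (simp add: subspaceD[OF V])
qed

lemma subspace_finsum:
  assumes V: "subspace V" and "finite I" "\<And>i. i \<in> I \<Longrightarrow> f i \<in> V"
  shows "(\<Oplus>i\<in>I. f i) \<in> V"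
  using assms(2,3)
proof (induction I)
  case (insert i I)
  then have "f \<in> I \<rightarrow> carrier H" "f i \<in> carrier H" using subspaceD(1)[OF V] by auto
  with insert show ?case by (simp add: subspaceD[OF V])
qed (simp add: subspaceD[OF V])

definition orthonormal :: "(nat \<Rightarrow> 'a) \<Rightarrow> nat \<Rightarrow> bool" where
  "orthonormal e n \<longleftrightarrow> (\<forall>i<n. e i \<in> carrier H) \<and>
     (\<forall>i<n. \<forall>j<n. hinner H (e i) (e j) = (if i = j then 1 else 0))"

text \<open>
  The orthogonal projection onto the span of an orthonormal family.
\<close>

definition proj :: "(nat \<Rightarrow> 'a) \<Rightarrow> nat \<Rightarrow> 'a \<Rightarrow> 'a" where
  "proj e n x = (\<Oplus>i\<in>{..<n}. hinner H x (e i) \<odot> e i)"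

definition onb :: "'a set \<Rightarrow> (nat \<Rightarrow> 'a) \<Rightarrow> nat \<Rightarrow> bool" where
  "onb V e n \<longleftrightarrow> subspace V \<and> orthonormal e n \<and> (\<forall>i<n. e i \<in> V) \<and> (\<forall>x\<in>V. proj e n x = x)"

lemma onbD:
  assumes "onb V e n"
  shows "subspace V" "orthonormal e n" "i < n \<Longrightarrow> e i \<in> V" "x \<in> V \<Longrightarrow> proj e n x = x"
  using assms by (auto simp: onb_def)

context
  fixes e n assumes e: "orthonormal e n"
begin

lemma orthonormal_closed: "i < n \<Longrightarrow> e i \<in> carrier H"
  using e by (simp add: orthonormal_def)

lemma orthonormal_inner: "\<lbrakk>i < n; j < n\<rbrakk> \<Longrightarrow> hinner H (e i) (e j) = (if i = j then 1 else 0)"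
  using e by (simp add: orthonormal_def)

lemma proj_closed [simp]: "proj e n x \<in> carrier H"
  unfolding proj_def by (intro M.finsum_closed) (auto simp: orthonormal_closed)

lemma hinner_proj_left: "z \<in> carrier H \<Longrightarrow> hinner H (proj e n x) z = (\<Sum>i<n. hinner H x (e i) * hinner H (e i) z)"
  unfolding proj_def by (subst hinner_finsum_left) (auto simp: orthonormal_closed hinner_left)

lemma hinner_proj_basis: "j < n \<Longrightarrow> hinner H (proj e n x) (e j) = hinner H x (e j)"
  by (simp add: hinner_proj_left orthonormal_closed orthonormal_inner if_distrib[of "(*) _"] sum.delta cong: if_cong)

lemma linear_proj: "linear_op H H (proj e n)"
  unfolding linear_op_def
  by (auto intro!: hinner_eqI simp: hinner_left hinner_proj_left orthonormal_closed
      distrib_right sum.distrib sum_distrib_left mult.assoc)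

lemma hnorm_proj: "x \<in> carrier H \<Longrightarrow> (hnorm H (proj e n x))\<^sup>2 = (\<Sum>i<n. (cmod (hinner H x (e i)))\<^sup>2)"
proof -
  assume x: "x \<in> carrier H"
  have "hinner H (proj e n x) (proj e n x) = (\<Sum>i<n. hinner H x (e i) * cnj (hinner H x (e i)))"
    by (subst hinner_proj_left) (simp_all add: hinner_commute[of "proj e n x" "e i" for i] orthonormal_closed hinner_proj_basis)
  also have "\<dots> = of_real (\<Sum>i<n. (cmod (hinner H x (e i)))\<^sup>2)"
    by (simp add: complex_norm_square[symmetric])
  finally show ?thesis by (simp add: hnorm_power2 del: of_real_sum)
qed

lemma hnorm_minus_proj:
  "x \<in> carrier H \<Longrightarrow> (hnorm H (x \<ominus> proj e n x))\<^sup>2 = (hnorm H x)\<^sup>2 - (hnorm H (proj e n x))\<^sup>2"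
proof -
  assume x: "x \<in> carrier H"
  have "hinner H (proj e n x) x = (\<Sum>i<n. hinner H x (e i) * cnj (hinner H x (e i)))"
    using x by (simp add: hinner_proj_left hinner_commute[of x "e i" for i] orthonormal_closed)
  also have "\<dots> = of_real (\<Sum>i<n. (cmod (hinner H x (e i)))\<^sup>2)"
    by (simp add: complex_norm_square[symmetric])
  finally have "hinner H (proj e n x) x = of_real ((hnorm H (proj e n x))\<^sup>2)"
    by (simp only: hnorm_proj[OF x])
  then have "Re (hinner H x (proj e n x)) = (hnorm H (proj e n x))\<^sup>2"
    using x hinner_commute[of "proj e n x" x] by simp
  then show ?thesis using x by (simp add: hnorm_minus_power2)
qed

lemma hnorm_minus_proj_le: "x \<in> carrier H \<Longrightarrow> hnorm H (x \<ominus> proj e n x) \<le> hnorm H x"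
  by (rule power2_le_imp_le) (simp_all add: hnorm_minus_proj)

lemma Bessel: "x \<in> carrier H \<Longrightarrow> (\<Sum>i<n. (cmod (hinner H x (e i)))\<^sup>2) \<le> (hnorm H x)\<^sup>2"
  using hnorm_minus_proj[of x] zero_le_power2[of "hnorm H (x \<ominus> proj e n x)"] by (simp add: hnorm_proj)

lemma hinner_minus_proj: "\<lbrakk>x \<in> carrier H; j < n\<rbrakk> \<Longrightarrow> hinner H (x \<ominus> proj e n x) (e j) = 0"
  by (simp add: hinner_left orthonormal_closed hinner_proj_basis)

lemma proj_in_subspace: "\<lbrakk>subspace V; \<And>i. i < n \<Longrightarrow> e i \<in> V\<rbrakk> \<Longrightarrow> proj e n x \<in> V"
  unfolding proj_def by (intro subspace_finsum) (auto intro: subspaceD)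

end

lemma onb_hnorm:
  assumes "onb V e n" "x \<in> V"
  shows "(hnorm H x)\<^sup>2 = (\<Sum>i<n. (cmod (hinner H x (e i)))\<^sup>2)"
  using hnorm_proj[OF onbD(2)[OF assms(1)], of x] assms subspaceD(1)[OF onbD(1)[OF assms(1)]]
  by (simp add: onbD)

lemma best_approximation:
  assumes V: "onb V e n" and x: "x \<in> carrier H" and y: "y \<in> V"
  shows "hnorm H (x \<ominus> proj e n x) \<le> hnorm H (x \<ominus> y)"
proof -
  note [simp] = proj_closed[OF onbD(2)[OF V]]
  have y': "y \<in> carrier H" using V y by (auto dest: onbD(1) subspaceD(1))
  have "proj e n (x \<ominus> y) = proj e n x \<ominus> y"
    using linear_op_minus[OF inner_product_space_axioms inner_product_space_axioms linear_proj[OF onbD(2)[OF V]] x y']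
    by (simp add: onbD(4)[OF V y])
  then have "x \<ominus> proj e n x = (x \<ominus> y) \<ominus> proj e n (x \<ominus> y)"
    using x y' by (intro hinner_eqI) (simp_all add: hinner_left)
  then show ?thesis using x y' hnorm_minus_proj_le[OF onbD(2)[OF V], of "x \<ominus> y"] by simp
qed

lemma orthonormal_size_le:
  assumes W: "onb W b n" and f: "orthonormal f m" and fW: "\<And>i. i < m \<Longrightarrow> f i \<in> W"
  shows "m \<le> n"
proof -
  note b = onbD(2)[OF W]
  have "real m = (\<Sum>i<m. (hnorm H (f i))\<^sup>2)"
    by (simp add: hnorm_power2 orthonormal_closed[OF f] orthonormal_inner[OF f])
  also have "\<dots> = (\<Sum>i<m. \<Sum>j<n. (cmod (hinner H (f i) (b j)))\<^sup>2)"
    using onb_hnorm[OF W fW] by simp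
  also have "\<dots> = (\<Sum>j<n. \<Sum>i<m. (cmod (hinner H (b j) (f i)))\<^sup>2)"
  proof (subst sum.swap, intro sum.cong refl)
    fix i j assume "j \<in> {..<n}" "i \<in> {..<m}"
    then show "(cmod (hinner H (f i) (b j)))\<^sup>2 = (cmod (hinner H (b j) (f i)))\<^sup>2"
      using hinner_commute[of "f i" "b j"] orthonormal_closed[OF f] orthonormal_closed[OF b] by simp
  qed
  also have "\<dots> \<le> (\<Sum>j<n. (hnorm H (b j))\<^sup>2)"
    by (intro sum_mono Bessel[OF f]) (simp add: orthonormal_closed[OF b])
  also have "\<dots> = real n"
    by (simp add: hnorm_power2 orthonormal_closed[OF b] orthonormal_inner[OF b])
  finally show ?thesis by simp
qed

text \<open>
  An orthonormal family in \<open>V\<close> of maximal size is a basis, since otherwise a vector minus its projection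
  could be normalized and added to the family.
\<close>

lemma onb_exists:
  assumes V: "subspace V" and bound: "\<And>f m. \<lbrakk>orthonormal f m; \<And>i. i < m \<Longrightarrow> f i \<in> V\<rbrakk> \<Longrightarrow> m \<le> n"
  obtains e m where "onb V e m"
proof -
  define P where "P m \<longleftrightarrow> (\<exists>f. orthonormal f m \<and> (\<forall>i<m. f i \<in> V))" for m
  have "P 0" by (auto simp: P_def orthonormal_def)
  moreover have "\<forall>m. P m \<longrightarrow> m \<le> n" using bound by (auto simp: P_def)
  ultimately have "P (Greatest P)" "\<And>m. P m \<Longrightarrow> m \<le> Greatest P"
    by (blast intro: GreatestI_nat Greatest_le_nat)+
  then obtain m e where m: "orthonormal e m" "\<And>i. i < m \<Longrightarrow> e i \<in> V" and max: "\<And>m'. P m' \<Longrightarrow> m' \<le> m"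
    by (auto simp: P_def)
  have "proj e m x = x" if x: "x \<in> V" for x
  proof (rule ccontr)
    assume neq: "proj e m x \<noteq> x"
    define r where "r = x \<ominus> proj e m x"
    have x': "x \<in> carrier H" using V x by (rule subspaceD)
    note [simp] = proj_closed[OF m(1)]
    have r: "r \<in> V" "r \<in> carrier H"
      using V x x' proj_in_subspace[OF m(1) V m(2)] by (simp_all add: r_def subspace_minus)
    have "hnorm H r \<noteq> 0"
      using neq x' hnorm_eq_zero[OF r(2)] minus_eq_zeroD[of x "proj e m x"] by (auto simp: r_def)
    define u where "u = of_real (1 / hnorm H r) \<odot> r"
    have u: "u \<in> V" "u \<in> carrier H" using r V by (simp_all add: u_def subspaceD)
    have uu: "hinner H u u = 1"
      using r \<open>hnorm H r \<noteq> 0\<close> by (simp add: u_def hinner_self hnorm_smult norm_divide)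
    have ue: "hinner H u (e i) = 0" "hinner H (e i) u = 0" if "i < m" for i
    proof -
      show 1: "hinner H u (e i) = 0"
        using that r hinner_minus_proj[OF m(1) x' that] by (simp add: u_def r_def hinner_left orthonormal_closed[OF m(1)])
      show "hinner H (e i) u = 0"
        using 1 hinner_commute[of u "e i"] u that by (simp add: orthonormal_closed[OF m(1)])
    qed
    have "orthonormal (e(m := u)) (Suc m)"
      unfolding orthonormal_def
      using u uu ue orthonormal_closed[OF m(1)] orthonormal_inner[OF m(1)] by (auto simp: less_Suc_eq)
    moreover have "\<forall>i<Suc m. (e(m := u)) i \<in> V" using u m(2) by (auto simp: less_Suc_eq)
    ultimately have "P (Suc m)" unfolding P_def by blast
    then show False using max by fastforce
  qed
  then have "onb V e m" using V m by (simp add: onb_def)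
  then show ?thesis by (rule that)
qed

lemma subspace_onb_exists:
  assumes W: "onb W b n" and V: "subspace V" "V \<subseteq> W"
  obtains e m where "onb V e m"
  by (rule onb_exists[OF V(1), of n]) (use orthonormal_size_le[OF W] V(2) in blast)+

lemma bounded_sequence_convergent_subseq:
  fixes x :: "nat \<Rightarrow> 'a"
  assumes V: "onb V e n" and x: "\<And>k. x k \<in> V" "\<And>k. hnorm H (x k) \<le> B"
  obtains r y where "strict_mono r" "y \<in> V" "hlim H (\<lambda>k. x (r k)) y"
proof -
  note e = onbD(2)[OF V] and VH = subspaceD(1)[OF onbD(1)[OF V]]
  have xH [simp]: "x k \<in> carrier H" for k using x(1) VH by blast
  have bd: "cmod (hinner H (x k) (e i)) \<le> B" if "i < n" for i k
  proof -
    have "cmod (hinner H (x k) (e i)) \<le> hnorm H (x k) * hnorm H (e i)"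
      using that by (intro Cauchy_Schwarz orthonormal_closed[OF e] xH)
    also have "hnorm H (e i) = 1" using that by (simp add: hnorm_def orthonormal_inner[OF e])
    finally show ?thesis using x(2)[of k] by simp
  qed
  then obtain r where r: "strict_mono r" "\<And>i. i < n \<Longrightarrow> convergent (\<lambda>k. hinner H (x (r k)) (e i))"
    using finitely_many_convergent_subseq[of n "\<lambda>i k. hinner H (x k) (e i)" B] by blast
  then obtain c where c: "\<And>i. i < n \<Longrightarrow> (\<lambda>k. hinner H (x (r k)) (e i)) \<longlonglongrightarrow> c i"
    unfolding convergent_def by metis
  define y where "y = (\<Oplus>i\<in>{..<n}. c i \<odot> e i)"
  have y: "y \<in> V" unfolding y_def
    using onbD(1,3)[OF V] by (intro subspace_finsum) (auto intro: subspaceD)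
  have yi: "hinner H y (e i) = c i" if "i < n" for i
    unfolding y_def using that
    by (subst hinner_finsum_left) (auto simp: orthonormal_closed[OF e] hinner_left orthonormal_inner[OF e]
        if_distrib[of "(*) _"] sum.delta' cong: if_cong)
  have "(\<lambda>k. (\<Sum>i<n. (cmod (hinner H (x (r k)) (e i) - c i))\<^sup>2)) \<longlonglongrightarrow> (\<Sum>i<n. (cmod (c i - c i))\<^sup>2)"
    using c by (intro tendsto_intros) auto
  moreover have "(\<Sum>i<n. (cmod (hinner H (x (r k)) (e i) - c i))\<^sup>2) = (hnorm H (x (r k) \<ominus> y))\<^sup>2" for k
    using x y VH by (subst onb_hnorm[OF V]) (auto simp: subspace_minus[OF onbD(1)[OF V]] hinner_left yi orthonormal_closed[OF e])
  ultimately have "(\<lambda>k. (hnorm H (x (r k) \<ominus> y))\<^sup>2) \<longlonglongrightarrow> 0" by simp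
  then have "(\<lambda>k. sqrt ((hnorm H (x (r k) \<ominus> y))\<^sup>2)) \<longlonglongrightarrow> sqrt 0" by (intro tendsto_intros)
  then have "hlim H (\<lambda>k. x (r k)) y" using x y VH by (simp add: hlim_def)
  with r(1) y show ?thesis using that by blast
qed

text \<open>
  The distance to the kernel of a linear map on a finite dimensional space is bounded by a multiple of
  the norm of the image. Otherwise there are unit vectors orthogonal to the kernel with images tending
  to \<open>0\<close>. By compactness they accumulate at a unit vector which is orthogonal to the kernel and lies
  in it.
\<close>

lemma kernel_distance_bound:
  assumes W: "onb W b n" and R: "linear_op H H R" "\<And>x. x \<in> carrier H \<Longrightarrow> hnorm H (R x) \<le> hnorm H x"
  obtains C where "C \<ge> 0" "\<And>x. x \<in> W \<Longrightarrow> \<exists>y\<in>W. R y = \<zero> \<and> hnorm H (x \<ominus> y) \<le> C * hnorm H (R x)"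
proof -
  note WH = subspaceD(1)[OF onbD(1)[OF W]]
  note R_closed [simp] = linear_opD(1)[OF R(1)]
  note R_minus = linear_op_minus[OF inner_product_space_axioms inner_product_space_axioms R(1)]
  note R_zero = linear_op_zero[OF inner_product_space_axioms inner_product_space_axioms R(1)]
  define L where "L = {x \<in> W. R x = \<zero>}"
  have "subspace L"
    unfolding subspace_def L_def using onbD(1)[OF W] WH
    by (auto simp: R_zero subspaceD linear_opD[OF R(1)] intro!: hinner_eqI)
  then obtain l m where L: "onb L l m"
    using subspace_onb_exists[OF W, of L] by (auto simp: L_def)
  note l = onbD(2)[OF L]
  note [simp] = proj_closed[OF l]
  have proj_L: "proj l m x \<in> L" for x
    using onbD[OF L] by (intro proj_in_subspace[OF l]) auto
  have "\<exists>C. \<forall>x\<in>W. hnorm H (x \<ominus> proj l m x) \<le> C * hnorm H (R x)"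
  proof (rule ccontr)
    assume "\<not> ?thesis"
    then have "\<forall>j::nat. \<exists>x\<in>W. real j * hnorm H (R x) < hnorm H (x \<ominus> proj l m x)"
      by (meson not_le)
    then obtain x where x: "\<And>j. x j \<in> W" "\<And>j. real j * hnorm H (R (x j)) < hnorm H (x j \<ominus> proj l m (x j))"
      by metis
    have xH [simp]: "x j \<in> carrier H" for j using x(1) WH by blast
    \<comment> \<open>subtracting the component in the kernel does not change the image\<close>
    define u where "u j = x j \<ominus> proj l m (x j)" for j
    have uH [simp]: "u j \<in> carrier H" for j by (simp add: u_def)
    have uW: "u j \<in> W" for j
      unfolding u_def using x(1) proj_L by (intro subspace_minus onbD(1)[OF W]) (auto simp: L_def)
    have Ru: "R (u j) = R (x j)" for j
    proof -
      have "R (proj l m (x j)) = \<zero>" using proj_L by (simp add: L_def)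
      then show ?thesis by (simp add: u_def R_minus)
    qed
    have u_pos: "hnorm H (u j) > 0" for j
    proof -
      have "0 \<le> real j * hnorm H (R (x j))" by simp
      also have "\<dots> < hnorm H (u j)" unfolding u_def by (rule x(2))
      finally show ?thesis .
    qed
    define v where "v j = of_real (1 / hnorm H (u j)) \<odot> u j" for j
    have vH [simp]: "v j \<in> carrier H" for j by (simp add: v_def)
    have vW: "v j \<in> W" for j using uW onbD(1)[OF W] by (simp add: v_def subspaceD)
    have v1: "hnorm H (v j) = 1" for j using u_pos[of j] by (simp add: v_def hnorm_smult norm_divide)
    have Rv: "real j * hnorm H (R (v j)) \<le> 1" for j
    proof -
      have "hnorm H (R (v j)) = hnorm H (R (x j)) / hnorm H (u j)"
        using u_pos[of j] by (simp add: v_def linear_opD[OF R(1)] hnorm_smult norm_divide Ru)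
      then show ?thesis using x(2)[of j] u_pos[of j] by (simp add: u_def divide_le_eq)
    qed
    obtain r y where r: "strict_mono r" and y: "y \<in> W" and lim: "hlim H (\<lambda>k. v (r k)) y"
      using bounded_sequence_convergent_subseq[OF W, of v 1] vW v1 by auto
    have yH [simp]: "y \<in> carrier H" using y WH by blast
    have y1: "hnorm H y = 1"
      using tendsto_hnorm[OF vH yH lim] v1 by (simp add: LIMSEQ_const_iff)
    have "hinner H y (l i) = 0" if "i < m" for i
    proof -
      have "(\<lambda>k. hinner H (v (r k)) (l i)) \<longlonglongrightarrow> hinner H y (l i)"
        using that by (intro tendsto_hinner lim hlim_const) (simp_all add: orthonormal_closed[OF l])
      moreover have "hinner H (v j) (l i) = 0" for j
        using that hinner_minus_proj[OF l _ that, of "x j"]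
        by (simp add: v_def u_def hinner_left orthonormal_closed[OF l])
      ultimately show ?thesis by (simp add: LIMSEQ_const_iff)
    qed
    then have proj_y: "hnorm H (proj l m y) = 0"
      using hnorm_proj[OF l yH] by simp
    have "R y = \<zero>"
    proof (rule hnorm_eq_zero)
      let ?t = "\<lambda>k. hnorm H (v (r (Suc k)) \<ominus> y) + 1 / real (Suc k)"
      have "?t \<longlonglongrightarrow> 0 + 0"
        using lim[unfolded hlim_def, THEN LIMSEQ_Suc] lim_1_over_n[THEN LIMSEQ_Suc] by (rule tendsto_add)
      moreover have "hnorm H (R y) \<le> ?t k" for k
      proof -
        have "hnorm H (R y) \<le> hnorm H (R (v (r (Suc k)))) + hnorm H (R y \<ominus> R (v (r (Suc k))))"
          by (intro hnorm_triangle_minus) simp_all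
        moreover have "hnorm H (R y \<ominus> R (v (r (Suc k)))) \<le> hnorm H (v (r (Suc k)) \<ominus> y)"
          using R(2)[of "y \<ominus> v (r (Suc k))"] hnorm_minus_commute[of y "v (r (Suc k))"] by (simp add: R_minus)
        moreover have "hnorm H (R (v (r (Suc k)))) \<le> 1 / real (Suc k)"
        proof -
          have "Suc k \<le> r (Suc k)" using seq_suble[OF r] by simp
          then have "real (Suc k) * hnorm H (R (v (r (Suc k)))) \<le> real (r (Suc k)) * hnorm H (R (v (r (Suc k))))"
            by (intro mult_right_mono) simp_all
          also have "\<dots> \<le> 1" by (rule Rv)
          finally show ?thesis by (simp add: pos_le_divide_eq mult.commute)
        qed
        ultimately show ?thesis by simp
      qed
      ultimately have "hnorm H (R y) \<le> 0 + 0" by (intro LIMSEQ_le_const) auto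
      then show "hnorm H (R y) = 0" by (intro antisym) simp_all
    qed simp
    then have "y \<in> L" using y by (simp add: L_def)
    then have "proj l m y = y" using L by (simp add: onbD)
    then show False using y1 proj_y by simp
  qed
  then obtain C where C: "\<And>x. x \<in> W \<Longrightarrow> hnorm H (x \<ominus> proj l m x) \<le> C * hnorm H (R x)" by blast
  show ?thesis
  proof (rule that[of "max C 0"])
    fix x assume x: "x \<in> W"
    have "C * hnorm H (R x) \<le> max C 0 * hnorm H (R x)" using x WH by (intro mult_right_mono) auto
    with C[OF x] have "hnorm H (x \<ominus> proj l m x) \<le> max C 0 * hnorm H (R x)" by simp
    then show "\<exists>y\<in>W. R y = \<zero> \<and> hnorm H (x \<ominus> y) \<le> max C 0 * hnorm H (R x)"
      using proj_L[of x] by (auto simp: L_def)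
  qed simp
qed

end

section \<open>Generating subspaces of finite dimension\<close>

context cuntz_system
begin

lemma T_invariant_fold: "\<lbrakk>T_invariant W; x \<in> W\<rbrakk> \<Longrightarrow> fold T u x \<in> W"
  by (induction u arbitrary: x) (simp_all add: T_invariantD)

lemma hnorm_minus_ev_Node:
  assumes "x \<in> carrier H" "labels l \<subseteq> carrier H" "labels r \<subseteq> carrier H"
  shows "(hnorm H (x \<ominus> ev (Node l r)))\<^sup>2 = (hnorm H (T False x \<ominus> ev l))\<^sup>2 + (hnorm H (T True x \<ominus> ev r))\<^sup>2"
proof -
  have "T i (x \<ominus> ev (Node l r)) = T i x \<ominus> ev (if i then r else l)" for i
    using assms T_ev_Node[OF assms(2,3), of i] by (simp add: T(5) del: ev.simps)
  then show ?thesis using assms hnorm_T[of "x \<ominus> ev (Node l r)"] by (simp del: ev.simps)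
qed

lemma generating_transfer:
  assumes W: "generating W" and V: "V \<subseteq> carrier H"
    and approx: "\<And>x e. \<lbrakk>x \<in> W; e > 0\<rbrakk> \<Longrightarrow> \<exists>t. labels t \<subseteq> V \<and> hnorm H (x \<ominus> ev t) < e"
  shows "generating V"
proof (rule generatingI[OF V])
  have WH: "W \<subseteq> carrier H" using W by (simp add: generating_def)
  have tree: "\<exists>t'. labels t' \<subseteq> V \<and> hnorm H (ev t \<ominus> ev t') < e" if "labels t \<subseteq> W" "e > 0" for t e
    using that
  proof (induction t arbitrary: e)
    case (Leaf x)
    then show ?case using approx by simp
  next
    case (Node l r)
    then obtain l' r' where l': "labels l' \<subseteq> V" "hnorm H (ev l \<ominus> ev l') < e / 2"
      and r': "labels r' \<subseteq> V" "hnorm H (ev r \<ominus> ev r') < e / 2"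
      using Node.IH(1)[of "e / 2"] Node.IH(2)[of "e / 2"] by auto
    have lr: "labels l \<subseteq> carrier H" "labels r \<subseteq> carrier H" "labels l' \<subseteq> carrier H" "labels r' \<subseteq> carrier H"
      using Node.prems WH V l' r' by auto
    note [simp] = ev_closed[OF lr(1)] ev_closed[OF lr(2)] ev_closed[OF lr(3)] ev_closed[OF lr(4)]
    have "(hnorm H (ev (Node l r) \<ominus> ev (Node l' r')))\<^sup>2 = (hnorm H (ev l \<ominus> ev l'))\<^sup>2 + (hnorm H (ev r \<ominus> ev r'))\<^sup>2"
      using hnorm_minus_ev_Node[OF _ lr(3,4), of "ev (Node l r)"] lr(1,2)
      by (simp only: T_ev_Node if_True if_False ev_closed dtree.set Un_subset_iff simp_thms)
    also have "\<dots> < (e / 2)\<^sup>2 + (e / 2)\<^sup>2"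
      using l' r' by (intro add_strict_mono power_strict_mono) simp_all
    also have "\<dots> \<le> e\<^sup>2" by (simp add: power2_eq_square field_simps)
    finally have "hnorm H (ev (Node l r) \<ominus> ev (Node l' r')) < e"
      using Node.prems(2) by (intro power2_less_imp_less[of _ e]) simp_all
    moreover have "labels (Node l' r') \<subseteq> V" using l' r' by simp
    ultimately show ?case by blast
  qed
  fix x and e :: real assume x: "x \<in> carrier H" and e: "e > 0"
  then obtain t where t: "labels t \<subseteq> W" "hnorm H (x \<ominus> ev t) < e / 2"
    using generatingD[OF W x, of "e / 2"] by auto
  obtain t' where t': "labels t' \<subseteq> V" "hnorm H (ev t \<ominus> ev t') < e / 2"
    using tree[OF t(1), of "e / 2"] e by auto
  have "ev t \<in> carrier H" "ev t' \<in> carrier H" using t t' WH V by (auto intro!: ev_closed)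
  then have "hnorm H (x \<ominus> ev t') < e"
    using hnorm_minus_triangle[of x "ev t" "ev t'"] t t' x by simp
  then show "\<exists>t. labels t \<subseteq> V \<and> hnorm H (x \<ominus> ev t) < e" using t' by blast
qed

text \<open>
  Let \<open>R x\<close> be the component of \<open>p x\<close> orthogonal to \<open>W\<close>. Its kernel in \<open>W\<close> is \<open>L = {x \<in> W. p x \<in> W}\<close>, so
  every \<open>h \<in> W\<close> has a vector of \<open>L\<close> at distance at most \<open>C \<parallel>R h\<parallel>\<close>, and \<open>\<parallel>R h\<parallel>\<close> is at most the distance of
  \<open>p h\<close> to any vector of \<open>W\<close>. This is the case of a leaf in the induction over a tree \<open>t\<close> with labels in
  \<open>W\<close> which approximates \<open>p h\<close>. Inner nodes are no problem, because \<open>T i h \<in> W\<close>, \<open>p (T i h) = T i (p h)\<close>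
  and squared distances add up over the two subtrees with the same constant \<open>C\<close>.
\<close>

theorem generating_restrict:
  assumes p: "linear_op H H p" "\<And>x. x \<in> carrier H \<Longrightarrow> hnorm H (p x) \<le> hnorm H x"
    and comm: "\<And>i x. x \<in> carrier H \<Longrightarrow> p (T i x) = T i (p x)"
    and W: "onb W b n" "T_invariant W" "generating W"
  shows "generating {x \<in> W. p x \<in> W}"
proof (rule generating_transfer[OF W(3)])
  note WH = subspaceD(1)[OF onbD(1)[OF W(1)]]
  note b = onbD(2)[OF W(1)]
  note [simp] = proj_closed[OF b] linear_opD(1)[OF p(1)]
  define R where "R x = p x \<ominus> proj b n (p x)" for x
  have "linear_op H H R"
    unfolding linear_op_def
  proof (intro conjI ballI allI)
    fix x y c assume [simp]: "x \<in> carrier H"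
    show "R x \<in> carrier H" by (simp add: R_def)
    show "R (c \<odot> x) = c \<odot> R x"
      by (rule hinner_eqI)
        (simp_all add: R_def linear_opD(3)[OF p(1)] linear_opD(3)[OF linear_proj[OF b]] hinner_left right_diff_distrib)
    assume [simp]: "y \<in> carrier H"
    show "R (x \<oplus> y) = R x \<oplus> R y"
      by (rule hinner_eqI)
        (simp_all add: R_def linear_opD(2)[OF p(1)] linear_opD(2)[OF linear_proj[OF b]] hinner_left)
  qed
  moreover have "hnorm H (R x) \<le> hnorm H x" if "x \<in> carrier H" for x
    using order_trans[OF hnorm_minus_proj_le[OF b] p(2)] that by (simp add: R_def)
  ultimately obtain C where C: "C \<ge> 0"
    "\<And>x. x \<in> W \<Longrightarrow> \<exists>y\<in>W. R y = \<zero> \<and> hnorm H (x \<ominus> y) \<le> C * hnorm H (R x)"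
    using kernel_distance_bound[OF W(1), of R] by blast
  let ?L = "{x \<in> W. p x \<in> W}"
  show "?L \<subseteq> carrier H" using WH by blast
  have tree: "\<exists>t'. labels t' \<subseteq> ?L \<and> hnorm H (h \<ominus> ev t') \<le> C * hnorm H (p h \<ominus> ev t)"
    if "labels t \<subseteq> W" "h \<in> W" for t h
    using that
  proof (induction t arbitrary: h)
    case (Leaf k)
    obtain y where y: "y \<in> W" "R y = \<zero>" "hnorm H (h \<ominus> y) \<le> C * hnorm H (R h)" using C(2)[OF Leaf(2)] by blast
    have "p y = proj b n (p y)"
      by (rule minus_eq_zeroD) (use y WH in \<open>simp_all add: R_def\<close>)
    then have "p y \<in> W" using proj_in_subspace[OF b onbD(1)[OF W(1)] onbD(3)[OF W(1)], of "p y"] by simp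
    moreover have "hnorm H (R h) \<le> hnorm H (p h \<ominus> k)"
      unfolding R_def using Leaf WH by (intro best_approximation[OF W(1)]) auto
    then have "C * hnorm H (R h) \<le> C * hnorm H (p h \<ominus> k)" using C(1) by (rule mult_left_mono)
    ultimately show ?case using y by (intro exI[of _ "Leaf y"]) simp
  next
    case (Node l r)
    have h [simp]: "h \<in> carrier H" using Node.prems WH by blast
    have lW: "labels l \<subseteq> W" "labels r \<subseteq> W" using Node.prems by auto
    have Th: "T i h \<in> W" for i using W(2) Node.prems by (simp add: T_invariantD)
    obtain l' where l': "labels l' \<subseteq> ?L" "hnorm H (T False h \<ominus> ev l') \<le> C * hnorm H (p (T False h) \<ominus> ev l)"
      using Node.IH(1)[OF lW(1) Th, of False] by blast
    obtain r' where r': "labels r' \<subseteq> ?L" "hnorm H (T True h \<ominus> ev r') \<le> C * hnorm H (p (T True h) \<ominus> ev r)"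
      using Node.IH(2)[OF lW(2) Th, of True] by blast
    have lr: "labels l \<subseteq> carrier H" "labels r \<subseteq> carrier H" "labels l' \<subseteq> carrier H" "labels r' \<subseteq> carrier H"
      using Node.prems WH l' r' by auto
    note [simp] = ev_closed[OF lr(1)] ev_closed[OF lr(2)] ev_closed[OF lr(3)] ev_closed[OF lr(4)]
    have "(hnorm H (h \<ominus> ev (Node l' r')))\<^sup>2 = (hnorm H (T False h \<ominus> ev l'))\<^sup>2 + (hnorm H (T True h \<ominus> ev r'))\<^sup>2"
      using lr by (intro hnorm_minus_ev_Node) simp_all
    also have "\<dots> \<le> (C * hnorm H (p (T False h) \<ominus> ev l))\<^sup>2 + (C * hnorm H (p (T True h) \<ominus> ev r))\<^sup>2"
      using l' r' by (intro add_mono power_mono) simp_all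
    also have "\<dots> = C\<^sup>2 * (hnorm H (p h \<ominus> ev (Node l r)))\<^sup>2"
      using lr by (subst hnorm_minus_ev_Node) (simp_all add: comm power_mult_distrib distrib_left)
    finally have "(hnorm H (h \<ominus> ev (Node l' r')))\<^sup>2 \<le> (C * hnorm H (p h \<ominus> ev (Node l r)))\<^sup>2"
      by (simp only: power_mult_distrib)
    then have "hnorm H (h \<ominus> ev (Node l' r')) \<le> C * hnorm H (p h \<ominus> ev (Node l r))"
      by (rule power2_le_imp_le) (use C(1) lr in \<open>simp del: ev.simps\<close>)
    moreover have "labels (Node l' r') \<subseteq> ?L" using l' r' by simp
    ultimately show ?case by blast
  qed
  fix x and e :: real assume x: "x \<in> W" and e: "e > 0"
  have px: "p x \<in> carrier H" using x WH by simp
  have e': "e / (C + 1) > 0" using e C(1) by simp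
  obtain t where t: "labels t \<subseteq> W" "hnorm H (p x \<ominus> ev t) < e / (C + 1)"
    using generatingD[OF W(3) px e'] by blast
  obtain t' where t': "labels t' \<subseteq> ?L" "hnorm H (x \<ominus> ev t') \<le> C * hnorm H (p x \<ominus> ev t)"
    using tree[OF t(1) x] by blast
  note t'(2)
  also have "C * hnorm H (p x \<ominus> ev t) \<le> C * (e / (C + 1))"
    using t(2) C(1) by (intro mult_left_mono) simp_all
  also have "\<dots> < e" using e C(1) by (simp add: field_simps)
  finally show "\<exists>t. labels t \<subseteq> ?L \<and> hnorm H (x \<ominus> ev t) < e" using t'(1) by blast
qed

text \<open>
  The norms of \<open>T\<^sub>b\<^sup>k x\<close> decrease to some \<open>c\<close>. An accumulation point \<open>u \<in> W\<close> of this sequence satisfies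
  \<open>\<parallel>T\<^sub>b\<^sup>j u\<parallel> = c\<close> for all \<open>j\<close>. As no norm is lost, the components of \<open>u\<close> off the branch \<open>b b b \<dots>\<close> vanish, and the elements \<open>g m\<close>
  of \<open>F\<close> act on \<open>u\<close> as \<open>T\<^sub>b\<^sup>m\<close>. These vectors have norm \<open>c\<close> and stay in the finite dimensional space
  \<open>W\<close>, but tend weakly to \<open>0\<close>. Hence \<open>c = 0\<close>.
\<close>

lemma vanishing_if_weakly_null:
  assumes W: "onb W e n" "T_invariant W" and x: "x \<in> W"
    and weak: "\<And>b g y z. \<lbrakk>cone_translations [] b g; y \<in> carrier H; z \<in> carrier H\<rbrakk> \<Longrightarrow>
      (\<lambda>m. hinner H (V_op H S (g m) y) z) \<longlonglongrightarrow> 0"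
  shows "vanishing x"
  unfolding vanishing_def
proof
  fix b
  note WH = subspaceD(1)[OF onbD(1)[OF W(1)]]
  have xH [simp]: "x \<in> carrier H" using x by (rule WH)
  let ?p = "\<lambda>k. fold T (replicate k b)"
  have p_Suc: "?p (Suc k) y = T b (?p k y)" for k y
    by (simp only: replicate_append_same[symmetric] replicate_Suc fold_append comp_apply fold_simps)
  have p_add: "?p j (?p k y) = ?p (j + k) y" for j k y
    by (subst add.commute) (simp add: replicate_add)
  let ?a = "\<lambda>k. hnorm H (?p k x)"
  have "decseq ?a"
    by (rule decseq_SucI) (simp only: p_Suc hnorm_T_le fold_T_closed xH)
  moreover have "0 \<le> ?a k" for k by simp
  ultimately obtain c where c: "?a \<longlonglongrightarrow> c" using decseq_convergent[of ?a 0] by blast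
  have le: "?a k \<le> hnorm H x" for k by (rule hnorm_fold_T_le) simp
  have pW: "?p k x \<in> W" for k using W(2) x by (rule T_invariant_fold)
  obtain r u where r: "strict_mono r" and u: "u \<in> W" and lim: "hlim H (\<lambda>k. ?p (r k) x) u"
    using bounded_sequence_convergent_subseq[OF W(1), of "\<lambda>k. ?p k x", OF pW le] by blast
  have uH [simp]: "u \<in> carrier H" using u by (rule WH)
  have norm_u: "hnorm H (?p j u) = c" for j
  proof (rule LIMSEQ_unique)
    have "hlim H (\<lambda>k. ?p j (?p (r k) x)) (?p j u)"
      unfolding hlim_def
    proof (rule squeeze_zero[OF lim[unfolded hlim_def]])
      fix k
      show "hnorm H (?p j (?p (r k) x) \<ominus> ?p j u) \<le> hnorm H (?p (r k) x \<ominus> u)"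
        using hnorm_fold_T_le[of "?p (r k) x \<ominus> u" "replicate j b"] by (simp add: fold_T_minus)
    qed simp
    then show "(\<lambda>k. hnorm H (?p j (?p (r k) x))) \<longlonglongrightarrow> hnorm H (?p j u)"
      by (intro tendsto_hnorm) simp_all
    have "strict_mono (\<lambda>k. j + r k)" using r by (auto simp: strict_mono_def)
    from LIMSEQ_subseq_LIMSEQ[OF c this] show "(\<lambda>k. hnorm H (?p j (?p (r k) x))) \<longlonglongrightarrow> c"
      by (simp add: o_def p_add)
  qed
  have hnorm_T': "(hnorm H y)\<^sup>2 = (hnorm H (T b y))\<^sup>2 + (hnorm H (T (\<not> b) y))\<^sup>2" if "y \<in> carrier H" for y
    using hnorm_T[OF that] by (cases b) simp_all
  have T_zero: "T (\<not> b) y = \<zero>" if "y \<in> carrier H" "hnorm H (T b y) = hnorm H y" for y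
    using hnorm_T'[OF that(1)] that by (intro hnorm_eq_zero) simp_all
  obtain g where g: "cone_translations [] b g" by (rule cone_translations_exist)
  then have gm: "g m \<in> thompson_V" for m using thompson_F_subset_V by (auto simp: cone_translations_def)
  have V_u: "V_op H S (g m) u = ?p m u" for m
  proof (rule eq_if_T_eq)
    have y: "V_op H S (g m) u \<in> carrier H" using gm by (rule V_op_closed) simp
    then show "V_op H S (g m) u \<in> carrier H" .
    have Tb: "T b (V_op H S (g m) u) = T b (?p m u)"
      using fold_T_cone_translation[OF g uH, of 0 m] by (simp add: p_Suc[of m] del: replicate.simps(2))
    have "hnorm H (T b (?p m u)) = c" using norm_u[of "Suc m"] by (simp only: p_Suc)
    then have "T (\<not> b) (?p m u) = \<zero>" "T (\<not> b) (V_op H S (g m) u) = \<zero>"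
      using norm_u[of 0] norm_u[of m] hnorm_V_op[OF gm uH, of m] y Tb by (auto intro!: T_zero)
    with Tb show "T i (V_op H S (g m) u) = T i (?p m u)" for i
      by (cases "i = b") auto
  qed simp
  have "(\<lambda>m. hinner H (?p m u) (e i)) \<longlonglongrightarrow> 0" if "i < n" for i
    using weak[OF g uH, of "e i"] that onbD(3)[OF W(1)] WH by (simp add: V_u)
  then have "(\<lambda>m. \<Sum>i<n. (cmod (hinner H (?p m u) (e i)))\<^sup>2) \<longlonglongrightarrow> (\<Sum>i<n. (cmod 0)\<^sup>2)"
    by (intro tendsto_intros) auto
  moreover have "(\<Sum>i<n. (cmod (hinner H (?p m u) (e i)))\<^sup>2) = c\<^sup>2" for m
    using onb_hnorm[OF W(1) T_invariant_fold[OF W(2) u, of "replicate m b"]] by (simp add: norm_u)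
  ultimately have "c = 0" by (simp add: LIMSEQ_const_iff)
  with c show "?a \<longlonglongrightarrow> 0" by simp
qed

end

text \<open>
  The unitary \<open>U\<close> carries the weak convergence of the powers of \<open>x\<^sub>0\<close> over from \<open>K\<close> to \<open>H\<close>, where finite
  dimension turns it into strong convergence of the powers of \<open>T b\<close>.
\<close>

theorem (in cuntz_pair) F_intertwiner_intertwines_T_if_finite_dimensional:
  assumes W: "H.onb W e n" "H.T_invariant W" "H.generating W"
    and vanK: "\<And>x. x \<in> carrier K \<Longrightarrow> K.vanishing x"
    and int: "\<And>v x. \<lbrakk>v \<in> thompson_F; x \<in> carrier H\<rbrakk> \<Longrightarrow> U (V_op H S v x) = V_op K S' v (U x)"
    and x: "x \<in> carrier H"
  shows "U (T b x) = T' b (U x)"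
proof (rule F_intertwiner_intertwines_T[OF _ vanK int x])
  fix y assume "y \<in> carrier H"
  then show "H.vanishing y"
  proof (rule H.vanishing_if_generating[OF W(3), rotated])
    fix w assume "w \<in> W"
    then show "H.vanishing w"
    proof (rule H.vanishing_if_weakly_null[OF W(1,2)])
      fix b g y z assume g: "cone_translations [] b g" and y: "y \<in> carrier H" and z: "z \<in> carrier H"
      then have gm: "g m \<in> thompson_F" for m by (simp add: cone_translations_def)
      have "(\<lambda>m. hinner K (V_op K S' (g m) (U y)) (U z)) \<longlonglongrightarrow> 0"
        using K.cone_translations_weak_limit[OF g vanK, of "U y" "U z"] y z by simp
      moreover have "hinner K (V_op K S' (g m) (U y)) (U z) = hinner H (V_op H S (g m) y) z" for m
        using y z int[OF gm y, of m] H.V_op_closed[of "g m" y] gm[of m] thompson_F_subset_V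
          U_inner[of "V_op H S (g m) y" z] by auto
      ultimately show "(\<lambda>m. hinner H (V_op H S (g m) y) z) \<longlonglongrightarrow> 0" by simp
    qed
  qed
qed

section \<open>Direct sums\<close>

lemma hsum_simps [simp]:
  "carrier (hsum H K) = carrier H \<times> carrier K"
  "\<zero>\<^bsub>hsum H K\<^esub> = (\<zero>\<^bsub>H\<^esub>, \<zero>\<^bsub>K\<^esub>)"
  "p \<oplus>\<^bsub>hsum H K\<^esub> q = (fst p \<oplus>\<^bsub>H\<^esub> fst q, snd p \<oplus>\<^bsub>K\<^esub> snd q)"
  "c \<odot>\<^bsub>hsum H K\<^esub> p = (c \<odot>\<^bsub>H\<^esub> fst p, c \<odot>\<^bsub>K\<^esub> snd p)"
  "hinner (hsum H K) p q = hinner H (fst p) (fst q) + hinner K (snd p) (snd q)"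
  by (simp_all add: hsum_def split: prod.splits)

lemma inner_product_space_hsum:
  assumes "inner_product_space H" "inner_product_space K"
  shows "inner_product_space (hsum H K)"
proof -
  interpret H: inner_product_space H by fact
  interpret K: inner_product_space K by fact
  show ?thesis
  proof (rule inner_product_spaceI)
    fix p q assume p: "p \<in> carrier (hsum H K)" and q: "q \<in> carrier (hsum H K)"
    show "hinner (hsum H K) q p = cnj (hinner (hsum H K) p q)"
      using p q H.hinner_commute[of "fst p" "fst q"] K.hinner_commute[of "snd p" "snd q"] by auto
    assume eq: "\<And>z. z \<in> carrier (hsum H K) \<Longrightarrow> hinner (hsum H K) p z = hinner (hsum H K) q z"
    have "fst p = fst q"
    proof (rule H.hinner_eqI)
      fix z assume "z \<in> carrier H"
      then show "hinner H (fst p) z = hinner H (fst q) z"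
        using eq[of "(z, \<zero>\<^bsub>K\<^esub>)"] p q by (auto simp: K.hinner_right)
    qed (use p q in auto)
    moreover have "snd p = snd q"
    proof (rule K.hinner_eqI)
      fix z assume "z \<in> carrier K"
      then show "hinner K (snd p) z = hinner K (snd q) z"
        using eq[of "(\<zero>\<^bsub>H\<^esub>, z)"] p q by (auto simp: H.hinner_right)
    qed (use p q in auto)
    ultimately show "p = q" by (simp add: prod_eq_iff)
  qed (auto simp: H.hinner_left K.hinner_left H.hinner_nonneg K.hinner_nonneg algebra_simps)
qed

lemma minus_hsum:
  assumes "inner_product_space H" "inner_product_space K" "p \<in> carrier (hsum H K)" "q \<in> carrier (hsum H K)"
  shows "p \<ominus>\<^bsub>hsum H K\<^esub> q = (fst p \<ominus>\<^bsub>H\<^esub> fst q, snd p \<ominus>\<^bsub>K\<^esub> snd q)"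
proof -
  interpret H: inner_product_space H by fact
  interpret K: inner_product_space K by fact
  interpret HK: inner_product_space "hsum H K" using assms by (intro inner_product_space_hsum)
  show ?thesis
  proof (rule HK.hinner_eqI)
    fix z assume z: "z \<in> carrier (hsum H K)"
    show "hinner (hsum H K) (p \<ominus>\<^bsub>hsum H K\<^esub> q) z = hinner (hsum H K) (fst p \<ominus>\<^bsub>H\<^esub> fst q, snd p \<ominus>\<^bsub>K\<^esub> snd q) z"
      unfolding HK.hinner_minus_left[OF assms(3,4) z]
      using assms(3,4) z by (auto simp: H.hinner_left K.hinner_left)
  qed (use assms(3,4) in \<open>auto intro: HK.M.minus_closed simp del: hsum_simps(1)\<close>, use assms(3,4) in auto)
qed

lemma hnorm_hsum:
  assumes "inner_product_space H" "inner_product_space K" "p \<in> carrier (hsum H K)"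
  shows "(hnorm (hsum H K) p)\<^sup>2 = (hnorm H (fst p))\<^sup>2 + (hnorm K (snd p))\<^sup>2"
proof -
  interpret H: inner_product_space H by fact
  interpret K: inner_product_space K by fact
  interpret HK: inner_product_space "hsum H K" using assms by (intro inner_product_space_hsum)
  show ?thesis using assms(3) HK.hnorm_power2[OF assms(3)] by (auto simp: H.hnorm_power2 K.hnorm_power2)
qed

lemma hnorm_hsum_ge:
  assumes H: "inner_product_space H" and K: "inner_product_space K" and p: "p \<in> carrier (hsum H K)"
  shows "hnorm H (fst p) \<le> hnorm (hsum H K) p" "hnorm K (snd p) \<le> hnorm (hsum H K) p"
    and "hnorm (hsum H K) p \<le> hnorm H (fst p) + hnorm K (snd p)"
proof -
  interpret H: inner_product_space H by fact
  interpret K: inner_product_space K by fact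
  interpret HK: inner_product_space "hsum H K" using H K by (rule inner_product_space_hsum)
  have nn: "0 \<le> hnorm (hsum H K) p" "0 \<le> hnorm H (fst p)" "0 \<le> hnorm K (snd p)"
    using HK.hnorm_nonneg[OF p] p by auto
  note eq = hnorm_hsum[OF H K p]
  show "hnorm H (fst p) \<le> hnorm (hsum H K) p" "hnorm K (snd p) \<le> hnorm (hsum H K) p"
    by (rule power2_le_imp_le, use nn in \<open>simp_all add: eq\<close>)+
  show "hnorm (hsum H K) p \<le> hnorm H (fst p) + hnorm K (snd p)"
    by (rule power2_le_imp_le) (use nn in \<open>simp_all add: eq power2_sum\<close>)
qed

lemma hilbert_space_hsum:
  assumes "hilbert_space H" "hilbert_space K"
  shows "hilbert_space (hsum H K)"
proof -
  interpret H: hilbert_space H by fact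
  interpret K: hilbert_space K by fact
  note HK = H.inner_product_space_axioms K.inner_product_space_axioms
  interpret HK: inner_product_space "hsum H K" using HK by (rule inner_product_space_hsum)
  show ?thesis
  proof
    fix f assume f: "hCauchy (hsum H K) f"
    note fc = HK.hCauchyD(1)[OF f]
    have fc' [simp]: "fst (f n) \<in> carrier H" "snd (f n) \<in> carrier K" for n using fc[of n] by auto
    have le: "hnorm H (fst (f m) \<ominus>\<^bsub>H\<^esub> fst (f n)) \<le> hnorm (hsum H K) (f m \<ominus>\<^bsub>hsum H K\<^esub> f n)"
      "hnorm K (snd (f m) \<ominus>\<^bsub>K\<^esub> snd (f n)) \<le> hnorm (hsum H K) (f m \<ominus>\<^bsub>hsum H K\<^esub> f n)" for m n
      using hnorm_hsum_ge[OF HK, of "f m \<ominus>\<^bsub>hsum H K\<^esub> f n"] minus_hsum[OF HK fc fc, of m n]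
        HK.M.minus_closed[OF fc fc, of m n] by simp_all
    have "hCauchy H (\<lambda>n. fst (f n))" "hCauchy K (\<lambda>n. snd (f n))"
      using HK.hCauchyD(2)[OF f] le unfolding hCauchy_def by (meson fc' order_le_less_trans)+
    then obtain x y where x: "x \<in> carrier H" "hlim H (\<lambda>n. fst (f n)) x" and y: "y \<in> carrier K" "hlim K (\<lambda>n. snd (f n)) y"
      using H.complete K.complete by blast
    have "(\<lambda>n. hnorm H (fst (f n) \<ominus>\<^bsub>H\<^esub> x) + hnorm K (snd (f n) \<ominus>\<^bsub>K\<^esub> y)) \<longlonglongrightarrow> 0 + 0"
      using x y unfolding hlim_def by (intro tendsto_add)
    then have "hlim (hsum H K) f (x, y)"
      unfolding hlim_def
    proof (rule_tac squeeze_zero)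
      fix n
      have xy: "(x, y) \<in> carrier (hsum H K)" using x y by simp
      show "hnorm (hsum H K) (f n \<ominus>\<^bsub>hsum H K\<^esub> (x, y)) \<le> hnorm H (fst (f n) \<ominus>\<^bsub>H\<^esub> x) + hnorm K (snd (f n) \<ominus>\<^bsub>K\<^esub> y)"
        using hnorm_hsum_ge(3)[OF HK HK.M.minus_closed[OF fc xy], of n] minus_hsum[OF HK fc xy, of n] by simp
      show "0 \<le> hnorm (hsum H K) (f n \<ominus>\<^bsub>hsum H K\<^esub> (x, y))"
        by (intro HK.hnorm_nonneg HK.M.minus_closed fc xy)
    qed simp
    with x y show "\<exists>p\<in>carrier (hsum H K). hlim (hsum H K) f p" by auto
  qed
qed

definition pair_op :: "('i \<Rightarrow> 'a \<Rightarrow> 'a) \<Rightarrow> ('i \<Rightarrow> 'b \<Rightarrow> 'b) \<Rightarrow> 'i \<Rightarrow> 'a \<times> 'b \<Rightarrow> 'a \<times> 'b" where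
  "pair_op f g i p = (f i (fst p), g i (snd p))"

lemma fst_pair_op [simp]: "fst (pair_op f g i p) = f i (fst p)" and snd_pair_op [simp]: "snd (pair_op f g i p) = g i (snd p)"
  by (simp_all add: pair_op_def)

locale cuntz_sum = H: cuntz_system H S T + K: cuntz_system K S' T'
  for H :: "'a hspace" and S T and K :: "'b hspace" and S' T'
begin

lemmas HK_ips = H.inner_product_space_axioms K.inner_product_space_axioms

lemma cuntz_system_sum: "cuntz_system (hsum H K) (pair_op S S') (pair_op T T')"
proof (intro cuntz_system.intro cuntz_system_axioms.intro)
  show "hilbert_space (hsum H K)"
    by (rule hilbert_space_hsum) unfold_locales
  show "linear_op (hsum H K) (hsum H K) (pair_op S S' i)" for i
    by (auto simp: linear_op_def pair_op_def H.S K.S)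
  show "linear_op (hsum H K) (hsum H K) (pair_op T T' i)" for i
    by (auto simp: linear_op_def pair_op_def H.T K.T)
qed (auto simp: pair_op_def H.hinner_S_left K.hinner_S_left H.T_S K.T_S H.S_T K.S_T)

sublocale sum: cuntz_system "hsum H K" "pair_op S S'" "pair_op T T'"
  by (rule cuntz_system_sum)

lemma fold_pair_op: "fold (pair_op T T') u p = (fold T u (fst p), fold T' u (snd p))"
  by (induction u arbitrary: p) simp_all

lemma V_op_sum:
  assumes v: "v \<in> thompson_V" and p: "p \<in> carrier (hsum H K)"
  shows "V_op (hsum H K) (pair_op S S') v p = (V_op H S v (fst p), V_op K S' v (snd p))"
proof (rule sum.V_op_eqI[OF v p])
  show "(V_op H S v (fst p), V_op K S' v (snd p)) \<in> carrier (hsum H K)"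
    using p v by (auto simp: H.V_op_closed K.V_op_closed)
  fix u u' assume "maps_cone v u u'"
  then show "fold (pair_op T T') u' (V_op H S v (fst p), V_op K S' v (snd p)) = fold (pair_op T T') u p"
    using p by (auto simp: fold_pair_op H.fold_T_V_op[OF v] K.fold_T_V_op[OF v])
qed

lemma vanishing_sum:
  assumes p: "p \<in> carrier (hsum H K)" and "H.vanishing (fst p)" "K.vanishing (snd p)"
  shows "sum.vanishing p"
  unfolding sum.vanishing_def
proof
  fix i :: bool
  let ?r = "\<lambda>n. replicate n i"
  have "(\<lambda>n. hnorm H (fold T (?r n) (fst p)) + hnorm K (fold T' (?r n) (snd p))) \<longlonglongrightarrow> 0 + 0"
    using assms by (intro tendsto_add) (simp_all add: H.vanishing_def K.vanishing_def)
  then show "(\<lambda>n. hnorm (hsum H K) (fold (pair_op T T') (?r n) p)) \<longlonglongrightarrow> 0"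
  proof (rule_tac squeeze_zero)
    fix n
    have cl: "fold (pair_op T T') (?r n) p \<in> carrier (hsum H K)" using p by (rule sum.fold_T_closed)
    then show "0 \<le> hnorm (hsum H K) (fold (pair_op T T') (?r n) p)" by (rule sum.hnorm_nonneg)
    show "hnorm (hsum H K) (fold (pair_op T T') (?r n) p)
        \<le> hnorm H (fold T (?r n) (fst p)) + hnorm K (fold T' (?r n) (snd p))"
      using hnorm_hsum_ge(3)[OF HK_ips cl] by (simp add: fold_pair_op)
  qed simp
qed

lemma ev_sum: "sum.ev t = (H.ev (map_dtree fst t), K.ev (map_dtree snd t))"
  by (induction t) simp_all

end

lemma onb_isometric_image:
  assumes H: "inner_product_space H" and K: "inner_product_space K" and j: "linear_op H K j"
    and inner: "\<And>x y. \<lbrakk>x \<in> carrier H; y \<in> carrier H\<rbrakk> \<Longrightarrow> hinner K (j x) (j y) = hinner H x y"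
    and V: "inner_product_space.onb H V e n"
  shows "inner_product_space.onb K (j ` V) (j \<circ> e) n"
proof -
  interpret H: inner_product_space H by fact
  interpret K: inner_product_space K by fact
  note VH = H.subspaceD(1)[OF H.onbD(1)[OF V]]
  note e = H.onbD(2)[OF V]
  note j_closed [simp] = linear_opD(1)[OF j]
  have ortho: "K.orthonormal (j \<circ> e) n"
    using H.orthonormal_closed[OF e] H.orthonormal_inner[OF e] by (simp add: K.orthonormal_def inner)
  have "K.subspace (j ` V)"
    unfolding K.subspace_def
  proof (intro conjI ballI allI)
    show "j ` V \<subseteq> carrier K" using VH by auto
    show "\<zero>\<^bsub>K\<^esub> \<in> j ` V"
      using H.subspaceD(2)[OF H.onbD(1)[OF V]] linear_op_zero[OF H K j] by force
    fix x' y' c assume "x' \<in> j ` V"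
    then obtain x where x: "x \<in> V" "x' = j x" by blast
    show "c \<odot>\<^bsub>K\<^esub> x' \<in> j ` V"
      using x linear_opD(3)[OF j VH[OF x(1)], of c] H.subspaceD(4)[OF H.onbD(1)[OF V] x(1), of c] by force
    assume "y' \<in> j ` V"
    then obtain y where y: "y \<in> V" "y' = j y" by blast
    show "x' \<oplus>\<^bsub>K\<^esub> y' \<in> j ` V"
      using x y linear_opD(2)[OF j VH[OF x(1)] VH[OF y(1)]] H.subspaceD(3)[OF H.onbD(1)[OF V] x(1) y(1)] by force
  qed
  moreover have "K.proj (j \<circ> e) n (j x) = j x" if x: "x \<in> V" for x
  proof -
    note [simp] = K.proj_closed[OF ortho] VH[OF x]
    have "(hnorm K (j x \<ominus>\<^bsub>K\<^esub> K.proj (j \<circ> e) n (j x)))\<^sup>2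
        = (hnorm H x)\<^sup>2 - (\<Sum>i<n. (cmod (hinner H x (e i)))\<^sup>2)"
    proof -
      have "hnorm K (j x) = hnorm H x" by (simp add: hnorm_def inner)
      then show ?thesis
        using H.orthonormal_closed[OF e] by (simp add: K.hnorm_minus_proj[OF ortho] K.hnorm_proj[OF ortho] inner)
    qed
    also have "\<dots> = 0" using H.onb_hnorm[OF V x] by simp
    finally have "j x \<ominus>\<^bsub>K\<^esub> K.proj (j \<circ> e) n (j x) = \<zero>\<^bsub>K\<^esub>"
      by (intro K.hnorm_eq_zero) simp_all
    from K.minus_eq_zeroD[OF this] show ?thesis by simp
  qed
  ultimately show ?thesis
    using ortho H.onbD(3)[OF V] by (auto simp: K.onb_def)
qed

lemma (in inner_product_space) has_dim_iff_onb: "has_dim H n \<longleftrightarrow> (\<exists>e. onb (carrier H) e n)"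
proof -
  have "subspace (carrier H)" by (auto simp: subspace_def)
  moreover have "(\<forall>x\<in>carrier H. x = (\<Oplus>i\<in>{..<n}. hinner H x (e i) \<odot> e i)) \<longleftrightarrow>
      (\<forall>x\<in>carrier H. proj e n x = x)" for e
    unfolding proj_def by (rule ball_cong[OF refl]) (rule eq_commute)
  ultimately show ?thesis unfolding has_dim_def onb_def orthonormal_def by (simp only:) blast
qed

lemma sum_lessThan_add: "(\<Sum>i<n + m. f i) = (\<Sum>i<n. f i) + (\<Sum>i<m. f (n + i))" for f :: "nat \<Rightarrow> 'a::comm_monoid_add"
  by (induction m) (simp_all add: add_ac)

context cuntz_sum
begin

definition concat_basis :: "(nat \<Rightarrow> 'a) \<Rightarrow> nat \<Rightarrow> (nat \<Rightarrow> 'b) \<Rightarrow> nat \<Rightarrow> 'a \<times> 'b" where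
  "concat_basis e n f i = (if i < n then (e i, \<zero>\<^bsub>K\<^esub>) else (\<zero>\<^bsub>H\<^esub>, f (i - n)))"

lemma orthonormal_concat:
  assumes e: "H.orthonormal e n" and f: "K.orthonormal f m"
  shows "sum.orthonormal (concat_basis e n f) (n + m)"
  unfolding sum.orthonormal_def
  using H.orthonormal_closed[OF e] H.orthonormal_inner[OF e] K.orthonormal_closed[OF f] K.orthonormal_inner[OF f]
  by (auto simp: concat_basis_def H.hinner_left K.hinner_left H.hinner_right K.hinner_right)

lemma onb_Times:
  assumes V: "H.onb V e n" and W: "K.onb W f m"
  shows "sum.onb (V \<times> W) (concat_basis e n f) (n + m)"
proof -
  note VH = H.subspaceD[OF H.onbD(1)[OF V]] and WK = K.subspaceD[OF K.onbD(1)[OF W]]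
  note e = H.onbD(2)[OF V] and f = K.onbD(2)[OF W]
  note ortho = orthonormal_concat[OF e f]
  have "sum.subspace (V \<times> W)"
    unfolding sum.subspace_def using VH WK by auto
  moreover have "concat_basis e n f i \<in> V \<times> W" if "i < n + m" for i
    using that VH(2) WK(2) H.onbD(3)[OF V] K.onbD(3)[OF W] by (auto simp: concat_basis_def)
  moreover have "sum.proj (concat_basis e n f) (n + m) p = p" if p: "p \<in> V \<times> W" for p
  proof (rule sum.hinner_eqI)
    have p': "fst p \<in> V" "snd p \<in> W" "fst p \<in> carrier H" "snd p \<in> carrier K" using p VH(1) WK(1) by auto
    show "sum.proj (concat_basis e n f) (n + m) p \<in> carrier (hsum H K)"
      by (rule sum.proj_closed[OF ortho])
    show "p \<in> carrier (hsum H K)" using p VH(1) WK(1) by auto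
    fix z assume z: "z \<in> carrier (hsum H K)"
    have "hinner (hsum H K) (sum.proj (concat_basis e n f) (n + m) p) z
        = (\<Sum>i<n. hinner H (fst p) (e i) * hinner H (e i) (fst z)) + (\<Sum>i<m. hinner K (snd p) (f i) * hinner K (f i) (snd z))"
      unfolding sum.hinner_proj_left[OF ortho z] sum_lessThan_add
      using p' z H.orthonormal_closed[OF e] K.orthonormal_closed[OF f]
      by (auto simp: concat_basis_def H.hinner_left K.hinner_left H.hinner_right K.hinner_right)
    also have "\<dots> = hinner H (H.proj e n (fst p)) (fst z) + hinner K (K.proj f m (snd p)) (snd z)"
      using z by (auto simp: H.hinner_proj_left[OF e] K.hinner_proj_left[OF f])
    also have "\<dots> = hinner (hsum H K) p z"
      using p' by (simp add: H.onbD(4)[OF V] K.onbD(4)[OF W])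
    finally show "hinner (hsum H K) (sum.proj (concat_basis e n f) (n + m) p) z = hinner (hsum H K) p z" .
  qed
  ultimately show ?thesis using ortho by (simp add: sum.onb_def)
qed

end

section \<open>Realization of generating subspaces by P-modules\<close>

definition coord_space :: "nat \<Rightarrow> (nat \<Rightarrow> complex) hspace" where
  "coord_space n = \<lparr>carrier = {f. \<forall>i\<ge>n. f i = 0}, mult = undefined, one = undefined,
     zero = (\<lambda>_. 0), add = (\<lambda>f g i. f i + g i), smult = (\<lambda>c f i. c * f i),
     hinner = (\<lambda>f g. \<Sum>i<n. f i * cnj (g i))\<rparr>"

lemma coord_space_simps [simp]:
  "carrier (coord_space n) = {f. \<forall>i\<ge>n. f i = 0}" "\<zero>\<^bsub>coord_space n\<^esub> = (\<lambda>_. 0)"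
  "f \<oplus>\<^bsub>coord_space n\<^esub> g = (\<lambda>i. f i + g i)" "c \<odot>\<^bsub>coord_space n\<^esub> f = (\<lambda>i. c * f i)"
  "hinner (coord_space n) f g = (\<Sum>i<n. f i * cnj (g i))"
  by (simp_all add: coord_space_def)

definition unit_vec :: "nat \<Rightarrow> nat \<Rightarrow> complex" where
  "unit_vec i j = (if j = i then 1 else 0)"

lemma sum_unit_vec: "i < n \<Longrightarrow> (\<Sum>j<n. f j * cnj (unit_vec i j)) = f i"
  by (simp add: unit_vec_def if_distrib[of cnj] if_distrib[of "(*) _"] sum.delta cong: if_cong)

lemma inner_product_space_coord: "inner_product_space (coord_space n)"
proof (rule inner_product_spaceI)
  fix f g :: "nat \<Rightarrow> complex"
  show "hinner (coord_space n) g f = cnj (hinner (coord_space n) f g)"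
    by (simp add: mult.commute)
  show "0 \<le> Re (hinner (coord_space n) f f)"
    by (auto simp: Re_sum intro!: sum_nonneg simp: mult_nonneg_nonneg)
  assume f: "f \<in> carrier (coord_space n)" and g: "g \<in> carrier (coord_space n)"
    and eq: "\<And>z. z \<in> carrier (coord_space n) \<Longrightarrow> hinner (coord_space n) f z = hinner (coord_space n) g z"
  show "f = g"
  proof
    fix i
    show "f i = g i"
    proof (cases "i < n")
      case True
      then show ?thesis using eq[of "unit_vec i"] by (simp add: sum_unit_vec) (simp add: unit_vec_def)
    qed (use f g in simp)
  qed
qed (auto simp: sum_distrib_left distrib_right sum.distrib mult.assoc)

lemma minus_coord:
  assumes "f \<in> carrier (coord_space n)" "g \<in> carrier (coord_space n)"
  shows "f \<ominus>\<^bsub>coord_space n\<^esub> g = (\<lambda>i. f i - g i)"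
proof -
  interpret inner_product_space "coord_space n" by (rule inner_product_space_coord)
  have "f \<ominus>\<^bsub>coord_space n\<^esub> g = f \<oplus>\<^bsub>coord_space n\<^esub> (-1) \<odot>\<^bsub>coord_space n\<^esub> g"
    using assms by (intro hinner_eqI) (simp_all only: hinner_left M.minus_closed M.a_closed smult_closed' , simp)
  then show ?thesis by simp
qed

lemma hnorm_coord: "hnorm (coord_space n) f = sqrt (\<Sum>i<n. (cmod (f i))\<^sup>2)"
  by (simp add: hnorm_def Re_sum complex_norm_square[symmetric])

lemma hilbert_space_coord: "hilbert_space (coord_space n)"
proof -
  interpret inner_product_space "coord_space n" by (rule inner_product_space_coord)
  show ?thesis
  proof
    fix f assume f: "hCauchy (coord_space n) f"
    note fc = hCauchyD(1)[OF f]
    have le: "cmod (f m i - f k i) \<le> hnorm (coord_space n) (f m \<ominus>\<^bsub>coord_space n\<^esub> f k)" if "i < n" for i m k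
      unfolding minus_coord[OF fc fc] hnorm_coord
      using that by (intro real_le_rsqrt member_le_sum) simp_all
    have "convergent (\<lambda>k. f k i)" if i: "i < n" for i
    proof (rule Cauchy_convergent, rule CauchyI)
      fix e :: real assume "e > 0"
      then obtain N where "\<forall>m\<ge>N. \<forall>k\<ge>N. hnorm (coord_space n) (f m \<ominus>\<^bsub>coord_space n\<^esub> f k) < e"
        using hCauchyD(2)[OF f] by blast
      then show "\<exists>M. \<forall>m\<ge>M. \<forall>k\<ge>M. norm (f m i - f k i) < e"
        using le[OF i] by (meson order_le_less_trans)
    qed
    then obtain l where l: "\<And>i. i < n \<Longrightarrow> (\<lambda>k. f k i) \<longlonglongrightarrow> l i"
      unfolding convergent_def by metis
    define L where "L i = (if i < n then l i else 0)" for i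
    have L: "L \<in> carrier (coord_space n)" by (simp add: L_def)
    have "(\<lambda>k. sqrt (\<Sum>i<n. (cmod (f k i - L i))\<^sup>2)) \<longlonglongrightarrow> sqrt (\<Sum>i<n. (cmod (L i - L i))\<^sup>2)"
      using l by (intro tendsto_intros) (simp add: L_def)
    then have "hlim (coord_space n) f L"
      by (simp add: hlim_def minus_coord[OF fc L] hnorm_coord)
    with L show "\<exists>x\<in>carrier (coord_space n). hlim (coord_space n) f x" by blast
  qed
qed

lemma has_dim_coord: "has_dim (coord_space n) n"
proof -
  interpret inner_product_space "coord_space n" by (rule inner_product_space_coord)
  have "orthonormal unit_vec n"
    unfolding orthonormal_def coord_space_simps by (auto simp: sum_unit_vec) (auto simp: unit_vec_def)
  moreover have "proj unit_vec n f = f" if f: "f \<in> carrier (coord_space n)" for f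
  proof (rule hinner_eqI)
    fix z assume z: "z \<in> carrier (coord_space n)"
    have "(\<Sum>j<n. unit_vec i j * cnj (z j)) = cnj (z i)" if "i < n" for i
    proof -
      have "(\<Sum>j<n. unit_vec i j * cnj (z j)) = (\<Sum>j<n. if j = i then cnj (z i) else 0)"
        by (intro sum.cong) (auto simp: unit_vec_def)
      then show ?thesis using that by simp
    qed
    then show "hinner (coord_space n) (proj unit_vec n f) z = hinner (coord_space n) f z"
      using hinner_proj_left[OF \<open>orthonormal unit_vec n\<close> z, of f] by (simp add: sum_unit_vec)
  qed (use f proj_closed[OF \<open>orthonormal unit_vec n\<close>] in auto)
  ultimately have "onb (carrier (coord_space n)) unit_vec n"
    using orthonormal_closed by (auto simp: onb_def subspace_def simp del: coord_space_simps)
  then show ?thesis using has_dim_iff_onb by blast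
qed

text \<open>
  The restrictions of \<open>T False\<close> and \<open>T True\<close> to \<open>W\<close> make \<open>W\<close> a P-module by the Parseval identity. An
  orthonormal basis transports it to the space of coordinate vectors, \<open>j\<close> being the synthesis map
  and \<open>k\<close> the coordinate map.
\<close>

theorem (in cuntz_system) realization:
  assumes W: "onb W e n" "T_invariant W" "generating W"
  obtains C :: "(nat \<Rightarrow> complex) hspace" and A B U
    where "P_module C A B" "has_dim C n" "unitary_op (Pi_space C A B) H U"
      "\<And>i x. x \<in> carrier (Pi_space C A B) \<Longrightarrow> U (tau C A B i x) = T i (U x)"
proof -
  note WH = subspaceD[OF onbD(1)[OF W(1)]] and e = onbD(2)[OF W(1)]
  note ec = orthonormal_closed[OF e]
  interpret C: hilbert_space "coord_space n" by (rule hilbert_space_coord)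
  let ?C = "coord_space n"
  define j where "j f = (\<Oplus>i\<in>{..<n}. f i \<odot> e i)" for f
  define k where "k x i = (if i < n then hinner H x (e i) else 0)" for x i
  have jW: "j f \<in> W" for f
    unfolding j_def using onbD(1,3)[OF W(1)] by (intro subspace_finsum) (auto intro: subspaceD)
  have j_closed [simp]: "j f \<in> carrier H" for f using jW WH(1) by blast
  have j_inner: "hinner H (j f) z = (\<Sum>i<n. f i * hinner H (e i) z)" if "z \<in> carrier H" for f z
    unfolding j_def using that ec by (subst hinner_finsum_left) (auto simp: hinner_left)
  have j_basis: "hinner H (j f) (e i) = f i" if "i < n" for f i
    using that ec by (simp add: j_inner orthonormal_inner[OF e] if_distrib[of "(*) _"] sum.delta cong: if_cong)
  have jj: "hinner H (j f) (j g) = hinner ?C f g" for f g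
    using ec by (subst j_inner) (simp_all add: hinner_commute[of "j g" "e i" for i] j_basis)
  have jk: "j (k x) = x" if "x \<in> W" for x
  proof -
    have "j (k x) = proj e n x"
      unfolding j_def proj_def k_def using ec by (intro M.finsum_cong') auto
    then show ?thesis using onbD(4)[OF W(1) that] by simp
  qed
  have k_closed: "k x \<in> carrier ?C" for x by (simp add: k_def)
  have TW: "T i (j f) \<in> W" for i f using W(2) jW by (simp add: T_invariantD)
  define A where "A f = k (T False (j f))" for f
  define B where "B f = k (T True (j f))" for f
  have TA: "T i (j f) = j (if i then B f else A f)" for i f
    using jk[OF TW] by (simp add: A_def B_def)
  have j_add: "j (f \<oplus>\<^bsub>?C\<^esub> g) = j f \<oplus> j g" and j_smult: "j (c \<odot>\<^bsub>?C\<^esub> f) = c \<odot> j f" for f g c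
    by (rule hinner_eqI; simp add: j_inner hinner_left sum.distrib distrib_right sum_distrib_left mult.assoc)+
  have lin: "linear_op ?C ?C (\<lambda>f. k (T i (j f)))" for i
    unfolding linear_op_def
  proof (intro conjI ballI allI)
    fix f g c
    show "k (T i (j f)) \<in> carrier ?C" by (rule k_closed)
    show "k (T i (j (f \<oplus>\<^bsub>?C\<^esub> g))) = k (T i (j f)) \<oplus>\<^bsub>?C\<^esub> k (T i (j g))"
      unfolding j_add by (auto simp: k_def T hinner_left ec)
    show "k (T i (j (c \<odot>\<^bsub>?C\<^esub> f))) = c \<odot>\<^bsub>?C\<^esub> k (T i (j f))"
      unfolding j_smult by (auto simp: k_def T hinner_left ec)
  qed
  interpret P: P_mod ?C A B
  proof
    show "linear_op ?C ?C A" "linear_op ?C ?C B" using lin unfolding A_def B_def by blast+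
    show "hinner ?C (A f) (A g) + hinner ?C (B f) (B g) = hinner ?C f g" for f g
      using parseval[of "j f" "j g"] by (simp only: TA jj if_True if_False j_closed)
  qed
  have jC: "j ` carrier ?C = W"
  proof
    show "j ` carrier ?C \<subseteq> W" using jW by blast
    show "W \<subseteq> j ` carrier ?C"
    proof
      fix x assume "x \<in> W"
      then have "x = j (k x)" by (simp only: jk)
      then show "x \<in> j ` carrier ?C" using k_closed by (rule image_eqI)
    qed
  qed
  have "P_module ?C A B"
    unfolding P_module_iff using C.hilbert_space_axioms P.linear_A P.linear_B P.hinner_AB by blast
  moreover obtain U where "unitary_op (Pi_space ?C A B) H U"
    "\<And>i x. x \<in> carrier (Pi_space ?C A B) \<Longrightarrow> U (tau ?C A B i x) = T i (U x)"
    by (rule P.universal[OF cuntz_system_axioms, of j]) (use W(3) jC jj TA in auto)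
  ultimately show ?thesis using that has_dim_coord by blast
qed

section \<open>Generating subspaces of a direct sum\<close>

lemma same_shape_zip:
  assumes "shape s = shape t"
  obtains u where "map_dtree fst u = s" "map_dtree snd u = t" "labels u \<subseteq> labels s \<times> labels t"
proof -
  have "\<exists>u. map_dtree fst u = s \<and> map_dtree snd u = t \<and> labels u \<subseteq> labels s \<times> labels t"
    using assms
  proof (induction rule: same_shape_induct)
    case (Leaf x y)
    then show ?case by (intro exI[of _ "Leaf (x, y)"]) simp
  next
    case (Node l r l' r')
    then obtain u v where "map_dtree fst u = l" "map_dtree snd u = l'" "labels u \<subseteq> labels l \<times> labels l'"
      "map_dtree fst v = r" "map_dtree snd v = r'" "labels v \<subseteq> labels r \<times> labels r'" by blast
    then show ?case by (intro exI[of _ "Node u v"]) auto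
  qed
  then show ?thesis using that by blast
qed

lemma (in cuntz_system) ev_expand:
  assumes "labels t \<subseteq> carrier H"
  shows "ev (expand (T False) (T True) n t) = ev t"
  using assms
proof (induction n arbitrary: t)
  case (Suc n)
  then show ?case by (cases t) (simp_all add: S_T)
qed simp

lemma (in cuntz_system) labels_expand:
  assumes "T_invariant W" "labels t \<subseteq> W"
  shows "labels (expand (T False) (T True) n t) \<subseteq> W"
  using assms(2)
proof (induction n arbitrary: t)
  case (Suc n)
  then show ?case using assms(1) by (cases t) (simp_all add: T_invariantD)
qed simp

context cuntz_sum
begin

text \<open>
  Two approximating trees, one for each component, can be expanded to the same shape without changing
  the vectors which they represent. Invariance keeps the labels in \<open>V\<close> and \<open>W\<close>. The two trees are then
  zipped into one tree labelled by pairs.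
\<close>

lemma generating_Times:
  assumes V: "H.generating V" "H.T_invariant V" and W: "K.generating W" "K.T_invariant W"
  shows "sum.generating (V \<times> W)"
proof (rule sum.generatingI)
  have VH: "V \<subseteq> carrier H" and WK: "W \<subseteq> carrier K"
    using V(1) W(1) by (auto simp: H.generating_def K.generating_def)
  then show "V \<times> W \<subseteq> carrier (hsum H K)" by auto
  fix p and e :: real assume p: "p \<in> carrier (hsum H K)" and e: "e > 0"
  then have p': "fst p \<in> carrier H" "snd p \<in> carrier K" by auto
  obtain s where s: "labels s \<subseteq> V" "hnorm H (fst p \<ominus>\<^bsub>H\<^esub> H.ev s) < e / 2"
    using H.generatingD[OF V(1) p'(1), of "e / 2"] e by auto
  obtain t where t: "labels t \<subseteq> W" "hnorm K (snd p \<ominus>\<^bsub>K\<^esub> K.ev t) < e / 2"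
    using K.generatingD[OF W(1) p'(2), of "e / 2"] e by auto
  have "\<forall>\<^sub>F n in sequentially. shape (expand (T False) (T True) n s) = full_tree n
      \<and> shape (expand (T' False) (T' True) n t) = full_tree n"
    by (intro eventually_conj shape_expand)
  then obtain n where n: "shape (expand (T False) (T True) n s) = full_tree n"
      "shape (expand (T' False) (T' True) n t) = full_tree n"
    by (auto simp: eventually_sequentially)
  obtain u where u: "map_dtree fst u = expand (T False) (T True) n s"
    "map_dtree snd u = expand (T' False) (T' True) n t"
    "labels u \<subseteq> labels (expand (T False) (T True) n s) \<times> labels (expand (T' False) (T' True) n t)"
    using same_shape_zip[OF trans[OF n(1) n(2)[symmetric]]] by blast
  have ev: "sum.ev u = (H.ev s, K.ev t)"
    using s(1) t(1) VH WK by (simp add: ev_sum u H.ev_expand K.ev_expand)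
  have cl: "sum.ev u \<in> carrier (hsum H K)"
    using s(1) t(1) VH WK by (simp add: ev)
  have labels: "labels u \<subseteq> V \<times> W"
    using u(3) H.labels_expand[OF V(2) s(1), of n] K.labels_expand[OF W(2) t(1), of n] by blast
  have "hnorm (hsum H K) (p \<ominus>\<^bsub>hsum H K\<^esub> sum.ev u) < e"
    using hnorm_hsum_ge(3)[OF HK_ips sum.M.minus_closed[OF p cl]] s(2) t(2)
    unfolding minus_hsum[OF HK_ips p cl] by (simp add: ev)
  with labels show "\<exists>t. labels t \<subseteq> V \<times> W \<and> hnorm (hsum H K) (p \<ominus>\<^bsub>hsum H K\<^esub> sum.ev t) < e" by blast
qed

lemma T_invariant_Times:
  "\<lbrakk>H.T_invariant V; K.T_invariant W\<rbrakk> \<Longrightarrow> sum.T_invariant (V \<times> W)"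
  by (auto simp: H.T_invariant_def K.T_invariant_def sum.T_invariant_def pair_op_def)

text \<open>
  The sections are orthogonal to each other inside \<open>W\<close>, so their orthonormal families concatenate.
\<close>

lemma sections_onb:
  assumes W: "sum.onb W b n"
  obtains e k f m where "H.onb {x \<in> carrier H. (x, \<zero>\<^bsub>K\<^esub>) \<in> W} e k" "K.onb {y \<in> carrier K. (\<zero>\<^bsub>H\<^esub>, y) \<in> W} f m" "k + m \<le> n"
proof -
  let ?V = "{x \<in> carrier H. (x, \<zero>\<^bsub>K\<^esub>) \<in> W}" and ?V' = "{y \<in> carrier K. (\<zero>\<^bsub>H\<^esub>, y) \<in> W}"
  note WHK = sum.subspaceD[OF sum.onbD(1)[OF W]]
  have "H.subspace ?V"
    unfolding H.subspace_def using WHK(2) WHK(3)[of "(_, \<zero>\<^bsub>K\<^esub>)" "(_, \<zero>\<^bsub>K\<^esub>)"] WHK(4)[of "(_, \<zero>\<^bsub>K\<^esub>)"]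
    by (auto simp: K.smult_r_null)
  have "K.subspace ?V'"
    unfolding K.subspace_def using WHK(2) WHK(3)[of "(\<zero>\<^bsub>H\<^esub>, _)" "(\<zero>\<^bsub>H\<^esub>, _)"] WHK(4)[of "(\<zero>\<^bsub>H\<^esub>, _)"]
    by (auto simp: H.smult_r_null)
  have size: "k + m \<le> n"
    if "H.orthonormal e k" "\<And>i. i < k \<Longrightarrow> e i \<in> ?V" "K.orthonormal f m" "\<And>i. i < m \<Longrightarrow> f i \<in> ?V'" for e k f m
    using that by (intro sum.orthonormal_size_le[OF W orthonormal_concat[OF that(1,3)]]) (auto simp: concat_basis_def)
  obtain e k where e: "H.onb ?V e k"
  proof (rule H.onb_exists[OF \<open>H.subspace ?V\<close>])
    fix e k assume "H.orthonormal e k" "\<And>i. i < k \<Longrightarrow> e i \<in> ?V"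
    then show "k \<le> n" using size[of e k undefined 0] by (simp add: K.orthonormal_def)
  qed
  obtain f m where f: "K.onb ?V' f m"
  proof (rule K.onb_exists[OF \<open>K.subspace ?V'\<close>])
    fix f m assume "K.orthonormal f m" "\<And>i. i < m \<Longrightarrow> f i \<in> ?V'"
    then show "m \<le> n" using size[of undefined 0 f m] by (simp add: H.orthonormal_def)
  qed
  have "k + m \<le> n"
    using e f by (intro size[of e k f m]) (auto simp: H.onb_def K.onb_def)
  with e f show ?thesis using that by blast
qed

text \<open>
  With \<open>p\<close> the projection onto the first summand, \<open>{q \<in> W. p q \<in> W}\<close> is the sum of the two sections:
  along with \<open>q\<close> and \<open>p q\<close> the space \<open>W\<close> contains \<open>q - p q\<close>. It generates by \<open>generating_restrict\<close>, and
  the two components of an approximating tree approximate in the two summands.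
\<close>

theorem generating_sections:
  assumes W: "sum.onb W b n" "sum.T_invariant W" "sum.generating W"
  shows "H.generating {x \<in> carrier H. (x, \<zero>\<^bsub>K\<^esub>) \<in> W}" "K.generating {y \<in> carrier K. (\<zero>\<^bsub>H\<^esub>, y) \<in> W}"
proof -
  let ?V = "{x \<in> carrier H. (x, \<zero>\<^bsub>K\<^esub>) \<in> W}" and ?V' = "{y \<in> carrier K. (\<zero>\<^bsub>H\<^esub>, y) \<in> W}"
  note WHK = sum.subspaceD[OF sum.onbD(1)[OF W(1)]]
  define p :: "'a \<times> 'b \<Rightarrow> 'a \<times> 'b" where "p q = (fst q, \<zero>\<^bsub>K\<^esub>)" for q
  have p_closed: "p q \<in> carrier (hsum H K)" if "q \<in> carrier (hsum H K)" for q using that by (auto simp: p_def)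
  let ?L = "{q \<in> W. p q \<in> W}"
  have gen: "sum.generating ?L"
  proof (rule sum.generating_restrict[OF _ _ _ W])
    show "linear_op (hsum H K) (hsum H K) p" by (auto simp: linear_op_def p_def K.smult_r_null)
    fix q assume q: "q \<in> carrier (hsum H K)"
    show "hnorm (hsum H K) (p q) \<le> hnorm (hsum H K) q"
      using hnorm_hsum_ge(1)[OF HK_ips q] hnorm_hsum_ge(3)[OF HK_ips p_closed[OF q]] by (simp add: p_def)
    show "p (pair_op T T' i q) = pair_op T T' i (p q)" for i
      by (simp add: p_def pair_op_def K.T)
  qed
  have L: "fst q \<in> ?V \<and> snd q \<in> ?V'" if q: "q \<in> ?L" for q
  proof -
    have "q \<in> carrier (hsum H K)" using q WHK(1) by blast
    then have cl: "fst q \<in> carrier H" "snd q \<in> carrier K" by auto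
    have "q \<ominus>\<^bsub>hsum H K\<^esub> p q \<in> W"
      using q by (intro sum.subspace_minus[OF sum.onbD(1)[OF W(1)]]) auto
    moreover have "q \<ominus>\<^bsub>hsum H K\<^esub> p q = (\<zero>\<^bsub>H\<^esub>, snd q)"
      using minus_hsum[OF HK_ips, of q "p q"] cl by (simp add: p_def mem_Times_iff)
    ultimately show ?thesis using q cl by (simp add: p_def)
  qed
  show "H.generating ?V"
  proof (rule H.generatingI)
    fix x and e :: real assume x: "x \<in> carrier H" and e: "e > 0"
    then have x0: "(x, \<zero>\<^bsub>K\<^esub>) \<in> carrier (hsum H K)" by simp
    obtain t where t: "labels t \<subseteq> ?L" "hnorm (hsum H K) ((x, \<zero>\<^bsub>K\<^esub>) \<ominus>\<^bsub>hsum H K\<^esub> sum.ev t) < e"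
      using sum.generatingD[OF gen x0 e] by blast
    have cl: "sum.ev t \<in> carrier (hsum H K)" using t(1) WHK(1) by (intro sum.ev_closed) blast
    have "labels (map_dtree fst t) \<subseteq> ?V"
      unfolding dtree.set_map using t(1) L by blast
    moreover have "hnorm H (x \<ominus>\<^bsub>H\<^esub> H.ev (map_dtree fst t)) < e"
      using hnorm_hsum_ge(1)[OF HK_ips sum.M.minus_closed[OF x0 cl]] t(2)
      unfolding minus_hsum[OF HK_ips x0 cl] by (simp add: ev_sum)
    ultimately show "\<exists>t. labels t \<subseteq> ?V \<and> hnorm H (x \<ominus>\<^bsub>H\<^esub> H.ev t) < e" by blast
  qed auto
  show "K.generating ?V'"
  proof (rule K.generatingI)
    fix y and e :: real assume y: "y \<in> carrier K" and e: "e > 0"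
    then have y0: "(\<zero>\<^bsub>H\<^esub>, y) \<in> carrier (hsum H K)" by simp
    obtain t where t: "labels t \<subseteq> ?L" "hnorm (hsum H K) ((\<zero>\<^bsub>H\<^esub>, y) \<ominus>\<^bsub>hsum H K\<^esub> sum.ev t) < e"
      using sum.generatingD[OF gen y0 e] by blast
    have cl: "sum.ev t \<in> carrier (hsum H K)" using t(1) WHK(1) by (intro sum.ev_closed) blast
    have "labels (map_dtree snd t) \<subseteq> ?V'"
      unfolding dtree.set_map using t(1) L by blast
    moreover have "hnorm K (y \<ominus>\<^bsub>K\<^esub> K.ev (map_dtree snd t)) < e"
      using hnorm_hsum_ge(2)[OF HK_ips sum.M.minus_closed[OF y0 cl]] t(2)
      unfolding minus_hsum[OF HK_ips y0 cl] by (simp add: ev_sum)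
    ultimately show "\<exists>t. labels t \<subseteq> ?V' \<and> hnorm K (y \<ominus>\<^bsub>K\<^esub> K.ev t) < e" by blast
  qed auto
qed

lemma T_invariant_sections:
  assumes "sum.T_invariant W"
  shows "H.T_invariant {x \<in> carrier H. (x, \<zero>\<^bsub>K\<^esub>) \<in> W}" "K.T_invariant {y \<in> carrier K. (\<zero>\<^bsub>H\<^esub>, y) \<in> W}"
  using sum.T_invariantD[OF assms] unfolding H.T_invariant_def K.T_invariant_def
  by (fastforce simp: pair_op_def H.T K.T)+

end

section \<open>Representations coming from Cuntz systems\<close>

fun sys_rep :: "'a hspace \<Rightarrow> (bool \<Rightarrow> 'a \<Rightarrow> 'a) \<Rightarrow> elem \<Rightarrow> 'a \<Rightarrow> 'a" where
  "sys_rep H S (Gen i) = S i"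
| "sys_rep H S (Homeo v) = V_op H S v"

lemma Pi_rep_eq_sys_rep: "Pi_rep H A B = sys_rep (Pi_space H A B) (Pi_gen H A B)"
proof
  fix g show "Pi_rep H A B g = sys_rep (Pi_space H A B) (Pi_gen H A B) g" by (cases g) simp_all
qed

lemma elems_cases:
  assumes "g \<in> elems X"
  obtains i where "g = Gen i" | v where "g = Homeo v" "v \<in> thompson_V"
  using assms thompson_F_subset_T thompson_T_subset_V by (cases X) auto

lemma elems_group:
  assumes "X \<noteq> Cuntz" "v \<in> thompson_F"
  shows "Homeo v \<in> elems X"
  using assms thompson_F_subset_T thompson_T_subset_V by (cases X) auto

lemma (in cuntz_system) sys_rep_closed: "\<lbrakk>g \<in> elems X; x \<in> carrier H\<rbrakk> \<Longrightarrow> sys_rep H S g x \<in> carrier H"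
  by (erule elems_cases) (simp_all add: V_op_closed)

lemma (in cuntz_pair) rep_equiv_sys_rep:
  assumes int: "\<And>i x. x \<in> carrier H \<Longrightarrow> U (T i x) = T' i (U x)"
  shows "rep_equiv X H (sys_rep H S) K (sys_rep K S')"
proof -
  have "U (sys_rep H S g x) = sys_rep K S' g (U x)" if "g \<in> elems X" "x \<in> carrier H" for g x
    using that(1)
  proof (cases rule: elems_cases)
    case (1 i)
    then show ?thesis using that(2) intertwines_S_iff_T int by simp
  next
    case (2 v)
    then show ?thesis using U_V_op[OF int] that(2) by simp
  qed
  then show ?thesis using U unfolding rep_equiv_def by blast
qed

lemma (in cuntz_sum) rep_sum_sys_rep:
  assumes g: "g \<in> elems X" and p: "p \<in> carrier (hsum H K)"
  shows "rep_sum (sys_rep H S) (sys_rep K S') g p = sys_rep (hsum H K) (pair_op S S') g p"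
  using g by (cases rule: elems_cases) (simp_all add: rep_sum_def V_op_sum[OF _ p] pair_op_def split_beta)

lemma rep_equiv_trans:
  assumes "rep_equiv X H \<sigma> K \<rho>" "rep_equiv X K \<rho> L \<tau>"
  shows "rep_equiv X H \<sigma> L \<tau>"
proof -
  obtain U W where U: "unitary_op H K U" "\<And>g x. \<lbrakk>g \<in> elems X; x \<in> carrier H\<rbrakk> \<Longrightarrow> U (\<sigma> g x) = \<rho> g (U x)"
    and W: "unitary_op K L W" "\<And>g x. \<lbrakk>g \<in> elems X; x \<in> carrier K\<rbrakk> \<Longrightarrow> W (\<rho> g x) = \<tau> g (W x)"
    using assms unfolding rep_equiv_def by blast
  have "(W \<circ> U) (\<sigma> g x) = \<tau> g ((W \<circ> U) x)" if "g \<in> elems X" "x \<in> carrier H" for g x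
    using that U(2) W(2) unitary_opD(3)[OF U(1)] by simp
  then show ?thesis unfolding rep_equiv_def using unitary_op_compose[OF U(1) W(1)] by blast
qed

lemma rep_equiv_sym:
  assumes H: "inner_product_space H" and K: "inner_product_space K" and eq: "rep_equiv X H \<sigma> K \<rho>"
    and \<sigma>: "\<And>g x. \<lbrakk>g \<in> elems X; x \<in> carrier H\<rbrakk> \<Longrightarrow> \<sigma> g x \<in> carrier H"
  shows "rep_equiv X K \<rho> H \<sigma>"
proof -
  obtain U where U: "unitary_op H K U" "\<And>g x. \<lbrakk>g \<in> elems X; x \<in> carrier H\<rbrakk> \<Longrightarrow> U (\<sigma> g x) = \<rho> g (U x)"
    using eq unfolding rep_equiv_def by blast
  let ?V = "the_inv_into (carrier H) U"
  note V = unitary_op_inverse[OF H K U(1)]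
  have "?V (\<rho> g y) = \<sigma> g (?V y)" if g: "g \<in> elems X" and y: "y \<in> carrier K" for g y
  proof -
    have Vy: "?V y \<in> carrier H" using V(1) y by (rule unitary_opD(3))
    have "\<rho> g y = U (\<sigma> g (?V y))" using U(2)[OF g Vy] V(3)[OF y] by simp
    then show ?thesis using V(2) \<sigma>[OF g Vy] by simp
  qed
  then show ?thesis unfolding rep_equiv_def using V(1) by blast
qed

lemma rep_equiv_sum:
  assumes ips: "inner_product_space H" "inner_product_space K" "inner_product_space H'" "inner_product_space K'"
    and "rep_equiv X H \<sigma> H' \<sigma>'" "rep_equiv X K \<rho> K' \<rho>'"
  shows "rep_equiv X (hsum H K) (rep_sum \<sigma> \<rho>) (hsum H' K') (rep_sum \<sigma>' \<rho>')"
proof -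
  obtain U W where U: "unitary_op H H' U" "\<And>g x. \<lbrakk>g \<in> elems X; x \<in> carrier H\<rbrakk> \<Longrightarrow> U (\<sigma> g x) = \<sigma>' g (U x)"
    and W: "unitary_op K K' W" "\<And>g x. \<lbrakk>g \<in> elems X; x \<in> carrier K\<rbrakk> \<Longrightarrow> W (\<rho> g x) = \<rho>' g (W x)"
    using assms unfolding rep_equiv_def by blast
  define Z where "Z p = (U (fst p), W (snd p))" for p
  have "unitary_op (hsum H K) (hsum H' K') Z"
  proof (rule unitary_opI)
    fix q assume "q \<in> carrier (hsum H' K')"
    then have q: "fst q \<in> carrier H'" "snd q \<in> carrier K'" by auto
    obtain x where x: "x \<in> carrier H" "fst q = U x" by (rule unitary_op_surj[OF U(1) q(1)])
    obtain y where y: "y \<in> carrier K" "snd q = W y" by (rule unitary_op_surj[OF W(1) q(2)])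
    have "Z (x, y) = q" using x y by (simp add: Z_def prod_eq_iff)
    then show "\<exists>p\<in>carrier (hsum H K). Z p = q" using x y by (intro bexI[of _ "(x, y)"]) simp_all
  qed (use ips in \<open>auto simp: Z_def unitary_opD[OF U(1)] unitary_opD[OF W(1)] inner_product_space_hsum\<close>)
  moreover have "Z (rep_sum \<sigma> \<rho> g p) = rep_sum \<sigma>' \<rho>' g (Z p)" if "g \<in> elems X" "p \<in> carrier (hsum H K)" for g p
    using that U(2) W(2) by (auto simp: Z_def rep_sum_def)
  ultimately show ?thesis unfolding rep_equiv_def by blast
qed

lemma rep_equiv_cong:
  assumes "rep_equiv X H \<sigma> K \<rho>" "\<And>g x. \<lbrakk>g \<in> elems X; x \<in> carrier H\<rbrakk> \<Longrightarrow> \<sigma>' g x = \<sigma> g x"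
    "\<And>g y. \<lbrakk>g \<in> elems X; y \<in> carrier K\<rbrakk> \<Longrightarrow> \<rho>' g y = \<rho> g y"
  shows "rep_equiv X H \<sigma>' K \<rho>'"
  using assms unfolding rep_equiv_def by (metis unitary_opD(3))

section \<open>P-dimensions\<close>

text \<open>
  The P-dimension is the least element of this set, and infinite if the set is empty (\<open>dim_P_eq\<close>).
\<close>

definition P_dims :: "group_or_algebra \<Rightarrow> 'a hspace \<Rightarrow> (elem \<Rightarrow> 'a \<Rightarrow> 'a) \<Rightarrow> nat set" where
  "P_dims X H \<sigma> = {n. \<exists>(C :: (nat \<Rightarrow> complex) hspace) A B.
     P_module C A B \<and> has_dim C n \<and> rep_equiv X (Pi_space C A B) (Pi_rep C A B) H \<sigma>}"

lemma P_mod_if_P_module: "P_module H A B \<Longrightarrow> P_mod H A B"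
  unfolding P_module_iff P_mod_def P_mod_axioms_def by blast

lemma (in cuntz_system) P_dims_if_generating:
  assumes "onb W e n" "T_invariant W" "generating W" and eq: "rep_equiv X H (sys_rep H S) L \<sigma>"
  shows "n \<in> P_dims X L \<sigma>"
proof -
  obtain C :: "(nat \<Rightarrow> complex) hspace" and A B U where P: "P_module C A B" "has_dim C n"
    and U: "unitary_op (Pi_space C A B) H U" "\<And>i x. x \<in> carrier (Pi_space C A B) \<Longrightarrow> U (tau C A B i x) = T i (U x)"
    using realization[OF assms(1-3)] by blast
  interpret P: P_mod C A B using P(1) by (rule P_mod_if_P_module)
  interpret pair: cuntz_pair "Pi_space C A B" "Pi_gen C A B" "tau C A B" H S T U
    by (intro cuntz_pair.intro cuntz_pair_axioms.intro P.cuntz_system_Pi cuntz_system_axioms U(1))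
  have "rep_equiv X (Pi_space C A B) (Pi_rep C A B) L \<sigma>"
    unfolding Pi_rep_eq_sys_rep using pair.rep_equiv_sys_rep[OF U(2)] eq by (rule rep_equiv_trans)
  with P show ?thesis unfolding P_dims_def by blast
qed

lemma (in P_mod) Pi_onb:
  assumes "has_dim H n"
  obtains e where "inner_product_space.onb (Pi_space H A B) (iota ` carrier H) e n"
proof -
  interpret Pi: cuntz_system "Pi_space H A B" "Pi_gen H A B" "tau H A B" by (rule cuntz_system_Pi)
  obtain e where e: "onb (carrier H) e n" using assms has_dim_iff_onb by blast
  have "inner_product_space.onb (Pi_space H A B) (iota ` carrier H) (iota \<circ> e) n"
    using onb_isometric_image[OF inner_product_space_axioms Pi.inner_product_space_axioms linear_iota hinner_iota e] .
  then show ?thesis by (rule that)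
qed

lemma (in P_mod) Pi_vanishing_if_diffuse:
  assumes "diffuse H A B" "x \<in> carrier (Pi_space H A B)"
  shows "cuntz_system.vanishing (Pi_space H A B) (tau H A B) x"
proof -
  interpret Pi: cuntz_system "Pi_space H A B" "Pi_gen H A B" "tau H A B" by (rule cuntz_system_Pi)
  show ?thesis
  proof (rule Pi.vanishing_if_generating[OF generating_iota _ assms(2)])
    fix y assume "y \<in> iota ` carrier H"
    then obtain x where x: "x \<in> carrier H" "y = iota x" by blast
    show "Pi.vanishing y"
      unfolding Pi.vanishing_def
    proof
      fix i
      have cl: "iter_op A B (\<lambda>_. i) n x \<in> carrier H" for n
        using x by (induction n) (auto simp: A B)
      have "fold (tau H A B) (replicate n i) (iota x) = iota (iter_op A B (\<lambda>_. i) n x)" for n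
      proof (induction n)
        case (Suc n)
        have "fold (tau H A B) (replicate (Suc n) i) (iota x) = tau H A B i (fold (tau H A B) (replicate n i) (iota x))"
          by (simp only: replicate_append_same[symmetric] replicate_Suc fold_append comp_apply fold_simps)
        then show ?case using Suc cl by (simp add: tau_iota)
      qed simp
      moreover have "(\<lambda>n. hnorm H (iter_op A B (\<lambda>_. i) n x \<ominus> \<zero>)) \<longlonglongrightarrow> 0"
        using assms(1) x(1) unfolding diffuse_def hlim_def by blast
      then have "(\<lambda>n. hnorm H (iter_op A B (\<lambda>_. i) n x)) \<longlonglongrightarrow> 0"
        by (simp add: cl)
      ultimately show "(\<lambda>n. hnorm (Pi_space H A B) (fold (tau H A B) (replicate n i) y)) \<longlonglongrightarrow> 0"
        using cl by (simp add: x hnorm_def hinner_iota)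
    qed
  qed
qed

lemma (in cuntz_pair) generating_image:
  assumes int: "\<And>i x. x \<in> carrier H \<Longrightarrow> U (T i x) = T' i (U x)" and W: "H.generating W"
  shows "K.generating (U ` W)"
proof (rule K.generatingI)
  have WH: "W \<subseteq> carrier H" using W by (simp add: H.generating_def)
  then show "U ` W \<subseteq> carrier K" by auto
  have ev: "K.ev (map_dtree U t) = U (H.ev t)" if "labels t \<subseteq> carrier H" for t
    using that intertwines_S_iff_T int by (induction t) (simp_all add: U_lin)
  fix y and e :: real assume "y \<in> carrier K" and e: "e > 0"
  then obtain x where x: "x \<in> carrier H" "y = U x" using unitary_op_surj[OF U] by metis
  obtain t where t: "labels t \<subseteq> W" "hnorm H (x \<ominus>\<^bsub>H\<^esub> H.ev t) < e" by (rule H.generatingD[OF W x(1) e])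
  have cl: "H.ev t \<in> carrier H" "labels t \<subseteq> carrier H" using t(1) WH by (auto intro!: H.ev_closed)
  have "U x \<ominus>\<^bsub>K\<^esub> U (H.ev t) = U (x \<ominus>\<^bsub>H\<^esub> H.ev t)"
    using linear_op_minus[OF H.inner_product_space_axioms K.inner_product_space_axioms unitary_opD(1)[OF U] x(1) cl(1)] by simp
  then have "hnorm K (y \<ominus>\<^bsub>K\<^esub> K.ev (map_dtree U t)) < e"
    using t(2) x cl unitary_op_hnorm[OF U, of "x \<ominus>\<^bsub>H\<^esub> H.ev t"] by (simp add: ev)
  moreover have "labels (map_dtree U t) \<subseteq> U ` W" using t(1) by (auto simp: dtree.set_map)
  ultimately show "\<exists>t. labels t \<subseteq> U ` W \<and> hnorm K (y \<ominus>\<^bsub>K\<^esub> K.ev t) < e" by blast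
qed

lemma P_dims_add:
  assumes ips: "inner_product_space H" "inner_product_space K"
    and n: "n \<in> P_dims X H \<sigma>" and m: "m \<in> P_dims X K \<rho>"
  shows "n + m \<in> P_dims X (hsum H K) (rep_sum \<sigma> \<rho>)"
proof -
  obtain C1 :: "(nat \<Rightarrow> complex) hspace" and A1 B1 where C1: "P_module C1 A1 B1" "has_dim C1 n"
    "rep_equiv X (Pi_space C1 A1 B1) (Pi_rep C1 A1 B1) H \<sigma>"
    using n unfolding P_dims_def by blast
  obtain C2 :: "(nat \<Rightarrow> complex) hspace" and A2 B2 where C2: "P_module C2 A2 B2" "has_dim C2 m"
    "rep_equiv X (Pi_space C2 A2 B2) (Pi_rep C2 A2 B2) K \<rho>"
    using m unfolding P_dims_def by blast
  interpret P1: P_mod C1 A1 B1 using C1(1) by (rule P_mod_if_P_module)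
  interpret P2: P_mod C2 A2 B2 using C2(1) by (rule P_mod_if_P_module)
  interpret S: cuntz_sum "Pi_space C1 A1 B1" "Pi_gen C1 A1 B1" "tau C1 A1 B1"
      "Pi_space C2 A2 B2" "Pi_gen C2 A2 B2" "tau C2 A2 B2"
    by (intro cuntz_sum.intro P1.cuntz_system_Pi P2.cuntz_system_Pi)
  obtain e where e: "S.H.onb (P1.iota ` carrier C1) e n" by (rule P1.Pi_onb[OF C1(2)])
  obtain f where f: "S.K.onb (P2.iota ` carrier C2) f m" by (rule P2.Pi_onb[OF C2(2)])
  show ?thesis
  proof (rule S.sum.P_dims_if_generating[OF S.onb_Times[OF e f]])
    show "S.sum.T_invariant (P1.iota ` carrier C1 \<times> P2.iota ` carrier C2)"
      by (intro S.T_invariant_Times P1.T_invariant_iota P2.T_invariant_iota)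
    show "S.sum.generating (P1.iota ` carrier C1 \<times> P2.iota ` carrier C2)"
      by (intro S.generating_Times P1.T_invariant_iota P2.T_invariant_iota P1.generating_iota P2.generating_iota)
    have "rep_equiv X (hsum (Pi_space C1 A1 B1) (Pi_space C2 A2 B2))
        (rep_sum (Pi_rep C1 A1 B1) (Pi_rep C2 A2 B2)) (hsum H K) (rep_sum \<sigma> \<rho>)"
      by (rule rep_equiv_sum[OF S.HK_ips ips C1(3) C2(3)])
    then show "rep_equiv X (hsum (Pi_space C1 A1 B1) (Pi_space C2 A2 B2))
        (sys_rep (hsum (Pi_space C1 A1 B1) (Pi_space C2 A2 B2)) (pair_op (Pi_gen C1 A1 B1) (Pi_gen C2 A2 B2)))
        (hsum H K) (rep_sum \<sigma> \<rho>)"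
      by (rule rep_equiv_cong) (simp_all only: S.rep_sum_sys_rep Pi_rep_eq_sys_rep)
  qed
qed

text \<open>
  A finite dimensional P-module which realizes the direct sum is moved by the equivalence \<open>U\<close> to a
  generating subspace \<open>W\<close> of the direct sum of the two diffuse representations. For the groups \<open>U\<close>
  intertwines the Cuntz systems because the target is vanishing. The sections of \<open>W\<close> then realize the
  two summands.
\<close>

theorem P_dims_split:
  fixes H :: "'a hspace" and K :: "'b hspace"
  assumes 1: "diffuse_pythagorean TYPE('m) X H \<sigma>" and 2: "diffuse_pythagorean TYPE('k) X K \<rho>"
    and ips: "inner_product_space H" "inner_product_space K"
    and n: "n \<in> P_dims X (hsum H K) (rep_sum \<sigma> \<rho>)"
  obtains k m where "k \<in> P_dims X H \<sigma>" "m \<in> P_dims X K \<rho>" "k + m \<le> n"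
proof -
  obtain C1 :: "'m hspace" and A1 B1 where C1: "P_module C1 A1 B1" "diffuse C1 A1 B1"
    "rep_equiv X (Pi_space C1 A1 B1) (Pi_rep C1 A1 B1) H \<sigma>"
    using 1 unfolding diffuse_pythagorean_def by blast
  obtain C2 :: "'k hspace" and A2 B2 where C2: "P_module C2 A2 B2" "diffuse C2 A2 B2"
    "rep_equiv X (Pi_space C2 A2 B2) (Pi_rep C2 A2 B2) K \<rho>"
    using 2 unfolding diffuse_pythagorean_def by blast
  obtain C :: "(nat \<Rightarrow> complex) hspace" and A B where C: "P_module C A B" "has_dim C n"
    "rep_equiv X (Pi_space C A B) (Pi_rep C A B) (hsum H K) (rep_sum \<sigma> \<rho>)"
    using n unfolding P_dims_def by blast
  interpret P: P_mod C A B using C(1) by (rule P_mod_if_P_module)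
  interpret P1: P_mod C1 A1 B1 using C1(1) by (rule P_mod_if_P_module)
  interpret P2: P_mod C2 A2 B2 using C2(1) by (rule P_mod_if_P_module)
  interpret S: cuntz_sum "Pi_space C1 A1 B1" "Pi_gen C1 A1 B1" "tau C1 A1 B1"
      "Pi_space C2 A2 B2" "Pi_gen C2 A2 B2" "tau C2 A2 B2"
    by (intro cuntz_sum.intro P1.cuntz_system_Pi P2.cuntz_system_Pi)
  let ?L = "hsum (Pi_space C1 A1 B1) (Pi_space C2 A2 B2)"
  let ?S = "pair_op (Pi_gen C1 A1 B1) (Pi_gen C2 A2 B2)"
  let ?T = "pair_op (tau C1 A1 B1) (tau C2 A2 B2)"
  have "rep_equiv X ?L (rep_sum (Pi_rep C1 A1 B1) (Pi_rep C2 A2 B2)) (hsum H K) (rep_sum \<sigma> \<rho>)"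
    by (rule rep_equiv_sum[OF S.HK_ips ips C1(3) C2(3)])
  then have "rep_equiv X ?L (sys_rep ?L ?S) (hsum H K) (rep_sum \<sigma> \<rho>)"
    by (rule rep_equiv_cong) (simp_all only: S.rep_sum_sys_rep Pi_rep_eq_sys_rep)
  then have "rep_equiv X (hsum H K) (rep_sum \<sigma> \<rho>) ?L (sys_rep ?L ?S)"
    by (rule rep_equiv_sym[OF S.sum.inner_product_space_axioms inner_product_space_hsum[OF ips]])
       (rule S.sum.sys_rep_closed)
  from rep_equiv_trans[OF C(3) this] obtain U where U: "unitary_op (Pi_space C A B) ?L U"
    and int: "\<And>g x. \<lbrakk>g \<in> elems X; x \<in> carrier (Pi_space C A B)\<rbrakk> \<Longrightarrow>
      U (sys_rep (Pi_space C A B) (Pi_gen C A B) g x) = sys_rep ?L ?S g (U x)"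
    unfolding rep_equiv_def Pi_rep_eq_sys_rep by blast
  interpret pair: cuntz_pair "Pi_space C A B" "Pi_gen C A B" "tau C A B" ?L ?S ?T U
    by (intro cuntz_pair.intro cuntz_pair_axioms.intro P.cuntz_system_Pi S.cuntz_system_sum U)
  obtain e where e: "pair.H.onb (P.iota ` carrier C) e n" by (rule P.Pi_onb[OF C(2)])
  have vanishing: "S.sum.vanishing p" if "p \<in> carrier ?L" for p
    using that P1.Pi_vanishing_if_diffuse[OF C1(2)] P2.Pi_vanishing_if_diffuse[OF C2(2)]
    by (intro S.vanishing_sum) auto
  have intT: "U (tau C A B i x) = ?T i (U x)" if x: "x \<in> carrier (Pi_space C A B)" for i x
  proof (cases "X = Cuntz")
    case True
    then show ?thesis using pair.intertwines_S_iff_T int[of "Gen i" for i] x by auto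
  next
    case False
    show ?thesis
    proof (rule pair.F_intertwiner_intertwines_T_if_finite_dimensional
        [OF e P.T_invariant_iota P.generating_iota vanishing _ x])
      fix v x assume "v \<in> thompson_F" "x \<in> carrier (Pi_space C A B)"
      then show "U (V_op (Pi_space C A B) (Pi_gen C A B) v x) = V_op ?L ?S v (U x)"
        using int[OF elems_group[OF False]] by simp
    qed
  qed
  let ?W = "U ` P.iota ` carrier C"
  have W: "S.sum.onb ?W (U \<circ> e) n"
    by (rule onb_isometric_image[OF pair.H.inner_product_space_axioms S.sum.inner_product_space_axioms
        unitary_opD(1)[OF U] pair.U_inner e])
  have gen: "S.sum.generating ?W" by (rule pair.generating_image[OF intT P.generating_iota])
  have inv: "S.sum.T_invariant ?W"
    unfolding S.sum.T_invariant_def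
  proof (intro allI ballI)
    fix i q assume "q \<in> ?W"
    then obtain x where x: "x \<in> P.iota ` carrier C" "q = U x" by blast
    then have "?T i q = U (tau C A B i x)" using intT P.iota_closed by auto
    then show "?T i q \<in> ?W" using pair.H.T_invariantD[OF P.T_invariant_iota x(1), of i] by simp
  qed
  obtain e1 k e2 m where
    V1: "S.H.onb {x \<in> carrier (Pi_space C1 A1 B1). (x, \<zero>\<^bsub>Pi_space C2 A2 B2\<^esub>) \<in> ?W} e1 k" and
    V2: "S.K.onb {y \<in> carrier (Pi_space C2 A2 B2). (\<zero>\<^bsub>Pi_space C1 A1 B1\<^esub>, y) \<in> ?W} e2 m" and km: "k + m \<le> n"
    by (rule S.sections_onb[OF W])
  have "k \<in> P_dims X H \<sigma>"
    using S.H.P_dims_if_generating[OF V1 S.T_invariant_sections(1)[OF inv] S.generating_sections(1)[OF W inv gen]]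
      C1(3) by (simp only: Pi_rep_eq_sys_rep)
  moreover have "m \<in> P_dims X K \<rho>"
    using S.K.P_dims_if_generating[OF V2 S.T_invariant_sections(2)[OF inv] S.generating_sections(2)[OF W inv gen]]
      C2(3) by (simp only: Pi_rep_eq_sys_rep)
  ultimately show ?thesis using km that by blast
qed

lemma dim_P_eq: "dim_P X H \<sigma> = (if P_dims X H \<sigma> = {} then \<infinity> else enat (LEAST n. n \<in> P_dims X H \<sigma>))"
proof -
  have eq: "dim_P X H \<sigma> = Inf (enat ` P_dims X H \<sigma>)"
    unfolding dim_P_def P_dims_def by (rule arg_cong[of _ _ Inf]) blast
  show ?thesis
  proof (cases "P_dims X H \<sigma> = {}")
    case False
    then have least: "(LEAST n. n \<in> P_dims X H \<sigma>) \<in> P_dims X H \<sigma>" by (auto intro: LeastI)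
    have "Inf (enat ` P_dims X H \<sigma>) = enat (LEAST n. n \<in> P_dims X H \<sigma>)"
      by (rule cInf_eq_minimum) (use least in \<open>auto intro: Least_le\<close>)
    then show ?thesis using False eq by simp
  qed (simp add: eq Inf_enat_def)
qed

lemma hilbert_space_if_is_rep: "is_rep X H \<sigma> \<Longrightarrow> hilbert_space H"
  by (cases X) (simp_all add: group_rep_def cuntz_rep_def)

theorem proposition4p9:
  fixes X :: group_or_algebra
    and H\<^sub>1 :: "'a hspace" and \<sigma>\<^sub>1 :: "elem \<Rightarrow> 'a \<Rightarrow> 'a"
    and H\<^sub>2 :: "'b hspace" and \<sigma>\<^sub>2 :: "elem \<Rightarrow> 'b \<Rightarrow> 'b"
  assumes "diffuse_pythagorean TYPE('m) X H\<^sub>1 \<sigma>\<^sub>1"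
    and "diffuse_pythagorean TYPE('k) X H\<^sub>2 \<sigma>\<^sub>2"
  shows "dim_P X (hsum H\<^sub>1 H\<^sub>2) (rep_sum \<sigma>\<^sub>1 \<sigma>\<^sub>2) = dim_P X H\<^sub>1 \<sigma>\<^sub>1 + dim_P X H\<^sub>2 \<sigma>\<^sub>2"
proof -
  have ips: "inner_product_space H\<^sub>1" "inner_product_space H\<^sub>2"
    using assms hilbert_space_if_is_rep hilbert_space.axioms(1) unfolding diffuse_pythagorean_def by blast+
  let ?D = "P_dims X (hsum H\<^sub>1 H\<^sub>2) (rep_sum \<sigma>\<^sub>1 \<sigma>\<^sub>2)" and ?D1 = "P_dims X H\<^sub>1 \<sigma>\<^sub>1" and ?D2 = "P_dims X H\<^sub>2 \<sigma>\<^sub>2"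
  have add: "n + m \<in> ?D" if "n \<in> ?D1" "m \<in> ?D2" for n m
    using P_dims_add[OF ips that] .
  have split: "\<exists>k\<in>?D1. \<exists>m\<in>?D2. k + m \<le> n" if "n \<in> ?D" for n
    using P_dims_split[OF assms ips that] by blast
  show ?thesis
  proof (cases "?D1 = {} \<or> ?D2 = {}")
    case True
    then have "?D = {}" using split by blast
    then show ?thesis using True by (auto simp: dim_P_eq)
  next
    case False
    let ?l = "\<lambda>D. LEAST n. n \<in> D"
    have l1: "?l ?D1 \<in> ?D1" and l2: "?l ?D2 \<in> ?D2" using False by (auto intro: LeastI)
    have "?l ?D = ?l ?D1 + ?l ?D2"
    proof (rule Least_equality)
      show "?l ?D1 + ?l ?D2 \<in> ?D" by (rule add[OF l1 l2])
      fix n assume "n \<in> ?D"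
      then obtain k m where "k \<in> ?D1" "m \<in> ?D2" "k + m \<le> n" using split by blast
      then show "?l ?D1 + ?l ?D2 \<le> n" using Least_le[of "\<lambda>n. n \<in> ?D1" k] Least_le[of "\<lambda>n. n \<in> ?D2" m] by linarith
    qed
    moreover have "?D \<noteq> {}" using add[OF l1 l2] by blast
    ultimately show ?thesis using False by (simp add: dim_P_eq)
  qed
qed

end
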